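(* Assume that $V\in C^1(\mathbb{R}^N)$ satisfies (V5) $V$ is $\mathbb{Z}^N$-periodic; (V6) $V(x)\ge0$, and $V(x)=0$ if and only if $x\in\mathbb{Z}^N$; and that $\nabla V$ is locally Lipschitz continuous in $\mathbb{R}^N$. For any sequence $(c_n)\subset(0,c_p)$ with $c_n\to0^+$, let $k_{c_n}\in\mathbb{N}$, $\{\xi_n^1,\ldots,\xi_n^{k_{c_n}}\}\subset\mathbb{Z}^N\setminus\{0\}$ and $q_{c_n,j}$ ($j=1,\ldots,k_{c_n}$, $q_{c_n,j}$ associated to $\xi_n^j$) be the integers, lattice points and solutions of $\ddot q=\nabla V(q)$ with energy $-c_n$ given by the inductive construction described in the context with $c=c_n$. Then, along a subsequence, we have that: (i) there exists $\kappa\in\mathbb{N}$ such that $k_{c_n}=\kappa$ for all $n\in\mathbb{N}$; (ii) there exist distinct elements $\hat\xi^1,\ldots,\hat\xi^\kappa$ in $\mathbb{Z}^N\setminus\{0\}$ such that $\{n_1\hat\xi^1+\ldots+n_\kappa\hat\xi^\kappa:n_1,\ldots,n_\kappa\in\mathbb{Z}\}=\mathbb{Z}^N$, and $$\xi_n^1=\hat\xi^1,\ \ldots,\ \xi_n^{k_{c_n}}=\hat\xi^\kappa\quad\text{for all } n\in\mathbb{N};$$ (iii) for any $j\in\{1,\ldots,\kappa\}$ there is a solution $q^j\in C^2(\mathbb{R},\mathbb{R}^N)$ of $\ddot q=\nabla V(q)$ of heteroclinic type between $0$ and $\hat\xi^j$ (i.e. $q^j(t)\to0$ as $t\to-\infty$,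 $q^j(t)\to\hat\xi^j$ as $t\to+\infty$, and $\dot q^j(t)\to0$ as $t\to\pm\infty$), and there exists $(\tau_{n,j})\subset\mathbb{R}$ such that $$q_{c_n,j}(\cdot-\tau_{n,j})\to q^j\quad\text{in } C^2_{loc}(\mathbb{R},\mathbb{R}^N),\ \text{ as } n\to+\infty.$$
   Context: $N\ge2$ is an integer; $\mathrm{dist}$ is Euclidean distance; $B_r(x)$ is the open ball; $\mathcal{V}^c:=\{x\in\mathbb{R}^N:V(x)\le c\}$. $c_p>0$ is fixed so that $\mathcal{V}^c\subset\bigcup_{\xi\in\mathbb{Z}^N}B_{1/3}(\xi)$ for any $c\in[0,c_p]$ (such $c_p$ exists). For $c\in[0,c_p)$ and $\xi\in\mathbb{Z}^N$, $\mathcal{V}^c_\xi:=\mathcal{V}^c\cap B_{1/3}(\xi)$. Let $M_p:=\frac12+\max_{|x|\le1}V(x)$. $R_p>0$ is a constant such that for any $c\in[0,c_p)$, if $q\in W^{1,2}_{loc}(\mathbb{R},\mathbb{R}^N)$ and $(\sigma,\tau)\subset\mathbb{R}$ satisfy $V(q(t))\ge c$ on $(\sigma,\tau)$ and $\int_\sigma^\tau\frac12|\dot q|^2+(V(q)-c)\,dt\le M_p+1$, then $|q(\tau)-q(\sigma)|\le R_p$ (such a constant exists). Variational setting for a decomposition $\mathcal{V}^c=\mathcal{V}^c_-\cup\mathcal{V}^c_+$ into nonempty closed sets at positive distance. $\Gamma_c$ is the set of $q\in H^1_{loc}(\mathbb{R},\mathbb{R}^N)$ such that $V(q(t))\ge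 c$ for all $t$ and $\liminf_{t\to-\infty}\mathrm{dist}(q(t),\mathcal{V}^c_-)=\liminf_{t\to+\infty}\mathrm{dist}(q(t),\mathcal{V}^c_+)=0$. $J_c(q):=\int_{\mathbb{R}}\tfrac12|\dot q|^2+(V(q)-c)\,dt$, $m_c:=\inf_{\Gamma_c}J_c$. Let $R>0$ be such that $m_c=\inf\{J_c(q):q\in\Gamma_c,\|q\|_{L^\infty}\le R\}$ (for the decompositions below, $R=R_p+1$ has this property), $4\rho_0:=\mathrm{dist}(\mathcal{V}^c_-\cap B_R(0),\mathcal{V}^c_+\cap B_R(0))>0$, and $\mathcal{M}_c:=\{q\in\Gamma_c:\mathrm{dist}(q(0),\mathcal{V}^c)=\rho_0,\ J_c(q)=m_c,\ \|q\|_{L^\infty}\le R\}\neq\emptyset$. For $q\in\mathcal{M}_c$ let $\alpha_q:=\sup\{t:q(t)\in\mathcal{V}^c_-\}$ if $q(\mathbb{R})\cap\mathcal{V}^c_-\ne\emptyset$, $\alpha_q:=-\infty$ otherwise; $\omega_q:=\inf\{t>\alpha_q:q(t)\in\mathcal{V}^c_+\}$ if $q(\mathbb{R})\cap\mathcal{V}^c_+\neq\emptyset$, $\omega_q:=+\infty$ otherwise. Minimization solution. Given $q\in\mathcal{M}_c$, the minimization solution generated by $q$ is the function $\bar q$ with: $\bar q=q$ if $\alpha_q=-\infty$, $\omega_q=+\infty$; if $\alpha_q=-\infty$ and $\omega_q<+\infty$, $\bar q=q$ on $(-\infty,\omega_q]$ extended by reflection about $\omega_q$; if $\alpha_q>-\infty$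 and $\omega_q=+\infty$, $\bar q=q$ on $[\alpha_q,+\infty)$ extended by reflection about $\alpha_q$; if both are finite, $\bar q=q$ on $[\alpha_q,\omega_q]$ extended by reflection about $\omega_q$ and then $2(\omega_q-\alpha_q)$-periodically. It is a $C^2$ solution of $\ddot q=\nabla V(q)$ on $\mathbb{R}$ with energy $\frac12|\dot{\bar q}|^2-V(\bar q)\equiv-c$. Inductive construction, for $c\in[0,c_p)$. Put $\mathcal{L}_0:=\{0\}$. Given $j\ge0$ and $\xi^1,\ldots,\xi^j$ with $\mathcal{L}_j:=\{\sum_{i=1}^jn_i\xi^i:n_i\in\mathbb{Z}\}\ne\mathbb{Z}^N$, consider the decomposition $\mathcal{V}^c_{-,j+1}:=\bigcup_{\xi\in\mathcal{L}_j}\mathcal{V}^c_\xi$, $\mathcal{V}^c_{+,j+1}:=\bigcup_{\xi\in\mathbb{Z}^N\setminus\mathcal{L}_j}\mathcal{V}^c_\xi$, and let $\bar q_{c,j+1}$ be a minimization solution for it, generated by some minimizer $q\in\mathcal{M}_c$, where $\mathcal{M}_c=\{q\in\Gamma_c:\mathrm{dist}(q(0),\mathcal{V}^c)=\rho_0,\ J_c(q)=m_c,\ \|q\|_{L^\infty}\le R\}$ and $\Gamma_c$, $m_c$, $R$, $\rho_0$, $\alpha_q$, $\omega_q$ are those corresponding to the choice $\mathcal{V}^c_-=\mathcal{V}^c_{-,j+1}$, $\mathcal{V}^c_+=\mathcal{V}^c_{+,j+1}$. There are $\xi_-\in\mathcal{L}_j$ and $\xi_+\in\mathbb{Z}^N\setminus\mathcal{L}_j$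 with $\lim_{t\to\alpha_q^+}\mathrm{dist}(\bar q_{c,j+1}(t),\mathcal{V}^c_{\xi_-})=0$ and $\lim_{t\to\omega_q^-}\mathrm{dist}(\bar q_{c,j+1}(t),\mathcal{V}^c_{\xi_+})=0$. Set $\xi^{j+1}:=\xi_+-\xi_-\in\mathbb{Z}^N\setminus\mathcal{L}_j$ and $q_{c,j+1}:=\bar q_{c,j+1}-\xi_-$. The construction stops at the first index $k_c$ with $\mathcal{L}_{k_c}=\mathbb{Z}^N$. It yields distinct $\xi^1,\ldots,\xi^{k_c}\in\mathbb{Z}^N\setminus\{0\}$ generating $\mathbb{Z}^N$ and solutions $q_{c,j}$ with energy $-c$, $\inf_t\mathrm{dist}(q_{c,j}(t),\mathcal{V}^c_0)=\inf_t\mathrm{dist}(q_{c,j}(t),\mathcal{V}^c_{\xi^j})=0$ and $\|q_{c,j}\|_{L^\infty}\le R_p+1$. *)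

theory Defs
  imports "HOL-Analysis.Analysis"
begin

definition int_lattice :: "(real ^ 'n) set" where
  "int_lattice = {x. \<forall>i. x $ i \<in> \<int>}"

definition lattice_span :: "(nat \<Rightarrow> real ^ 'n) \<Rightarrow> nat \<Rightarrow> (real ^ 'n) set" where
  "lattice_span \<xi> j = {\<Sum>i=1..j. real_of_int (m i) *\<^sub>R \<xi> i | m. True}"

definition sublevel :: "(real ^ 'n \<Rightarrow> real) \<Rightarrow> real \<Rightarrow> (real ^ 'n) set" where
  "sublevel V c = {x. V x \<le> c}"

definition sublevel_at :: "(real ^ 'n \<Rightarrow> real) \<Rightarrow> real \<Rightarrow> real ^ 'n \<Rightarrow> (real ^ 'n) set" where
  "sublevel_at V c \<xi> = sublevel V c \<inter> ball \<xi> (1/3)"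

definition admissible_cp :: "(real ^ 'n \<Rightarrow> real) \<Rightarrow> real \<Rightarrow> bool" where
  "admissible_cp V cp \<longleftrightarrow>
     cp > 0 \<and> (\<forall>c\<in>{0..cp}. sublevel V c \<subseteq> (\<Union>\<xi>\<in>int_lattice. ball \<xi> (1/3)))"

definition L2_loc :: "(real \<Rightarrow> 'a::euclidean_space) \<Rightarrow> bool" where
  "L2_loc f \<longleftrightarrow> f \<in> borel_measurable borel \<and>
     (\<forall>a b. set_integrable lborel {a..b} (\<lambda>t. (norm (f t))\<^sup>2))"

definition test_function :: "(real \<Rightarrow> real) \<Rightarrow> bool" where
  "test_function \<phi> \<longleftrightarrow> \<phi> C1_differentiable_on UNIV \<and> compact (closure {t. \<phi> t \<noteq> 0})"

definition has_weak_deriv :: "(real \<Rightarrow> 'a::euclidean_space) \<Rightarrow> (real \<Rightarrow> 'a) \<Rightarrow> bool" where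
  "has_weak_deriv q g \<longleftrightarrow>
     (\<forall>\<phi>. test_function \<phi> \<longrightarrow>
        (LBINT t. deriv \<phi> t *\<^sub>R q t) = - (LBINT t. \<phi> t *\<^sub>R g t))"

text \<open>Pointwise values of a Sobolev function of one variable are those of its continuous
  representative, so continuity is part of the definition.\<close>

definition H1_loc :: "(real \<Rightarrow> 'a::euclidean_space) \<Rightarrow> bool" where
  "H1_loc q \<longleftrightarrow> continuous_on UNIV q \<and> L2_loc q \<and> (\<exists>g. L2_loc g \<and> has_weak_deriv q g)"

text \<open>The weak derivative is unique almost everywhere; the chosen representative only
  enters through integrals.\<close>

definition weak_deriv :: "(real \<Rightarrow> 'a::euclidean_space) \<Rightarrow> real \<Rightarrow> 'a" where
  "weak_deriv q = (SOME g. L2_loc g \<and> has_weak_deriv q g)"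

text \<open>The integrand is nonnegative wherever \<^term>\<open>V (q t) \<ge> c\<close>, which is required of all
  paths for which the action is used; hence the value in \<^typ>\<open>ennreal\<close> is the usual integral.\<close>

definition action_on ::
    "(real ^ 'n \<Rightarrow> real) \<Rightarrow> real \<Rightarrow> real set \<Rightarrow> (real \<Rightarrow> real ^ 'n) \<Rightarrow> ennreal" where
  "action_on V c S q =
     (\<integral>\<^sup>+t\<in>S. ennreal (1/2 * (norm (weak_deriv q t))\<^sup>2 + (V (q t) - c)) \<partial>lborel)"

definition M_p :: "(real ^ 'n \<Rightarrow> real) \<Rightarrow> real" where
  "M_p V = 1/2 + (SUP x\<in>cball 0 1. V x)"

definition admissible_Rp :: "(real ^ 'n \<Rightarrow> real) \<Rightarrow> real \<Rightarrow> real \<Rightarrow> bool" where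
  "admissible_Rp V cp Rp \<longleftrightarrow> Rp > 0 \<and>
     (\<forall>c\<in>{0..<cp}. \<forall>q \<sigma> \<tau>.
        H1_loc q \<and> \<sigma> < \<tau> \<and> (\<forall>t\<in>{\<sigma><..<\<tau>}. V (q t) \<ge> c) \<and>
        action_on V c {\<sigma><..<\<tau>} q \<le> ennreal (M_p V + 1)
        \<longrightarrow> norm (q \<tau> - q \<sigma>) \<le> Rp)"

definition Gamma_paths ::
    "(real ^ 'n \<Rightarrow> real) \<Rightarrow> real \<Rightarrow> (real ^ 'n) set \<Rightarrow> (real ^ 'n) set \<Rightarrow> (real \<Rightarrow> real ^ 'n) set" where
  "Gamma_paths V c A B = {q. H1_loc q \<and> (\<forall>t. V (q t) \<ge> c) \<and>
     Liminf at_bot (\<lambda>t. ereal (infdist (q t) A)) = 0 \<and>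
     Liminf at_top (\<lambda>t. ereal (infdist (q t) B)) = 0}"

definition min_action ::
    "(real ^ 'n \<Rightarrow> real) \<Rightarrow> real \<Rightarrow> (real ^ 'n) set \<Rightarrow> (real ^ 'n) set \<Rightarrow> ennreal" where
  "min_action V c A B = (INF q\<in>Gamma_paths V c A B. action_on V c UNIV q)"

definition rho0 :: "real \<Rightarrow> (real ^ 'n) set \<Rightarrow> (real ^ 'n) set \<Rightarrow> real" where
  "rho0 R A B = setdist (A \<inter> ball 0 R) (B \<inter> ball 0 R) / 4"

text \<open>As the paths are continuous, the \<open>L\<^sup>\<infinity>\<close> bound is a pointwise bound.\<close>

definition minimizers ::
    "(real ^ 'n \<Rightarrow> real) \<Rightarrow> real \<Rightarrow> real \<Rightarrow> (real ^ 'n) set \<Rightarrow> (real ^ 'n) set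
     \<Rightarrow> (real \<Rightarrow> real ^ 'n) set" where
  "minimizers V c R A B = {q \<in> Gamma_paths V c A B.
     infdist (q 0) (sublevel V c) = rho0 R A B \<and>
     action_on V c UNIV q = min_action V c A B \<and> (\<forall>t. norm (q t) \<le> R)}"

text \<open>In \<^typ>\<open>ereal\<close>, \<open>Sup {} = -\<infinity>\<close> and \<open>Inf {} = \<infinity>\<close>, which are the values
  prescribed when the path does not meet the set.\<close>

definition alpha_time :: "(real ^ 'n) set \<Rightarrow> (real \<Rightarrow> real ^ 'n) \<Rightarrow> ereal" where
  "alpha_time A q = Sup (ereal ` {t. q t \<in> A})"

definition omega_time ::
    "(real ^ 'n) set \<Rightarrow> (real ^ 'n) set \<Rightarrow> (real \<Rightarrow> real ^ 'n) \<Rightarrow> ereal" where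
  "omega_time A B q = Inf (ereal ` {t. ereal t > alpha_time A q \<and> q t \<in> B})"

text \<open>\<open>extends_by_reflection \<alpha> \<omega> q p\<close>: the function \<open>p\<close> is obtained from the restriction of
  \<open>q\<close> to the (possibly unbounded) interval from \<open>\<alpha>\<close> to \<open>\<omega>\<close> by reflecting about
  its finite endpoints.\<close>

definition extends_by_reflection ::
    "ereal \<Rightarrow> ereal \<Rightarrow> (real \<Rightarrow> 'a) \<Rightarrow> (real \<Rightarrow> 'a) \<Rightarrow> bool" where
  "extends_by_reflection \<alpha> \<omega> q p \<longleftrightarrow>
     (\<alpha> = -\<infinity> \<and> \<omega> = \<infinity> \<and> p = q) \<or>
     (\<exists>w. \<alpha> = -\<infinity> \<and> \<omega> = ereal w \<and> (\<forall>t\<le>w. p t = q t \<and> p (2 * w - t) = q t)) \<or>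
     (\<exists>a. \<alpha> = ereal a \<and> \<omega> = \<infinity> \<and> (\<forall>t\<ge>a. p t = q t \<and> p (2 * a - t) = q t)) \<or>
     (\<exists>a w. \<alpha> = ereal a \<and> \<omega> = ereal w \<and>
        (\<forall>t\<in>{a..w}. p t = q t \<and> p (2 * w - t) = q t) \<and>
        (\<forall>t. p (t + 2 * (w - a)) = p t))"

definition minimization_solution ::
    "(real ^ 'n) set \<Rightarrow> (real ^ 'n) set \<Rightarrow> (real \<Rightarrow> real ^ 'n) \<Rightarrow> (real \<Rightarrow> real ^ 'n) \<Rightarrow> bool" where
  "minimization_solution A B q p \<longleftrightarrow>
     extends_by_reflection (alpha_time A q) (omega_time A B q) q p"

definition right_of :: "ereal \<Rightarrow> real filter" where
  "right_of \<alpha> = (if \<alpha> = -\<infinity> then at_bot else at_right (real_of_ereal \<alpha>))"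

definition left_of :: "ereal \<Rightarrow> real filter" where
  "left_of \<omega> = (if \<omega> = \<infinity> then at_top else at_left (real_of_ereal \<omega>))"

definition V_minus ::
    "(real ^ 'n \<Rightarrow> real) \<Rightarrow> real \<Rightarrow> (nat \<Rightarrow> real ^ 'n) \<Rightarrow> nat \<Rightarrow> (real ^ 'n) set" where
  "V_minus V c \<xi> j = (\<Union>\<eta>\<in>lattice_span \<xi> j. sublevel_at V c \<eta>)"

definition V_plus ::
    "(real ^ 'n \<Rightarrow> real) \<Rightarrow> real \<Rightarrow> (nat \<Rightarrow> real ^ 'n) \<Rightarrow> nat \<Rightarrow> (real ^ 'n) set" where
  "V_plus V c \<xi> j = (\<Union>\<eta>\<in>int_lattice - lattice_span \<xi> j. sublevel_at V c \<eta>)"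

text \<open>The step from \<open>\<xi>\<^sup>1, \<dots>, \<xi>\<^sup>j\<close> to a next lattice point \<open>\<zeta>\<close> and connecting orbit \<open>u\<close>;
  the radius \<open>R\<close> of the variational setting is \<open>Rp + 1\<close>.\<close>

definition construction_step ::
    "(real ^ 'n \<Rightarrow> real) \<Rightarrow> real \<Rightarrow> real \<Rightarrow> (nat \<Rightarrow> real ^ 'n) \<Rightarrow> nat
     \<Rightarrow> real ^ 'n \<Rightarrow> (real \<Rightarrow> real ^ 'n) \<Rightarrow> bool" where
  "construction_step V Rp c \<xi> j \<zeta> u \<longleftrightarrow>
     (let A = V_minus V c \<xi> j; B = V_plus V c \<xi> j in
      \<exists>q \<in> minimizers V c (Rp + 1) A B. \<exists>p.
        minimization_solution A B q p \<and>
        (\<exists>\<eta> \<in> lattice_span \<xi> j. \<exists>\<theta> \<in> int_lattice - lattice_span \<xi> j.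
           ((\<lambda>t. infdist (p t) (sublevel_at V c \<eta>)) \<longlongrightarrow> 0) (right_of (alpha_time A q)) \<and>
           ((\<lambda>t. infdist (p t) (sublevel_at V c \<theta>)) \<longlongrightarrow> 0) (left_of (omega_time A B q)) \<and>
           \<zeta> = \<theta> - \<eta> \<and> u = (\<lambda>t. p t - \<eta>)))"

text \<open>A complete run; \<open>\<xi> j\<close> and \<open>u j\<close> are relevant for \<open>j = 1, \<dots>, k\<close> only.\<close>

definition construction ::
    "(real ^ 'n \<Rightarrow> real) \<Rightarrow> real \<Rightarrow> real \<Rightarrow> nat
     \<Rightarrow> (nat \<Rightarrow> real ^ 'n) \<Rightarrow> (nat \<Rightarrow> real \<Rightarrow> real ^ 'n) \<Rightarrow> bool" where
  "construction V Rp c k \<xi> u \<longleftrightarrow>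
     (\<forall>j<k. lattice_span \<xi> j \<noteq> int_lattice \<and>
            construction_step V Rp c \<xi> j (\<xi> (Suc j)) (u (Suc j))) \<and>
     lattice_span \<xi> k = int_lattice"

definition velocity :: "(real \<Rightarrow> 'a::real_normed_vector) \<Rightarrow> real \<Rightarrow> 'a" where
  "velocity q t = vector_derivative q (at t)"

definition C2_curve :: "(real \<Rightarrow> 'a::real_normed_vector) \<Rightarrow> bool" where
  "C2_curve q \<longleftrightarrow> q C1_differentiable_on UNIV \<and> velocity q C1_differentiable_on UNIV"

definition newton_solution :: "('a \<Rightarrow> 'a) \<Rightarrow> (real \<Rightarrow> 'a::real_normed_vector) \<Rightarrow> bool" where
  "newton_solution gradV q \<longleftrightarrow> C2_curve q \<and> (\<forall>t. velocity (velocity q) t = gradV (q t))"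

definition heteroclinic :: "'a \<Rightarrow> 'a \<Rightarrow> (real \<Rightarrow> 'a::real_normed_vector) \<Rightarrow> bool" where
  "heteroclinic x y q \<longleftrightarrow> (q \<longlongrightarrow> x) at_bot \<and> (q \<longlongrightarrow> y) at_top \<and>
     (velocity q \<longlongrightarrow> 0) at_bot \<and> (velocity q \<longlongrightarrow> 0) at_top"

definition C2_loc_converges ::
    "(nat \<Rightarrow> real \<Rightarrow> 'a::real_normed_vector) \<Rightarrow> (real \<Rightarrow> 'a) \<Rightarrow> bool" where
  "C2_loc_converges f g \<longleftrightarrow> (\<forall>n. C2_curve (f n)) \<and> C2_curve g \<and>
     (\<forall>K. compact K \<longrightarrow>
        uniform_limit K f g sequentially \<and>
        uniform_limit K (\<lambda>n. velocity (f n)) (velocity g) sequentially \<and>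
        uniform_limit K (\<lambda>n. velocity (velocity (f n))) (velocity (velocity g)) sequentially)"

end

theory Submission
  imports Defs "HOL-Complex_Analysis.Great_Picard"
begin

text \<open>
  Away from the wells a minimizer satisfies the Euler-Lagrange equation; on an unbounded interval
  finiteness of the action, and on a bounded one invariance under time rescaling, give it energy
  \<open>-c\<close>. Hence it comes to rest at finite endpoints and its reflections solve the equation on the
  whole line.

  The minimal actions are bounded by that of a unit segment along a coordinate axis, uniformly in
  \<open>c\<close>, and since the minimizers are bounded too, only finitely many lattice points \<open>\<xi>\<close> can occur;
  this gives the subsequence with constant \<open>\<kappa>\<close> and \<open>\<xi>\<^sup>j\<close>. An orbit from the well at \<open>0\<close> to the well
  at \<open>\<xi>\<^sup>j\<close> cannot come close to any other lattice point: stopping there, or starting from there, and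
  adding a short segment would save the fixed cost of crossing an annulus between two wells.
  Normalising time by \<open>|u(0)| = 1/3\<close> and using Ascoli's theorem, the orbits converge to a
  solution \<open>Q\<close> of energy \<open>0\<close>. By a Gronwall argument \<open>Q\<close> never reaches a lattice point, so the times of
  rest escape to infinity, \<open>V(Q)\<close> is integrable on the line, \<open>Q\<close> converges to lattice points at both
  ends, and the previous remark identifies these as \<open>0\<close> and \<open>\<xi>\<^sup>j\<close>.
\<close>

subsection \<open>Primitives of square-integrable functions and weak derivatives\<close>

text \<open>Two obstacles shape the proof. A variation of a minimizer has to keep V(q) \<ge> c, so
  it is made only on compact intervals where V(q) > c strictly. At a finite end of the orbit V(q) =
  c, no local variation is available there, and the energy has to come from a global comparison.
  Such comparisons are flexible because every path from A to B, admissible or not, bounds the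
  minimal action from above: the piece between its last visit to A and the next visit to B satisfies
  the constraint and costs no more. The unit segment, the rescaled arc and the bridged arcs are all
  used in this way. An orbit may need finite or infinite time to reach its end wells. Both cases are
  treated together by imposing conditions on an orbit only until it meets the level c, which on a
  fixed compact interval no longer happens for large n. The derivative in the action is an
  arbitrarily chosen representative, so paths are carried along with an explicit derivative.\<close>

text \<open>\<open>W\<^sup>1\<^sup>,\<^sup>2\<close> functions on an interval, given together with a chosen derivative \<open>g\<close>.\<close>

definition primitive_on :: "real \<Rightarrow> real \<Rightarrow> (real \<Rightarrow> 'a::euclidean_space) \<Rightarrow> (real \<Rightarrow> 'a) \<Rightarrow> bool" where
  "primitive_on a b q g \<longleftrightarrow> g \<in> borel_measurable borel \<and>
     set_integrable lborel {a..b} (\<lambda>t. (norm (g t))\<^sup>2) \<and>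
     (\<forall>s t. a \<le> s \<longrightarrow> s \<le> t \<longrightarrow> t \<le> b \<longrightarrow> q t - q s = (LBINT x:{s..t}. g x))"

lemma set_integrable_of_square:
  fixes g :: "real \<Rightarrow> 'a::euclidean_space"
  assumes [measurable]: "g \<in> borel_measurable borel"
    and sq: "set_integrable lborel {a..b} (\<lambda>t. (norm (g t))\<^sup>2)"
  shows "set_integrable lborel {a..b} g"
proof -
  have "set_integrable lborel {a..b} (\<lambda>t. 1 + (norm (g t))\<^sup>2)"
    using sq by (intro set_integral_add) (auto intro: borel_integrable_atLeastAtMost')
  moreover have "norm (g t) \<le> norm (1 + (norm (g t))\<^sup>2)" for t
  proof -
    have "0 \<le> (norm (g t) - 1)\<^sup>2" by simp
    then have "2 * norm (g t) \<le> 1 + (norm (g t))\<^sup>2"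
      by (simp add: power2_eq_square algebra_simps)
    then show ?thesis using norm_ge_zero[of "g t"] by (smt (verit) real_norm_def)
  qed
  ultimately show ?thesis
    by (auto intro: set_integrable_bound simp: set_borel_measurable_def)
qed

lemma set_integrable_subinterval:
  fixes g :: "real \<Rightarrow> 'a::euclidean_space"
  assumes "set_integrable lborel {a..b} g" "a \<le> s" "t \<le> b"
  shows "set_integrable lborel {s..t} g"
  using assms by (auto intro: set_integrable_subset)

lemma primitive_onD:
  assumes "primitive_on a b q g"
  shows "g \<in> borel_measurable borel" "set_integrable lborel {a..b} (\<lambda>t. (norm (g t))\<^sup>2)"
    "set_integrable lborel {a..b} g"
    "\<And>s t. a \<le> s \<Longrightarrow> s \<le> t \<Longrightarrow> t \<le> b \<Longrightarrow> q t - q s = (LBINT x:{s..t}. g x)"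
  using assms set_integrable_of_square[of g a b] unfolding primitive_on_def by auto

lemma primitive_on_subset:
  assumes "primitive_on a b q g" "a \<le> s" "t \<le> b"
  shows "primitive_on s t q g"
  using assms set_integrable_subinterval[OF _ assms(2,3)] unfolding primitive_on_def by auto

lemma primitive_on_continuous:
  assumes "primitive_on a b q g"
  shows "continuous_on {a..b} q"
proof -
  note D = primitive_onD[OF assms]
  have HK: "g integrable_on {a..b}"
    using D(3) by (rule set_borel_integral_eq_integral)
  have "q t = q a + integral {a..t} g" if "t \<in> {a..b}" for t
  proof -
    have "set_integrable lborel {a..t} g"
      using that by (intro set_integrable_subinterval[OF D(3)]) auto
    from set_borel_integral_eq_integral(2)[OF this] show ?thesis
      using D(4)[of a t] that by (auto simp: algebra_simps)
  qed
  moreover have "continuous_on {a..b} (\<lambda>t. q a + integral {a..t} g)"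
    by (intro continuous_intros indefinite_integral_continuous_1 HK)
  ultimately show ?thesis
    by (metis (no_types, lifting) continuous_on_cong)
qed

lemma LBINT_split:
  fixes g :: "real \<Rightarrow> 'a::euclidean_space"
  assumes "set_integrable lborel {a..c} g" "a \<le> b" "b \<le> c"
  shows "(LBINT x:{a..c}. g x) = (LBINT x:{a..b}. g x) + (LBINT x:{b..c}. g x)"
proof -
  have i: "set_integrable lborel {a..b} g" "set_integrable lborel {b..c} g"
    using assms by (auto intro: set_integrable_subset)
  show ?thesis
    using Henstock_Kurzweil_Integration.integral_combine[OF assms(2,3) set_borel_integral_eq_integral(1)[OF assms(1)]]
    by (simp add: set_borel_integral_eq_integral(2) i assms(1))
qed

text \<open>The exceptional point c is the breakpoint where two paths are glued.\<close>

lemma LBINT_cong_AE_insert: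
  fixes f g :: "real \<Rightarrow> 'a::euclidean_space"
  assumes "f \<in> borel_measurable borel" "g \<in> borel_measurable borel"
    "\<And>x. x \<in> {a..b} - {c} \<Longrightarrow> f x = g x"
  shows "(LBINT x:{a..b}. f x) = (LBINT x:{a..b}. g x)"
    "set_integrable lborel {a..b} f \<longleftrightarrow> set_integrable lborel {a..b} g"
proof -
  have ae: "AE x in lborel. indicator {a..b} x *\<^sub>R f x = indicator {a..b} x *\<^sub>R g x"
    using AE_lborel_singleton[of c] by eventually_elim (use assms(3) in \<open>auto simp: indicator_def\<close>)
  note [measurable] = assms(1,2)
  show "(LBINT x:{a..b}. f x) = (LBINT x:{a..b}. g x)"
    unfolding set_lebesgue_integral_def by (rule integral_cong_AE) (use ae in auto)
  show "set_integrable lborel {a..b} f \<longleftrightarrow> set_integrable lborel {a..b} g"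
    unfolding set_integrable_def by (rule integrable_cong_AE) (use ae in auto)
qed

lemma primitive_on_cong:
  assumes "primitive_on a b q g" "\<And>t. t \<in> {a..b} \<Longrightarrow> q' t = q t"
    "\<And>t. t \<in> {a..b} - {c} \<Longrightarrow> g' t = g t" "g' \<in> borel_measurable borel"
  shows "primitive_on a b q' g'"
proof -
  note D = primitive_onD[OF assms(1)]
  note [measurable] = D(1) assms(4)
  have "set_integrable lborel {a..b} (\<lambda>t. (norm (g' t))\<^sup>2)"
    using D(2) LBINT_cong_AE_insert(2)[of "\<lambda>t. (norm (g t))\<^sup>2" "\<lambda>t. (norm (g' t))\<^sup>2" a b c] assms(3)
    by auto
  moreover have "q' t - q' s = (LBINT x:{s..t}. g' x)" if "a \<le> s" "s \<le> t" "t \<le> b" for s t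
    using D(4)[OF that] that assms(2)[of s] assms(2)[of t]
      LBINT_cong_AE_insert(1)[OF assms(4) D(1), of s t c] assms(3) by auto
  ultimately show ?thesis using assms(4) unfolding primitive_on_def by auto
qed

lemma primitive_on_combine:
  assumes 1: "primitive_on a b q g" and 2: "primitive_on b c q g" and "a \<le> b" "b \<le> c"
  shows "primitive_on a c q g"
proof -
  note D = primitive_onD[OF 1] and E = primitive_onD[OF 2]
  have U: "{a..b} \<union> {b..c} = {a..c}" using assms(3,4) by auto
  have sq: "set_integrable lborel {a..c} (\<lambda>t. (norm (g t))\<^sup>2)"
    using set_integrable_Un[OF D(2) E(2)] U by auto
  have gi: "set_integrable lborel {a..c} g" by (rule set_integrable_of_square[OF D(1) sq])
  have "q t - q s = (LBINT x:{s..t}. g x)" if st: "a \<le> s" "s \<le> t" "t \<le> c" for s t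
  proof -
    consider "t \<le> b" | "b \<le> s" | "s \<le> b" "b \<le> t" by linarith
    then show ?thesis
    proof cases
      case 3
      have "(LBINT x:{s..t}. g x) = (LBINT x:{s..b}. g x) + (LBINT x:{b..t}. g x)"
        using 3 st by (intro LBINT_split set_integrable_subinterval[OF gi]) auto
      then show ?thesis using D(4)[of s b] E(4)[of b t] 3 st by (simp add: algebra_simps)
    qed (use D(4) E(4) st in auto)
  qed
  then show ?thesis using sq D(1) unfolding primitive_on_def by auto
qed

lemma primitive_on_glue:
  assumes "primitive_on a b q g" "primitive_on b c r h" "q b = r b" "a \<le> b" "b \<le> c"
  shows "primitive_on a c (\<lambda>t. if t \<le> b then q t else r t) (\<lambda>t. if t \<le> b then g t else h t)"
proof (rule primitive_on_combine[OF _ _ assms(4,5)])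
  note [measurable] = primitive_onD(1)[OF assms(1)] primitive_onD(1)[OF assms(2)]
  have m: "(\<lambda>t. if t \<le> b then g t else h t) \<in> borel_measurable borel" by measurable
  show "primitive_on a b (\<lambda>t. if t \<le> b then q t else r t) (\<lambda>t. if t \<le> b then g t else h t)"
    by (rule primitive_on_cong[OF assms(1), where c=b]) (use m in auto)
  show "primitive_on b c (\<lambda>t. if t \<le> b then q t else r t) (\<lambda>t. if t \<le> b then g t else h t)"
    by (rule primitive_on_cong[OF assms(2), where c=b]) (use m assms(3) in auto)
qed

lemma primitive_on_const: "primitive_on a b (\<lambda>_. x) (\<lambda>_. 0)"
  unfolding primitive_on_def by (auto simp: set_integrable_def set_lebesgue_integral_def)

text \<open>Freezing a path outside {s..t} makes it a path on the whole line, as members of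
  \<open>Gamma_paths\<close> have to be. It also localises perturbations that vanish at s and
  t.\<close>

lemma primitive_on_clamp:
  assumes "primitive_on s t q g" "s \<le> t"
  shows "primitive_on a b (\<lambda>x. q (max s (min t x))) (\<lambda>x. indicator {s..t} x *\<^sub>R g x)"
proof -
  define a' where "a' = min a s" define b' where "b' = max b t"
  note [measurable] = primitive_onD(1)[OF assms(1)]
  let ?q = "\<lambda>x. q (max s (min t x))" and ?g = "\<lambda>x. indicator {s..t} x *\<^sub>R g x"
  have m: "?g \<in> borel_measurable borel" by measurable
  have cl: "x \<le> s \<Longrightarrow> max s (min t x) = s" "t \<le> x \<Longrightarrow> max s (min t x) = t" for x
    using assms(2) by auto
  have "primitive_on a' s ?q ?g"
    by (rule primitive_on_cong[OF primitive_on_const[of _ _ "q s"], where c=s]) (use m assms(2) in \<open>auto simp: cl\<close>)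
  moreover have "primitive_on t b' ?q ?g"
    by (rule primitive_on_cong[OF primitive_on_const[of _ _ "q t"], where c=t]) (use m assms(2) in \<open>auto simp: cl\<close>)
  moreover have "primitive_on s t ?q ?g"
    by (rule primitive_on_cong[OF assms(1), where c=s]) (use m assms(2) in \<open>auto simp: max_def min_def\<close>)
  ultimately have "primitive_on a' b' ?q ?g"
    using assms(2) by (intro primitive_on_combine[of a' t _ _ b'] primitive_on_combine[of a' s _ _ t])
      (auto simp: a'_def b'_def)
  then show ?thesis by (rule primitive_on_subset) (auto simp: a'_def b'_def)
qed

lemma primitive_on_scaleR:
  assumes "primitive_on a b q g"
  shows "primitive_on a b (\<lambda>t. k *\<^sub>R q t) (\<lambda>t. k *\<^sub>R g t)"
proof -
  note D = primitive_onD[OF assms]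
  note [measurable] = D(1)
  have "set_integrable lborel {a..b} (\<lambda>t. k\<^sup>2 * (norm (g t))\<^sup>2)"
    using D(2) by simp
  then have "set_integrable lborel {a..b} (\<lambda>t. (norm (k *\<^sub>R g t))\<^sup>2)"
    by (simp add: power_mult_distrib)
  moreover have "k *\<^sub>R q t - k *\<^sub>R q s = (LBINT x:{s..t}. k *\<^sub>R g x)" if "a \<le> s" "s \<le> t" "t \<le> b" for s t
    using D(4)[OF that] by (simp add: scaleR_diff_right[symmetric])
  ultimately show ?thesis unfolding primitive_on_def by simp
qed

lemma primitive_on_add:
  assumes "primitive_on a b q g" "primitive_on a b r h"
  shows "primitive_on a b (\<lambda>t. q t + r t) (\<lambda>t. g t + h t)"
proof -
  note D = primitive_onD[OF assms(1)] and E = primitive_onD[OF assms(2)]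
  note [measurable] = D(1) E(1)
  have "set_integrable lborel {a..b} (\<lambda>t. 2 * (norm (g t))\<^sup>2 + 2 * (norm (h t))\<^sup>2)"
    using D(2) E(2) by (intro set_integral_add) auto
  then have "set_integrable lborel {a..b} (\<lambda>t. (norm (g t + h t))\<^sup>2)"
  proof (rule set_integrable_bound)
    have "(norm (g t + h t))\<^sup>2 \<le> 2 * (norm (g t))\<^sup>2 + 2 * (norm (h t))\<^sup>2" for t
      proof -
      have "(norm (g t + h t))\<^sup>2 \<le> (norm (g t) + norm (h t))\<^sup>2"
        by (intro power_mono norm_triangle_ineq) auto
      also have "\<dots> \<le> 2 * (norm (g t))\<^sup>2 + 2 * (norm (h t))\<^sup>2"
        using sum_squares_bound[of "norm (g t)" "norm (h t)"] by (simp add: power2_sum)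
      finally show ?thesis .
    qed
    then show "AE t\<in>{a..b} in lborel. norm ((norm (g t + h t))\<^sup>2) \<le> norm (2 * (norm (g t))\<^sup>2 + 2 * (norm (h t))\<^sup>2)"
      by auto
  qed (auto simp: set_borel_measurable_def)
  moreover have "(q t + r t) - (q s + r s) = (LBINT x:{s..t}. g x + h x)" if "a \<le> s" "s \<le> t" "t \<le> b" for s t
    using D(4)[OF that] E(4)[OF that] set_integrable_subinterval[OF D(3)] set_integrable_subinterval[OF E(3)] that
    by (subst set_integral_add) (auto simp: algebra_simps)
  ultimately show ?thesis unfolding primitive_on_def by simp
qed

lemma primitive_on_diff:
  assumes "primitive_on a b q g" "primitive_on a b r h"
  shows "primitive_on a b (\<lambda>t. q t - r t) (\<lambda>t. g t - h t)"
  using primitive_on_add[OF assms(1) primitive_on_scaleR[OF assms(2), of "-1"]] by simp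

lemma primitive_on_C1:
  assumes "a \<le> b" "\<And>t. t \<in> {a..b} \<Longrightarrow> (q has_vector_derivative g t) (at t within {a..b})"
    "continuous_on UNIV g"
  shows "primitive_on a b q g"
proof -
  have cg: "continuous_on S g" for S using assms(3) continuous_on_subset by blast
  have [measurable]: "g \<in> borel_measurable borel" using assms(3) by (rule borel_measurable_continuous_onI)
  have "set_integrable lborel {a..b} (\<lambda>t. (norm (g t))\<^sup>2)"
    by (intro borel_integrable_atLeastAtMost' continuous_intros cg)
  moreover have "q t - q s = (LBINT x:{s..t}. g x)" if st: "a \<le> s" "s \<le> t" "t \<le> b" for s t
  proof -
    have "set_integrable lborel {s..t} g" by (rule borel_integrable_atLeastAtMost'[OF cg])
    moreover have "(g has_integral (q t - q s)) {s..t}"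
    proof (rule fundamental_theorem_of_calculus[OF st(2)])
      fix x assume "x \<in> {s..t}"
      then show "(q has_vector_derivative g x) (at x within {s..t})"
        using has_vector_derivative_within_subset[OF assms(2)[of x], of "{s..t}"] st by auto
    qed
    ultimately show ?thesis by (simp add: set_borel_integral_eq_integral integral_unique)
  qed
  ultimately show ?thesis unfolding primitive_on_def by auto
qed

text \<open>One factor has only a square-integrable derivative, so the product rule is replaced by
  Fubini on the triangle a \<le> s \<le> t \<le> b. The general bilinear product serves both scalar
  test functions (\<open>scaleR\<close>) and the first variation (\<open>inner\<close>).\<close>

lemma integration_by_parts_primitive:
  fixes pr :: "'a::euclidean_space \<Rightarrow> 'b::euclidean_space \<Rightarrow> 'c::euclidean_space"
  assumes bb: "bounded_bilinear pr" and "a \<le> b" and P: "primitive_on a b q g"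
    and Y: "\<And>t. t \<in> {a..b} \<Longrightarrow> (Y has_vector_derivative Y' t) (at t within {a..b})"
    and Y': "continuous_on UNIV Y'"
  shows "(LBINT t:{a..b}. pr (Y t) (g t)) + (LBINT t:{a..b}. pr (Y' t) (q t)) = pr (Y b) (q b) - pr (Y a) (q a)"
    and "set_integrable lborel {a..b} (\<lambda>t. pr (Y t) (g t))"
    and "set_integrable lborel {a..b} (\<lambda>t. pr (Y' t) (q t))"
proof -
  interpret bounded_bilinear pr by (rule bb)
  let ?D = "{a..b}"
  note D = primitive_onD[OF P]
  have PY: "primitive_on a b Y Y'" by (rule primitive_on_C1[OF assms(2) Y Y'])
  note E = primitive_onD[OF PY]
  have cY: "continuous_on ?D Y" and cq: "continuous_on ?D q"
    using primitive_on_continuous PY P by auto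
  note [measurable] = D(1) E(1)
  define h where "h t = indicator ?D t *\<^sub>R Y' t" for t
  define k where "k s = indicator ?D s *\<^sub>R g s" for s
  have [measurable]: "h \<in> borel_measurable borel" "k \<in> borel_measurable borel"
    unfolding h_def k_def by measurable
  have ih: "integrable lborel h" and ik: "integrable lborel k"
    using E(3) D(3) unfolding h_def k_def set_integrable_def by auto
  have cpr: "continuous_on UNIV (\<lambda>x. pr (fst x) (snd x))"
    by (rule continuous_on[OF continuous_on_fst continuous_on_snd]) (auto intro: continuous_on_id)
  have mpr2: "(\<lambda>x. pr (f x) (g x)) \<in> borel_measurable M"
    if "f \<in> borel_measurable M" "g \<in> borel_measurable M" for f g and M :: "(real \<times> real) measure"
    by (rule borel_measurable_continuous_Pair[OF that cpr])
  have mprr: "(\<lambda>x. pr (f x) (g x)) \<in> borel_measurable M"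
    if "f \<in> borel_measurable M" "g \<in> borel_measurable M" for f g and M :: "real measure"
    by (rule borel_measurable_continuous_Pair[OF that cpr])
  obtain K where K: "0 < K" "\<And>x y. norm (pr x y) \<le> norm x * norm y * K"
    using pos_bounded by blast
  define F where "F t s = (if s \<le> t then pr (h t) (k s) else 0)" for t s
  have mF: "case_prod F \<in> borel_measurable (lborel \<Otimes>\<^sub>M lborel)"
  proof -
    have "(\<lambda>p::real\<times>real. pr (h (fst p)) (k (snd p))) \<in> borel_measurable (lborel \<Otimes>\<^sub>M lborel)"
      by (intro mpr2) measurable
    then show ?thesis unfolding F_def case_prod_beta by measurable
  qed
  have "integrable (lborel \<Otimes>\<^sub>M lborel) (\<lambda>p. norm (h (fst p)) * (norm (k (snd p)) * K))"
  proof (rule lborel_pair.Fubini_integrable)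
    show "(\<lambda>p. norm (h (fst p)) * (norm (k (snd p)) * K)) \<in> borel_measurable (lborel \<Otimes>\<^sub>M lborel)"
      by measurable
    show "integrable lborel (\<lambda>x. LBINT y. norm (norm (h (fst (x, y))) * (norm (k (snd (x, y))) * K)))"
      using ih K(1) by (simp add: abs_mult)
  qed (use ik in auto)
  then have iF: "integrable (lborel \<Otimes>\<^sub>M lborel) (case_prod F)"
    by (rule Bochner_Integration.integrable_bound[OF _ mF])
       (use K in \<open>auto simp: F_def abs_mult mult.assoc\<close>)
  have A: "(LBINT s. F t s) = indicator ?D t *\<^sub>R pr (Y' t) (q t - q a)" for t
  proof (cases "t \<in> ?D")
    case True
    have "(LBINT s. F t s) = (LBINT s. pr (Y' t) (indicator {a..t} s *\<^sub>R g s))"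
      by (rule Bochner_Integration.integral_cong) (use True in \<open>auto simp: F_def h_def k_def indicator_def zero_right\<close>)
    also have "\<dots> = pr (Y' t) (LBINT s. indicator {a..t} s *\<^sub>R g s)"
    proof (rule integral_bounded_linear[OF bounded_linear_right])
      have "set_integrable lborel {a..t} g" using True by (intro set_integrable_subinterval[OF D(3)]) auto
      then show "integrable lborel (\<lambda>s. indicator {a..t} s *\<^sub>R g s)" unfolding set_integrable_def .
    qed
    also have "\<dots> = pr (Y' t) (q t - q a)"
      using D(4)[of a t] True by (simp add: set_lebesgue_integral_def)
    finally show ?thesis using True by simp
  next
    case False
    then have "h t = 0" by (simp add: h_def)
    then show ?thesis using False by (simp add: F_def zero_left cong: if_cong)
  qed
  have B: "(LBINT t. F t s) = indicator ?D s *\<^sub>R pr (Y b - Y s) (g s)" for s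
  proof (cases "s \<in> ?D")
    case True
    have "(LBINT t. F t s) = (LBINT t. pr (indicator {s..b} t *\<^sub>R Y' t) (g s))"
      by (rule Bochner_Integration.integral_cong) (use True in \<open>auto simp: F_def h_def k_def indicator_def zero_left\<close>)
    also have "\<dots> = pr (LBINT t. indicator {s..b} t *\<^sub>R Y' t) (g s)"
    proof (rule integral_bounded_linear[OF bounded_linear_left])
      have "set_integrable lborel {s..b} Y'" using True by (intro set_integrable_subinterval[OF E(3)]) auto
      then show "integrable lborel (\<lambda>t. indicator {s..b} t *\<^sub>R Y' t)" unfolding set_integrable_def .
    qed
    also have "\<dots> = pr (Y b - Y s) (g s)"
      using E(4)[of s b] True by (simp add: set_lebesgue_integral_def)
    finally show ?thesis using True by simp
  next
    case False
    then have "k s = 0" by (simp add: k_def)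
    then show ?thesis using False by (simp add: F_def zero_right cong: if_cong)
  qed
  have fub: "(LBINT s:?D. pr (Y b - Y s) (g s)) = (LBINT t:?D. pr (Y' t) (q t - q a))"
    using lborel_pair.Fubini_integral[OF iF] A B by (simp add: set_lebesgue_integral_def)
  show i1: "set_integrable lborel ?D (\<lambda>t. pr (Y t) (g t))"
  proof -
    obtain C where C: "\<And>t. t \<in> ?D \<Longrightarrow> norm (Y t) \<le> C"
      using compact_continuous_image[OF cY] compact_imp_bounded bounded_iff by (metis compact_Icc image_eqI)
    have "set_integrable lborel ?D (\<lambda>t. C * K * norm (g t))"
      using set_integrable_norm[OF D(3)] by simp
    then show ?thesis
    proof (rule set_integrable_bound)
      have "(\<lambda>t. indicator ?D t *\<^sub>R Y t) \<in> borel_measurable borel"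
        by (rule borel_measurable_continuous_on_indicator[OF _ cY]) auto
      then have "(\<lambda>t. pr (indicator ?D t *\<^sub>R Y t) (g t)) \<in> borel_measurable borel" by (intro mprr D(1))
      then show "set_borel_measurable lborel ?D (\<lambda>t. pr (Y t) (g t))"
        by (simp add: set_borel_measurable_def scaleR_left)
      have "norm (pr (Y t) (g t)) \<le> norm (C * K * norm (g t))" if "t \<in> ?D" for t
      proof -
        have "norm (pr (Y t) (g t)) \<le> norm (Y t) * norm (g t) * K" by (rule K(2))
        also have "\<dots> \<le> C * norm (g t) * K"
          using C[OF that] K(1) by (intro mult_right_mono) auto
        finally show ?thesis by (simp add: algebra_simps)
      qed
      then show "AE t in lborel. t \<in> ?D \<longrightarrow> norm (pr (Y t) (g t)) \<le> norm (C * K * norm (g t))" by auto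
    qed
  qed
  show i2: "set_integrable lborel ?D (\<lambda>t. pr (Y' t) (q t))"
    by (intro borel_integrable_atLeastAtMost' continuous_on cq continuous_on_subset[OF Y']) auto
  have i3: "set_integrable lborel ?D (\<lambda>t. pr (Y b) (g t))"
    using integrable_bounded_linear[OF bounded_linear_right D(3)[unfolded set_integrable_def]]
    by (simp add: set_integrable_def scaleR_right)
  have i4: "set_integrable lborel ?D (\<lambda>t. pr (Y' t) (q a))"
    using integrable_bounded_linear[OF bounded_linear_left E(3)[unfolded set_integrable_def]]
    by (simp add: set_integrable_def scaleR_left)
  have e3: "(LBINT t:?D. pr (Y b) (g t)) = pr (Y b) (q b - q a)"
    using integral_bounded_linear[OF bounded_linear_right D(3)[unfolded set_integrable_def], of "Y b"] D(4)[of a b] assms(2)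
    by (simp add: set_lebesgue_integral_def scaleR_right)
  have e4: "(LBINT t:?D. pr (Y' t) (q a)) = pr (Y b - Y a) (q a)"
    using integral_bounded_linear[OF bounded_linear_left E(3)[unfolded set_integrable_def], of "q a"] E(4)[of a b] assms(2)
    by (simp add: set_lebesgue_integral_def scaleR_left)
  have "(LBINT s:?D. pr (Y b - Y s) (g s)) = pr (Y b) (q b - q a) - (LBINT t:?D. pr (Y t) (g t))"
    unfolding diff_left using i1 i3 e3 by (simp add: set_integral_diff)
  moreover have "(LBINT t:?D. pr (Y' t) (q t - q a)) = (LBINT t:?D. pr (Y' t) (q t)) - pr (Y b - Y a) (q a)"
    unfolding diff_right using i2 i4 e4 by (simp add: set_integral_diff)
  moreover have vec: "u = B - Ba - X \<Longrightarrow> w = Z - (Ba - A) \<Longrightarrow> u = w \<Longrightarrow> X + Z = B - A" for u w X Z B Ba A :: 'c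
  proof -
    assume "u = B - Ba - X" "w = Z - (Ba - A)" "u = w"
    then have "X = B - Ba - u" "Z = u + (Ba - A)" by simp_all
    then show "X + Z = B - A" by simp
  qed
  ultimately show "(LBINT t:?D. pr (Y t) (g t)) + (LBINT t:?D. pr (Y' t) (q t)) = pr (Y b) (q b) - pr (Y a) (q a)"
    using fub vec unfolding diff_left diff_right by blast
qed

section \<open>Equivalence of primitives and weak derivatives\<close>

lemma primitive_imp_has_weak_deriv:
  assumes P: "\<And>a b. primitive_on a b q g"
  shows "has_weak_deriv q g"
  unfolding has_weak_deriv_def
proof (intro allI impI)
  fix \<phi> assume t: "test_function \<phi>"
  then obtain D where D: "\<And>x. (\<phi> has_vector_derivative D x) (at x)" "continuous_on UNIV D"
    unfolding test_function_def C1_differentiable_on_def by auto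
  have dD: "deriv \<phi> = D"
    using D(1) by (auto simp: has_real_derivative_iff_has_vector_derivative[symmetric] intro: DERIV_imp_deriv)
  from t have "bounded (closure {t. \<phi> t \<noteq> 0})"
    unfolding test_function_def by (auto dest: compact_imp_bounded)
  then obtain M where M: "M > 0" "\<And>t. t \<in> closure {t. \<phi> t \<noteq> 0} \<Longrightarrow> norm t \<le> M"
    unfolding bounded_pos by auto
  have z: "\<phi> t = 0" if "\<bar>t\<bar> > M" for t using M(2)[of t] closure_subset[of "{t. \<phi> t \<noteq> 0}"] that by fastforce
  have z': "D t = 0" if "\<bar>t\<bar> > M" for t
  proof -
    have "open {t. \<bar>t\<bar> > M}" by (intro open_Collect_less continuous_intros)
    then have "(\<phi> has_vector_derivative 0) (at t)"
      by (rule has_vector_derivative_transform_within_open[rotated]) (use that z has_vector_derivative_const[of 0] in auto)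
    then show ?thesis using D(1) vector_derivative_unique_at by blast
  qed
  \<comment> \<open>The margin 1 beyond the support bound M puts the endpoints where \<phi>
    vanishes, which removes the boundary terms.\<close>
  have nz: "\<phi> t = 0" "D t = 0" if "t \<notin> {-M-1..M+1}" for t 
  proof -
    have "\<bar>t\<bar> > M" using that by (auto simp: abs_if)
    then show "\<phi> t = 0" "D t = 0" using z z' by auto
  qed
  have zb: "\<phi> (M+1) = 0" "\<phi> (-M-1) = 0" using z[of "M+1"] z[of "-M-1"] M(1) by auto
  have ibp: "(LBINT t:{-M-1..M+1}. \<phi> t *\<^sub>R g t) + (LBINT t:{-M-1..M+1}. D t *\<^sub>R q t) = 0"
    using integration_by_parts_primitive(1)[OF bounded_bilinear_scaleR _ P[of "-M-1" "M+1"], of \<phi> D] D M(1) zb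
    by (auto simp: has_vector_derivative_at_within)
  have "(LBINT t:{-M-1..M+1}. \<phi> t *\<^sub>R g t) = (LBINT t. \<phi> t *\<^sub>R g t)"
    unfolding set_lebesgue_integral_def
    by (rule Bochner_Integration.integral_cong) (use nz in \<open>auto simp: indicator_def simp del: atLeastAtMost_iff\<close>)
  moreover have "(LBINT t:{-M-1..M+1}. D t *\<^sub>R q t) = (LBINT t. D t *\<^sub>R q t)"
    unfolding set_lebesgue_integral_def
    by (rule Bochner_Integration.integral_cong) (use nz in \<open>auto simp: indicator_def simp del: atLeastAtMost_iff\<close>)
  ultimately show "(LBINT t. deriv \<phi> t *\<^sub>R q t) = - (LBINT t. \<phi> t *\<^sub>R g t)"
    using ibp dD by (simp add: eq_neg_iff_add_eq_0 add.commute)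
qed

lemma primitive_imp_H1_loc:
  assumes P: "\<And>a b. primitive_on a b q g"
  shows "H1_loc q" "L2_loc g"
proof -
  have c: "continuous_on UNIV q"
  proof -
    have "continuous_on {t-1..t+1} q" for t using P primitive_on_continuous by blast
    then have "continuous_on {t-1<..<t+1} q" for t
      by (meson continuous_on_subset greaterThanLessThan_subseteq_atLeastAtMost_iff order_refl)
    then have "isCont q t" for t
      using continuous_on_interior[of "{t-1<..<t+1}" q t] by (auto simp: interior_open)
    then show ?thesis by (simp add: continuous_at_imp_continuous_on)
  qed
  then have "L2_loc q" unfolding L2_loc_def
    by (auto intro!: borel_measurable_continuous_onI borel_integrable_atLeastAtMost' continuous_intros intro: continuous_on_subset)
  moreover show "L2_loc g" using P primitive_onD(1,2) unfolding L2_loc_def by blast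
  ultimately show "H1_loc q" unfolding H1_loc_def using c primitive_imp_has_weak_deriv[OF P] by blast
qed

text \<open>The difference of the two derivatives, cut off to {a..b}, has integral zero over every
  half-line {..x}. These sets are stable under intersection and generate the Borel sets, so the
  integral vanishes over every Borel set and the difference vanishes almost everywhere.\<close>

lemma primitive_on_unique:
  assumes P: "primitive_on a b q g" and Q: "primitive_on a b q h"
  shows "AE t in lborel. t \<in> {a..b} \<longrightarrow> g t = h t"
proof -
  note D = primitive_onD[OF P] and E = primitive_onD[OF Q]
  note [measurable] = D(1) E(1)
  define f where "f t = indicator {a..b} t *\<^sub>R (g t - h t)" for t
  have "set_integrable lborel {a..b} (\<lambda>t. g t - h t)" using D(3) E(3) by (rule set_integral_diff)
  then have f: "integrable lborel f" unfolding f_def set_integrable_def .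
  have atm: "set_lebesgue_integral lborel {..x} f = 0" for x
  proof -
    have "set_lebesgue_integral lborel {..x} f = (LBINT t:{a..min b x}. g t - h t)"
      unfolding set_lebesgue_integral_def f_def
      by (rule Bochner_Integration.integral_cong) (auto simp: indicator_def)
    also have "\<dots> = 0"
    proof (cases "a \<le> min b x")
      case True
      have "set_integrable lborel {a..min b x} g" "set_integrable lborel {a..min b x} h"
        using D(3) E(3) by (auto intro: set_integrable_subinterval)
      then have "(LBINT t:{a..min b x}. g t - h t) = (LBINT t:{a..min b x}. g t) - (LBINT t:{a..min b x}. h t)"
        by (rule set_integral_diff)
      then show ?thesis using D(4)[of a "min b x"] E(4)[of a "min b x"] True by simp
    qed (auto simp: set_lebesgue_integral_def)
    finally show ?thesis .
  qed
  have fi: "set_integrable lborel A f" if "A \<in> sets borel" for A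
    unfolding set_integrable_def using that f by (intro integrable_mult_indicator) auto
  have tot: "integral\<^sup>L lborel f = 0"
  proof -
    have "set_lebesgue_integral lborel {..b} f = integral\<^sup>L lborel f"
      unfolding set_lebesgue_integral_def f_def by (rule Bochner_Integration.integral_cong) (auto simp: indicator_def)
    then show ?thesis using atm by simp
  qed
  have "set_lebesgue_integral lborel A f = 0" if "A \<in> sets borel" for A
  proof -
    have S: "sets borel = sigma_sets UNIV (range (\<lambda>x::real. {..x}))"
      by (simp add: borel_eq_atMost)
    have "Int_stable (range (\<lambda>x::real. {..x}))" "range (\<lambda>x::real. {..x}) \<subseteq> Pow UNIV"
      by (auto simp: Int_stable_def)
    moreover from that have "A \<in> sigma_sets UNIV (range (\<lambda>x::real. {..x}))" using S by simp
    ultimately show ?thesis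
    proof (induction rule: sigma_sets_induct_disjoint)
      case (basic A) then show ?case using atm by auto
    next
      case empty then show ?case by (simp add: set_lebesgue_integral_def)
    next
      case (compl A)
      then have A: "A \<in> sets borel" using S by simp
      have "(\<lambda>x. indicat_real (UNIV - A) x *\<^sub>R f x) = (\<lambda>x. f x - indicat_real A x *\<^sub>R f x)"
        by (auto simp: indicator_def)
      then have "set_lebesgue_integral lborel (UNIV - A) f = integral\<^sup>L lborel f - set_lebesgue_integral lborel A f"
        using f fi[OF A] by (simp add: set_lebesgue_integral_def set_integrable_def)
      then show ?case using compl tot by simp
    next
      case (union A)
      then have A: "A i \<in> sets borel" for i using S by auto
      have "set_lebesgue_integral lborel (\<Union>i. A i) f = (\<Sum>i. set_lebesgue_integral lborel (A i) f)"
        by (rule lebesgue_integral_countable_add) (use A union fi in \<open>auto simp: disjoint_family_on_def\<close>)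
      then show ?case using union by simp
    qed
  qed
  then have "AE t in lborel. f t = 0" using f by (intro sigma_finite_measure.density_zero[OF lborel.sigma_finite_measure_axioms]) auto
  then show ?thesis by eventually_elim (auto simp: f_def)
qed


text \<open>A \<open>C\<^sup>1\<close> step from \<open>0\<close> to \<open>1\<close> on the unit interval; squares of positive parts avoid a definition
  by cases.\<close>

definition step1 :: "real \<Rightarrow> real" where
  "step1 x = 2 * ((max 0 x)\<^sup>2 - 2 * (max 0 (x - 1/2))\<^sup>2 + (max 0 (x - 1))\<^sup>2)"

text \<open>The hat function on the unit interval with peak 2 at 1/2 and integral 1. It is the
  derivative of \<open>step1\<close>, and its rescalings act as mollifiers.\<close>

definition tent :: "real \<Rightarrow> real" where
  "tent x = 4 * (max 0 x - 2 * max 0 (x - 1/2) + max 0 (x - 1))"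

lemma DERIV_max_0_square: "((\<lambda>x. (max 0 x)\<^sup>2) has_real_derivative 2 * max 0 x) (at x)" for x :: real
proof -
  consider "x < 0" | "x > 0" | "x = 0" by linarith
  then show ?thesis
  proof cases
    case 1
    have "((\<lambda>x. 0) has_real_derivative 0) (at x)" by simp
    then have "((\<lambda>x. (max 0 x)\<^sup>2) has_real_derivative 0) (at x)"
      by (rule has_field_derivative_transform_within_open[where S="{..<0}"]) (use 1 in auto)
    then show ?thesis using 1 by simp
  next
    case 2
    have "((\<lambda>x. x\<^sup>2) has_real_derivative 2 * x) (at x)" by (auto intro!: derivative_eq_intros)
    then have "((\<lambda>x. (max 0 x)\<^sup>2) has_real_derivative 2 * x) (at x)"
      by (rule has_field_derivative_transform_within_open[where S="{0<..}"]) (use 2 in auto)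
    then show ?thesis using 2 by simp
  next
    case 3
    have "((\<lambda>h::real. (max 0 (0 + h))\<^sup>2 / h) \<longlongrightarrow> 0) (at 0)"
    proof (rule Lim_null_comparison)
      have "norm ((max 0 (0 + h))\<^sup>2 / h) \<le> \<bar>h\<bar>" for h :: real
        by (cases "h > 0") (auto simp: max_def power2_eq_square)
      then show "\<forall>\<^sub>F h in at 0. norm ((max 0 (0 + h))\<^sup>2 / h) \<le> \<bar>h::real\<bar>" by auto
      show "((\<lambda>h::real. \<bar>h\<bar>) \<longlongrightarrow> 0) (at 0)"
        by (rule tendsto_rabs_zero) (rule tendsto_ident_at)
    qed
    then show ?thesis using 3 by (simp add: DERIV_def)
  qed
qed

lemma DERIV_step1: "(step1 has_real_derivative tent x) (at x)"
proof -
  have s: "((\<lambda>x. (max 0 (x - c))\<^sup>2) has_real_derivative 2 * max 0 (x - c)) (at x)" for c x :: real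
    using DERIV_shift[of "\<lambda>x. (max 0 x)\<^sup>2" "2 * max 0 (x - c)" x "-c"] DERIV_max_0_square[of "x - c"]
    by simp
  have "(step1 has_real_derivative 2 * (2 * max 0 x - 2 * (2 * max 0 (x - 1/2)) + 2 * max 0 (x - 1))) (at x)"
    unfolding step1_def[abs_def]
    by (intro DERIV_cmult DERIV_add DERIV_diff s DERIV_max_0_square)
  then show ?thesis by (simp add: tent_def)
qed

lemma continuous_tent: "continuous_on S tent"
  unfolding tent_def[abs_def] by (intro continuous_intros)

lemma step1_simps: "x \<le> 0 \<Longrightarrow> step1 x = 0" "x \<ge> 1 \<Longrightarrow> step1 x = 1"
proof -
  show "x \<le> 0 \<Longrightarrow> step1 x = 0" by (simp add: step1_def max_absorb1)
  assume "x \<ge> 1"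
  then have m: "max 0 x = x" "max 0 (x - 1/2) = x - 1/2" "max 0 (x - 1) = x - 1" by auto
  show "step1 x = 1" unfolding step1_def m by (simp add: power2_eq_square field_simps)
qed

lemma tent_nonneg: "0 \<le> tent x" and tent_zero: "x \<notin> {0..1} \<Longrightarrow> tent x = 0"
proof -
  consider "x \<le> 0" | "0 \<le> x" "x \<le> 1/2" | "1/2 \<le> x" "x \<le> 1" | "1 \<le> x" by linarith
  then show "0 \<le> tent x" by cases (simp_all add: tent_def max_absorb1 max_absorb2)
  assume "x \<notin> {0..1}"
  then consider "x \<le> 0" | "1 \<le> x" by fastforce
  then show "tent x = 0" by cases (simp_all add: tent_def max_absorb1 max_absorb2)
qed

lemma step1_bounds: "0 \<le> step1 x" "step1 x \<le> 1"
proof -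
  have mono: "step1 x \<le> step1 y" if "x \<le> y" for x y
    using DERIV_step1 tent_nonneg that by (meson DERIV_nonneg_imp_nondecreasing)
  show "0 \<le> step1 x" using mono[of "min 0 x" x] step1_simps(1)[of "min 0 x"] by simp
  show "step1 x \<le> 1" using mono[of x "max 1 x"] step1_simps(2)[of "max 1 x"] by simp
qed

lemma tent_integral: "integrable lborel tent" "(LBINT x. tent x) = 1"
proof -
  have e: "indicator {0..1} x * tent x = tent x" for x
    using tent_zero[of x] by (auto simp: indicator_def)
  have "set_integrable lborel {0..1} tent"
    by (rule borel_integrable_atLeastAtMost'[OF continuous_tent])
  then show "integrable lborel tent" by (simp add: set_integrable_def e)
  have "primitive_on 0 1 step1 tent"
  proof (rule primitive_on_C1)
    show "(step1 has_vector_derivative tent t) (at t within {0..1})" for t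
      using DERIV_step1[of t] unfolding has_real_derivative_iff_has_vector_derivative
      by (rule has_vector_derivative_at_within)
  qed (auto intro: continuous_tent)
  from primitive_onD(4)[OF this, of 0 1] show "(LBINT x. tent x) = 1"
    by (simp add: set_lebesgue_integral_def e step1_simps)
qed

text \<open>The rescaled hat lives on [a, a + 1/(n+1)]. Substituting t = a + x/(n+1) turns the
  average into an integral against the fixed hat, where dominated convergence applies with the bound
  of q on [a, a + 1].\<close>

lemma tent_mollify:
  fixes q :: "real \<Rightarrow> 'a::euclidean_space"
  assumes q: "continuous_on UNIV q"
  shows "(\<lambda>n. LBINT t. (real (Suc n) * tent (real (Suc n) * (t - a))) *\<^sub>R q t) \<longlonglongrightarrow> q a"
    and "integrable lborel (\<lambda>t. (real (Suc n) * tent (real (Suc n) * (t - a))) *\<^sub>R q t)"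
proof -
  have [measurable]: "q \<in> borel_measurable borel" "tent \<in> borel_measurable borel"
    using q continuous_tent by (auto intro: borel_measurable_continuous_onI)
  have "compact (q ` {a..a+1})"
    by (intro compact_continuous_image continuous_on_subset[OF q]) auto
  then obtain C where C: "\<And>t. t \<in> {a..a+1} \<Longrightarrow> norm (q t) \<le> C"
    using compact_imp_bounded bounded_iff by (metis imageI)
  define s where "s n x = tent x *\<^sub>R q (a + x / real (Suc n))" for n x
  have eq: "has_bochner_integral lborel (\<lambda>t. (real (Suc n) * tent (real (Suc n) * (t - a))) *\<^sub>R q t) y
     \<longleftrightarrow> has_bochner_integral lborel (s n) y" for n y
  proof -
    have "has_bochner_integral lborel (\<lambda>t. (real (Suc n) * tent (real (Suc n) * (t - a))) *\<^sub>R q t) y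
      \<longleftrightarrow> has_bochner_integral lborel (\<lambda>x. (real (Suc n) * tent (real (Suc n) * ((a + 1 / real (Suc n) * x) - a))) *\<^sub>R q (a + 1 / real (Suc n) * x)) (y /\<^sub>R \<bar>1 / real (Suc n)\<bar>)"
      by (rule lborel_has_bochner_integral_real_affine_iff) simp
    also have "(\<lambda>x. (real (Suc n) * tent (real (Suc n) * ((a + 1 / real (Suc n) * x) - a))) *\<^sub>R q (a + 1 / real (Suc n) * x))
       = (\<lambda>x. real (Suc n) *\<^sub>R s n x)"
      by (auto simp: s_def fun_eq_iff)
    also have "has_bochner_integral lborel (\<lambda>x. real (Suc n) *\<^sub>R s n x) (y /\<^sub>R \<bar>1 / real (Suc n)\<bar>) \<longleftrightarrow> has_bochner_integral lborel (s n) y"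
    proof -
      have "y /\<^sub>R \<bar>1 / real (Suc n)\<bar> = real (Suc n) *\<^sub>R y" by simp
      then show ?thesis
        using has_bochner_integral_scaleR_right[of "real (Suc n)" lborel "s n" y]
          has_bochner_integral_scaleR_right[of "1 / real (Suc n)" lborel "\<lambda>x. real (Suc n) *\<^sub>R s n x" "real (Suc n) *\<^sub>R y"]
        by auto
    qed
    finally show ?thesis .
  qed
  have w: "integrable lborel (\<lambda>x. tent x * C)" using tent_integral(1) by simp
  have b: "norm (s n x) \<le> tent x * C" for n x
  proof (cases "x \<in> {0..1}")
    case True
    then have "x / real (Suc n) \<le> 1" by (simp add: divide_le_eq)
    then have "a + x / real (Suc n) \<in> {a..a+1}" using True by auto
    from C[OF this] show ?thesis using tent_nonneg[of x] by (auto simp: s_def intro: mult_left_mono)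
  qed (auto simp: s_def tent_zero)
  have [measurable]: "s n \<in> borel_measurable lborel" for n unfolding s_def[abs_def] by measurable
  have lim: "(\<lambda>n. s n x) \<longlonglongrightarrow> tent x *\<^sub>R q a" for x
  proof -
    have "(\<lambda>n. a + x * inverse (real (Suc n))) \<longlonglongrightarrow> a + x * 0"
      by (intro tendsto_intros LIMSEQ_inverse_real_of_nat)
    then have "(\<lambda>n. q (a + x / real (Suc n))) \<longlonglongrightarrow> q a"
      using continuous_on_tendsto_compose[OF q, of "\<lambda>n. a + x / real (Suc n)" a] by (simp add: divide_inverse)
    then show ?thesis unfolding s_def by (intro tendsto_intros)
  qed
  have "(\<lambda>n. integral\<^sup>L lborel (s n)) \<longlonglongrightarrow> (LBINT x. tent x *\<^sub>R q a)"
    by (rule integral_dominated_convergence[where w="\<lambda>x. tent x * C"]) (use w b lim in auto)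
  also have "(LBINT x. tent x *\<^sub>R q a) = q a" using tent_integral by simp
  finally have L: "(\<lambda>n. integral\<^sup>L lborel (s n)) \<longlonglongrightarrow> q a" .
  have i: "integrable lborel (s n)" for n
    by (rule integrable_dominated_convergence2[where w="\<lambda>x. tent x * C"]) (use w b in auto)
  then have h: "has_bochner_integral lborel (\<lambda>t. (real (Suc n) * tent (real (Suc n) * (t - a))) *\<^sub>R q t) (integral\<^sup>L lborel (s n))" for n
    using eq has_bochner_integral_integrable by blast
  from h show "integrable lborel (\<lambda>t. (real (Suc n) * tent (real (Suc n) * (t - a))) *\<^sub>R q t)"
    by (rule integrable.intros)
  from h have "(LBINT t. (real (Suc n) * tent (real (Suc n) * (t - a))) *\<^sub>R q t) = integral\<^sup>L lborel (s n)" for n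
    by (rule has_bochner_integral_integral_eq)
  with L show "(\<lambda>n. LBINT t. (real (Suc n) * tent (real (Suc n) * (t - a))) *\<^sub>R q t) \<longlonglongrightarrow> q a" by simp
qed

text \<open>Tested against the difference of two steps that steepen at \<open>s\<close> and at \<open>t\<close>.\<close>

lemma has_weak_deriv_imp_primitive:
  assumes q: "continuous_on UNIV q" and L2: "L2_loc g" and W: "has_weak_deriv q g"
  shows "primitive_on a b q g"
proof -
  have [measurable]: "g \<in> borel_measurable borel" and sq: "\<And>a b. set_integrable lborel {a..b} (\<lambda>t. (norm (g t))\<^sup>2)"
    using L2 unfolding L2_loc_def by blast+
  have gi: "set_integrable lborel {a..b} g" for a b by (rule set_integrable_of_square) (use sq in auto)
  have "q t - q s = (LBINT x:{s..t}. g x)" if st: "s \<le> t" for s t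
  proof -
    define N where "N n = real (Suc n)" for n
    have N: "N n \<ge> 1" for n by (simp add: N_def)
    define \<phi> where "\<phi> n x = step1 (N n * (x - s)) - step1 (N n * (x - t))" for n x
    define d where "d n x = N n * tent (N n * (x - s)) - N n * tent (N n * (x - t))" for n x
    have D: "(\<phi> n has_real_derivative d n x) (at x)" for n x
      unfolding \<phi>_def d_def
      by (auto intro!: derivative_eq_intros DERIV_chain2[OF DERIV_step1])
    \<comment> \<open>Each step is complete within time 1/N n \<le> 1 after it starts, hence the
      bound t + 1.\<close>
    have supp: "\<phi> n x = 0" if "x \<notin> {s..t+1}" for n x
    proof (cases "x < s")
      case True
      then have "N n * (x - s) \<le> 0" "N n * (x - t) \<le> 0" using N[of n] st by (auto simp: mult_le_0_iff)
      then show ?thesis by (simp add: \<phi>_def step1_simps)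
    next
      case False
      then have "1 * 1 \<le> N n * (x - s)" "1 * 1 \<le> N n * (x - t)" using N[of n] st that
        by (intro mult_mono; auto)+
      then show ?thesis by (simp add: \<phi>_def step1_simps)
    qed
    have tf: "test_function (\<phi> n)" for n
    proof -
      have "continuous_on UNIV (d n)"
        unfolding d_def by (intro continuous_intros continuous_on_compose2[OF continuous_tent[of UNIV]]) auto
      moreover have "{x. \<phi> n x \<noteq> 0} \<subseteq> {s..t+1}" using supp by blast
      then have "closure {x. \<phi> n x \<noteq> 0} \<subseteq> {s..t+1}" by (rule closure_minimal) simp
      then have "compact (closure {x. \<phi> n x \<noteq> 0})"
        using compact_Int_closed[of "{s..t+1}" "closure {x. \<phi> n x \<noteq> 0}"]
        by (simp add: inf.absorb2)
      ultimately show ?thesis unfolding test_function_def C1_differentiable_on_def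
        using D by (auto simp: has_real_derivative_iff_has_vector_derivative intro!: exI[of _ "d n"])
    qed
    have dd: "deriv (\<phi> n) x = d n x" for n x using D by (rule DERIV_imp_deriv)
    have E: "(LBINT x. d n x *\<^sub>R q x) = - (LBINT x. \<phi> n x *\<^sub>R g x)" for n
      using W[unfolded has_weak_deriv_def, rule_format, OF tf[of n]] unfolding dd .
    have "(LBINT x. d n x *\<^sub>R q x) = (LBINT x. (N n * tent (N n * (x - s))) *\<^sub>R q x) - (LBINT x. (N n * tent (N n * (x - t))) *\<^sub>R q x)" for n
      unfolding d_def scaleR_diff_left N_def using tent_mollify(2)[OF q, of n]
      by (intro Bochner_Integration.integral_diff)
    moreover have "(\<lambda>n. (LBINT x. (N n * tent (N n * (x - s))) *\<^sub>R q x) - (LBINT x. (N n * tent (N n * (x - t))) *\<^sub>R q x)) \<longlonglongrightarrow> q s - q t"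
      unfolding N_def by (intro tendsto_diff tent_mollify(1)[OF q])
    ultimately have L1: "(\<lambda>n. - (LBINT x. \<phi> n x *\<^sub>R g x)) \<longlonglongrightarrow> q s - q t" using E by simp
    have NI: "\<exists>n0. \<forall>n\<ge>n0. 1 \<le> N n * e" if "e > 0" for e
    proof -
      obtain n0 where "1 / e < real n0" using reals_Archimedean2 by blast
      have "1 \<le> N n * e" if "n \<ge> n0" for n
      proof -
        have "real n0 \<le> N n" using that by (simp add: N_def)
        then have "1 / e < N n" using \<open>1 / e < real n0\<close> by linarith
        then show ?thesis using \<open>e > 0\<close> by (simp add: divide_less_eq)
      qed
      then show ?thesis by blast
    qed
    \<comment> \<open>The limit is half-open because \<open>step1\<close> vanishes at 0; the missing
      endpoint s is a null set.\<close>
    have ptw: "(\<lambda>n. \<phi> n x) \<longlonglongrightarrow> indicator {s<..t} x" for x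
    proof -
      have s1: "(\<lambda>n. step1 (N n * (x - c))) \<longlonglongrightarrow> (if c < x then 1 else 0)" for c
      proof (cases "c < x")
        case True
        then obtain n0 where "\<forall>n\<ge>n0. 1 \<le> N n * (x - c)" using NI[of "x - c"] by auto
        then have "\<forall>\<^sub>F n in sequentially. step1 (N n * (x - c)) = 1"
          using step1_simps(2) unfolding eventually_sequentially by blast
        then show ?thesis using True by (simp add: tendsto_eventually)
      next
        case False
        then have "step1 (N n * (x - c)) = 0" for n using N[of n] by (intro step1_simps) (simp add: mult_le_0_iff)
        then show ?thesis using False by simp
      qed
      have "(\<lambda>n. \<phi> n x) \<longlonglongrightarrow> (if s < x then 1 else 0) - (if t < x then 1 else 0)"
        unfolding \<phi>_def by (intro tendsto_diff s1)
      moreover have "(if s < x then 1 else 0) - (if t < x then 1 else 0) = (indicator {s<..t} x :: real)"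
        using st by (auto simp: indicator_def)
      ultimately show ?thesis by simp
    qed
    have [measurable]: "\<phi> n \<in> borel_measurable borel" for n
      using D by (intro borel_measurable_continuous_onI continuous_at_imp_continuous_on) (auto intro: DERIV_isCont)
    have bd: "norm (\<phi> n x *\<^sub>R g x) \<le> norm (indicator {s..t+1} x *\<^sub>R g x)" for n x
    proof (cases "x \<in> {s..t+1}")
      case True
      have "\<bar>\<phi> n x\<bar> \<le> 1" unfolding \<phi>_def using step1_bounds by (smt (verit))
      then show ?thesis using True by (auto intro: mult_left_le_one_le)
    qed (use supp in auto)
    have "(\<lambda>n. LBINT x. \<phi> n x *\<^sub>R g x) \<longlonglongrightarrow> (LBINT x. indicator {s<..t} x *\<^sub>R g x)"
      by (rule integral_dominated_convergence[where w="\<lambda>x. norm (indicator {s..t+1} x *\<^sub>R g x)"])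
         (use gi[of s "t+1"] bd in \<open>auto simp: set_integrable_def intro!: tendsto_intros ptw simp del: norm_scaleR\<close>)
    from tendsto_minus[OF this] have "q s - q t = - (LBINT x. indicator {s<..t} x *\<^sub>R g x)"
      using LIMSEQ_unique[OF L1] by blast
    moreover have "(LBINT x. indicator {s<..t} x *\<^sub>R g x) = (LBINT x:{s..t}. g x)"
      unfolding set_lebesgue_integral_def
    proof (rule integral_cong_AE)
      show "AE x in lborel. indicat_real {s<..t} x *\<^sub>R g x = indicat_real {s..t} x *\<^sub>R g x"
        using AE_lborel_singleton[of s] by eventually_elim (auto simp: indicator_def)
    qed auto
    ultimately show ?thesis by (simp add: algebra_simps)
  qed
  then show ?thesis using sq unfolding primitive_on_def by auto
qed

lemma H1_loc_primitive:
  assumes "H1_loc q"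
  shows "primitive_on a b q (weak_deriv q)"
proof -
  obtain g where "L2_loc g \<and> has_weak_deriv q g" using assms by (auto simp: H1_loc_def)
  then have "L2_loc (weak_deriv q) \<and> has_weak_deriv q (weak_deriv q)"
    unfolding weak_deriv_def by (rule someI[of "\<lambda>g. L2_loc g \<and> has_weak_deriv q g"])
  then show ?thesis using assms has_weak_deriv_imp_primitive unfolding H1_loc_def by blast
qed

lemma weak_deriv_AE_eq:
  assumes P: "\<And>a b. primitive_on a b q g"
  shows "AE t in lborel. weak_deriv q t = g t"
proof -
  have "AE t in lborel. t \<in> {-real n..real n} \<longrightarrow> weak_deriv q t = g t" for n
    by (rule primitive_on_unique[OF H1_loc_primitive[OF primitive_imp_H1_loc(1)[OF P]] P])
  then have "AE t in lborel. \<forall>n. t \<in> {-real n..real n} \<longrightarrow> weak_deriv q t = g t"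
    unfolding AE_all_countable by blast
  then show ?thesis
  proof eventually_elim
    case (elim t)
    obtain n where "\<bar>t\<bar> < real n" using reals_Archimedean2 by blast
    then have "t \<in> {-real n..real n}" by (auto simp: abs_less_iff)
    then show ?case using elim by blast
  qed
qed

subsection \<open>Competitors and the minimal action\<close>

text \<open>The derivative is a parameter, so that a competitor can be used with the derivative it
  is built with instead of the representative chosen by \<open>weak_deriv\<close>.\<close>

definition lagrangian ::
    "(real ^ 'n \<Rightarrow> real) \<Rightarrow> real \<Rightarrow> (real \<Rightarrow> real ^ 'n) \<Rightarrow> (real \<Rightarrow> real ^ 'n) \<Rightarrow> real \<Rightarrow> ennreal" where
  "lagrangian V c q g t = ennreal (1/2 * (norm (g t))\<^sup>2 + (V (q t) - c))"

lemma lagrangian_measurable: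
  assumes "continuous_on UNIV V" "q \<in> borel_measurable borel" "g \<in> borel_measurable borel"
  shows "lagrangian V c q g \<in> borel_measurable borel"
proof -
  have [measurable]: "V \<in> borel_measurable borel" "q \<in> borel_measurable borel" "g \<in> borel_measurable borel"
    using assms by (auto intro: borel_measurable_continuous_onI)
  show ?thesis unfolding lagrangian_def[abs_def] by measurable
qed

lemma action_on_primitive:
  assumes "\<And>a b. primitive_on a b q g"
  shows "action_on V c S q = (\<integral>\<^sup>+t\<in>S. lagrangian V c q g t \<partial>lborel)"
  unfolding action_on_def lagrangian_def
  by (rule nn_integral_cong_AE) (use weak_deriv_AE_eq[OF assms] in \<open>eventually_elim, simp\<close>)

text \<open>The two lower limits see only the behaviour near infinity, so a change on a bounded
  interval preserves them.\<close>

lemma Gamma_paths_cong: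
  assumes q: "q \<in> Gamma_paths V c A B" and r: "\<And>a b. primitive_on a b r h"
    and V: "\<And>t. V (r t) \<ge> c" and out: "\<And>t. t \<notin> {a..b} \<Longrightarrow> r t = q t"
  shows "r \<in> Gamma_paths V c A B"
proof -
  have "\<forall>\<^sub>F t in at_bot. ereal (infdist (r t) A) = ereal (infdist (q t) A)"
    using eventually_gt_at_bot[of a] by eventually_elim (use out in auto)
  then have "Liminf at_bot (\<lambda>t. ereal (infdist (r t) A)) = Liminf at_bot (\<lambda>t. ereal (infdist (q t) A))"
    by (rule Liminf_eq)
  moreover have "\<forall>\<^sub>F t in at_top. ereal (infdist (r t) B) = ereal (infdist (q t) B)"
    using eventually_gt_at_top[of b] by eventually_elim (use out in auto)
  then have "Liminf at_top (\<lambda>t. ereal (infdist (r t) B)) = Liminf at_top (\<lambda>t. ereal (infdist (q t) B))"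
    by (rule Liminf_eq)
  ultimately show ?thesis
    using q V primitive_imp_H1_loc(1)[OF r] unfolding Gamma_paths_def by auto
qed

section \<open>Upper bounds for the minimal action\<close>

locale decomposition =
  fixes V :: "real ^ 'n \<Rightarrow> real" and c :: real and A B :: "(real ^ 'n) set"
  assumes contV: "continuous_on UNIV V"
    and closed_A: "closed A" and closed_B: "closed B" and disj: "A \<inter> B = {}"
    and union: "A \<union> B = sublevel V c"
begin

text \<open>The path need not satisfy V \<ge> c. Between its last time T1 in A and the first later
  time T2 in B it stays above the level c, and by continuity V = c at both times, so freezing it
  outside {T1..T2} costs nothing. The discarded pieces contribute nonnegative amounts, since
  \<open>ennreal\<close> truncates negative values to 0.\<close>

lemma min_action_le_crossing:
  assumes P: "primitive_on s t \<gamma> g" and "s \<le> t" and "\<gamma> s \<in> A" and "\<gamma> t \<in> B"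
  shows "min_action V c A B \<le> (\<integral>\<^sup>+x\<in>{s..t}. lagrangian V c \<gamma> g x \<partial>lborel)"
proof -
  have ct: "continuous_on {s..t} \<gamma>" by (rule primitive_on_continuous[OF P])
  define S where "S = {s..t} \<inter> \<gamma> -` A"
  have S: "compact S" "S \<noteq> {}"
    using continuous_closed_preimage[OF ct _ closed_A] assms by (auto simp: S_def compact_eq_bounded_closed intro: bounded_Int)
  from compact_attains_sup[OF S] obtain T1 where T1: "T1 \<in> S" "\<And>x. x \<in> S \<Longrightarrow> x \<le> T1" by blast
  define S' where "S' = {T1..t} \<inter> \<gamma> -` B"
  have ct': "continuous_on {T1..t} \<gamma>" using ct T1 by (auto intro: continuous_on_subset simp: S_def)
  have S': "compact S'" "S' \<noteq> {}"
    using continuous_closed_preimage[OF ct' _ closed_B] assms T1 by (auto simp: S_def S'_def compact_eq_bounded_closed intro: bounded_Int)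
  from compact_attains_inf[OF S'] obtain T2 where T2: "T2 \<in> S'" "\<And>x. x \<in> S' \<Longrightarrow> T2 \<le> x" by blast
  have T: "s \<le> T1" "T1 < T2" "T2 \<le> t" "\<gamma> T1 \<in> A" "\<gamma> T2 \<in> B"
    using T1 T2 disj by (auto simp: S_def S'_def less_le)
  have int: "V (\<gamma> x) > c" if "T1 < x" "x < T2" for x
  proof -
    have "\<gamma> x \<notin> A" using T1(2)[of x] that T by (auto simp: S_def)
    moreover have "\<gamma> x \<notin> B" using T2(2)[of x] that T by (auto simp: S'_def)
    ultimately have "\<gamma> x \<notin> sublevel V c" unfolding union[symmetric] by simp
    then show ?thesis by (simp add: sublevel_def)
  qed
  have ge: "V (\<gamma> x) \<ge> c" if "x \<in> {T1..T2}" for x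
  proof (rule continuous_ge_on_closure[where S="{T1<..<T2}" and f="\<lambda>x. V (\<gamma> x)"])
    show "continuous_on (closure {T1<..<T2}) (\<lambda>x. V (\<gamma> x))"
      using T by (auto intro!: continuous_on_compose2[OF contV] continuous_on_subset[OF ct])
  qed (use that int T in \<open>auto intro: less_imp_le\<close>)
  have V1: "V (\<gamma> T1) = c" "V (\<gamma> T2) = c"
  proof -
    have "\<gamma> T1 \<in> sublevel V c" "\<gamma> T2 \<in> sublevel V c" unfolding union[symmetric] using T by simp_all
    then show "V (\<gamma> T1) = c" "V (\<gamma> T2) = c"
      using ge[of T1] ge[of T2] T by (auto simp: sublevel_def intro!: antisym)
  qed
  define \<gamma>' where "\<gamma>' x = \<gamma> (max T1 (min T2 x))" for x
  define g' where "g' x = indicator {T1..T2} x *\<^sub>R g x" for x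
  have P': "primitive_on a b \<gamma>' g'" for a b
    unfolding \<gamma>'_def g'_def using T by (intro primitive_on_clamp primitive_on_subset[OF P]) auto
  have cl: "max T1 (min T2 x) \<in> {T1..T2}" for x using T by auto
  have lo: "\<gamma>' x = \<gamma> T1" if "x \<le> T1" for x using that T by (simp add: \<gamma>'_def max_absorb1 min_absorb2)
  have hi: "\<gamma>' x = \<gamma> T2" if "T2 \<le> x" for x using that T by (simp add: \<gamma>'_def max_absorb2 min_absorb1)
  have "\<gamma>' \<in> Gamma_paths V c A B"
  proof -
    have "\<forall>\<^sub>F x in at_bot. ereal (infdist (\<gamma>' x) A) = 0"
      using eventually_le_at_bot[of T1] by eventually_elim (use lo T in auto)
    then have "Liminf at_bot (\<lambda>x. ereal (infdist (\<gamma>' x) A)) = 0"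
      by (intro lim_imp_Liminf tendsto_eventually) auto
    moreover have "\<forall>\<^sub>F x in at_top. ereal (infdist (\<gamma>' x) B) = 0"
      using eventually_ge_at_top[of T2] by eventually_elim (use hi T in auto)
    then have "Liminf at_top (\<lambda>x. ereal (infdist (\<gamma>' x) B)) = 0"
      by (intro lim_imp_Liminf tendsto_eventually) auto
    ultimately show ?thesis
      using primitive_imp_H1_loc(1)[OF P'] ge[OF cl] by (simp add: Gamma_paths_def \<gamma>'_def)
  qed
  then have "min_action V c A B \<le> action_on V c UNIV \<gamma>'"
    unfolding min_action_def by (rule INF_lower)
  also have "\<dots> = (\<integral>\<^sup>+x. lagrangian V c \<gamma>' g' x \<partial>lborel)"
    using action_on_primitive[OF P'] by simp
  also have "\<dots> \<le> (\<integral>\<^sup>+x\<in>{s..t}. lagrangian V c \<gamma> g x \<partial>lborel)"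
  proof (rule nn_integral_mono)
    fix x
    consider "x < T1" | "x > T2" | "x \<in> {T1..T2}" by fastforce
    then show "lagrangian V c \<gamma>' g' x \<le> lagrangian V c \<gamma> g x * indicator {s..t} x"
    proof cases
      case 3
      then have "\<gamma>' x = \<gamma> x" by (simp add: \<gamma>'_def)
      then show ?thesis using 3 T by (simp add: lagrangian_def g'_def)
    qed (use lo hi V1 in \<open>auto simp: lagrangian_def g'_def\<close>)
  qed
  finally show ?thesis .
qed

text \<open>Straight segments of duration 1 join x to q a and q b to y. Each has speed at most d and
  stays in a ball where V \<le> e, so as c \<ge> 0 it costs at most d^2/2 + e.\<close>

lemma min_action_le_bridge:
  assumes P: "primitive_on a b q g" and ab: "a \<le> b" and c: "c \<ge> 0"
    and mq: "q \<in> borel_measurable borel"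
    and x: "x \<in> A" "norm (q a - x) \<le> d" "\<And>z. z \<in> cball x d \<Longrightarrow> V z \<le> e"
    and y: "y \<in> B" "norm (q b - y) \<le> d" "\<And>z. z \<in> cball y d \<Longrightarrow> V z \<le> e"
  shows "min_action V c A B \<le>
    (\<integral>\<^sup>+t\<in>{a..b}. lagrangian V c q g t \<partial>lborel) + ennreal (d\<^sup>2 + 2 * e)"
proof -
  have d: "d \<ge> 0" using x(2) norm_ge_zero order_trans by blast
  define l1 where "l1 t = x + (t - (a - 1)) *\<^sub>R (q a - x)" for t
  define l2 where "l2 t = q b + (t - b) *\<^sub>R (y - q b)" for t
  define r where "r t = (if t \<le> b then q t else l2 t)" for t
  define h where "h t = (if t \<le> b then g t else y - q b)" for t
  define \<gamma> where "\<gamma> t = (if t \<le> a then l1 t else r t)" for t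
  define k where "k t = (if t \<le> a then q a - x else h t)" for t
  have "primitive_on (a-1) a l1 (\<lambda>_. q a - x)"
    unfolding l1_def
    by (rule primitive_on_C1) (auto intro!: derivative_eq_intros)
  moreover have "primitive_on b (b+1) l2 (\<lambda>_. y - q b)"
    unfolding l2_def
    by (rule primitive_on_C1) (auto intro!: derivative_eq_intros)
  then have "primitive_on a (b+1) r h"
    unfolding r_def h_def by (rule primitive_on_glue[OF P]) (use ab in \<open>auto simp: l2_def\<close>)
  ultimately have G: "primitive_on (a-1) (b+1) \<gamma> k"
    unfolding \<gamma>_def k_def by (rule primitive_on_glue) (use ab in \<open>auto simp: l1_def r_def\<close>)
  have m: "lagrangian V c q g \<in> borel_measurable borel"
    by (rule lagrangian_measurable[OF contV mq primitive_onD(1)[OF P]])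
  have "min_action V c A B \<le> (\<integral>\<^sup>+t\<in>{a-1..b+1}. lagrangian V c \<gamma> k t \<partial>lborel)"
    by (rule min_action_le_crossing[OF G]) (use ab x y in \<open>auto simp: \<gamma>_def r_def l1_def l2_def\<close>)
  also have "\<dots> \<le> (\<integral>\<^sup>+t. lagrangian V c q g t * indicator {a..b} t +
      (ennreal (d\<^sup>2/2 + e) * indicator {a-1..a} t + ennreal (d\<^sup>2/2 + e) * indicator {b..b+1} t) \<partial>lborel)"
  proof (rule nn_integral_mono)
    fix t
    have sq: "(norm u)\<^sup>2 \<le> d\<^sup>2" if "norm u \<le> d" for u :: "real^'n" using that by (intro power_mono) auto
    consider "t \<notin> {a-1..b+1}" | "t \<in> {a-1..a}" | "t \<in> {a<..b}" | "t \<in> {b<..b+1}" "t > a"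
      by fastforce
    then show "lagrangian V c \<gamma> k t * indicator {a-1..b+1} t \<le> lagrangian V c q g t * indicator {a..b} t +
      (ennreal (d\<^sup>2/2 + e) * indicator {a-1..a} t + ennreal (d\<^sup>2/2 + e) * indicator {b..b+1} t)"
    proof cases
      case 2
      have "\<bar>t - (a - 1)\<bar> * norm (q a - x) \<le> 1 * d"
        using 2 x(2) d by (intro mult_mono) auto
      then have "norm (l1 t - x) \<le> d" by (simp add: l1_def)
      then have "V (l1 t) \<le> e" using x(3)[of "l1 t"] by (simp add: dist_norm norm_minus_commute)
      then have "lagrangian V c \<gamma> k t \<le> ennreal (d\<^sup>2/2 + e)"
        unfolding lagrangian_def using 2 sq[OF x(2)] c by (intro ennreal_leI) (auto simp: \<gamma>_def k_def)
      then show ?thesis using 2 by (simp add: indicator_def add_increasing add_increasing2)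
    next
      case 3
      then have "lagrangian V c \<gamma> k t = lagrangian V c q g t"
        by (simp add: lagrangian_def \<gamma>_def k_def r_def h_def)
      then show ?thesis using 3 by (auto simp: indicator_def)
    next
      case 4
      have "\<bar>1 - (t - b)\<bar> * norm (q b - y) \<le> 1 * d"
        using 4 y(2) d by (intro mult_mono) auto
      moreover have "l2 t - y = (1 - (t - b)) *\<^sub>R (q b - y)" by (simp add: l2_def algebra_simps)
      ultimately have "norm (l2 t - y) \<le> d" by simp
      then have "V (l2 t) \<le> e" using y(3)[of "l2 t"] by (simp add: dist_norm norm_minus_commute)
      moreover have "norm (y - q b) \<le> d" using y(2) by (simp add: norm_minus_commute)
      ultimately have "lagrangian V c \<gamma> k t \<le> ennreal (d\<^sup>2/2 + e)"
        unfolding lagrangian_def using 4 sq[of "y - q b"] c by (intro ennreal_leI) (auto simp: \<gamma>_def k_def r_def h_def)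
      then show ?thesis using 4 by (simp add: indicator_def add_increasing add_increasing2)
    qed (auto simp: indicator_def)
  qed
  also have "\<dots> = (\<integral>\<^sup>+t\<in>{a..b}. lagrangian V c q g t \<partial>lborel) + (ennreal (d\<^sup>2/2 + e) + ennreal (d\<^sup>2/2 + e))"
    using m by (subst nn_integral_add; (subst nn_integral_add)?; simp add: nn_integral_cmult_indicator)
  also have "ennreal (d\<^sup>2/2 + e) + ennreal (d\<^sup>2/2 + e) = ennreal (d\<^sup>2 + 2 * e)"
  proof (cases "d\<^sup>2/2 + e \<ge> 0")
    case True
    then show ?thesis by (subst ennreal_plus[symmetric]) (auto simp: field_simps)
  next
    case False
    then show ?thesis by (simp add: ennreal_neg)
  qed
  finally show ?thesis .
qed

end

text \<open>Finiteness of the minimum allows common parts of two actions to be cancelled in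
  \<open>ennreal\<close>, and it forces zero shifted energy on long intervals.\<close>

locale action_minimizer = decomposition +
  fixes gradV :: "real ^ 'n \<Rightarrow> real ^ 'n" and q :: "real \<Rightarrow> real ^ 'n"
  assumes grad: "\<And>x. GDERIV V x :> gradV x" and contg: "continuous_on UNIV gradV"
    and qG: "q \<in> Gamma_paths V c A B"
    and qmin: "action_on V c UNIV q = min_action V c A B"
    and fin: "min_action V c A B < \<infinity>"
begin

abbreviation g where "g \<equiv> weak_deriv q"
abbreviation L where "L \<equiv> lagrangian V c q g"
abbreviation m where "m \<equiv> min_action V c A B"

lemma Vq: "V (q t) \<ge> c" using qG by (simp add: Gamma_paths_def)
lemma prim_q: "primitive_on a b q g"
  using qG by (intro H1_loc_primitive) (simp add: Gamma_paths_def)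
lemma cont_q: "continuous_on S q"
  using qG by (auto simp: Gamma_paths_def H1_loc_def intro: continuous_on_subset)
lemma meas_q [measurable]: "q \<in> borel_measurable borel"
  by (rule borel_measurable_continuous_onI) (rule cont_q)
lemma meas_g [measurable]: "g \<in> borel_measurable borel"
  using primitive_onD(1)[OF prim_q] .
lemma meas_L [measurable]: "L \<in> borel_measurable borel"
  by (rule lagrangian_measurable[OF contV meas_q meas_g])
lemma total_action: "(\<integral>\<^sup>+t. L t \<partial>lborel) = m"
  using action_on_primitive[OF prim_q, of V c UNIV] qmin by simp

text \<open>The competitor on {a..b} is spliced into q by adding the clamped difference r - q, which
  vanishes outside. Both paths then have the same finite action off {a..b}, and it cancels.\<close>

lemma action_local_min:
  assumes P: "primitive_on a b r h" and ab: "a \<le> b" and ends: "r a = q a" "r b = q b"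
    and V: "\<And>t. t \<in> {a..b} \<Longrightarrow> V (r t) \<ge> c"
  shows "(\<integral>\<^sup>+t\<in>{a..b}. L t \<partial>lborel) \<le> (\<integral>\<^sup>+t\<in>{a..b}. lagrangian V c r h t \<partial>lborel)"
proof -
  define \<phi> where "\<phi> t = r t - q t" for t
  have "primitive_on a b \<phi> (\<lambda>t. h t - g t)"
    unfolding \<phi>_def by (rule primitive_on_diff[OF P prim_q])
  from primitive_on_clamp[OF this ab]
  have "primitive_on s t (\<lambda>x. \<phi> (max a (min b x))) (\<lambda>x. indicator {a..b} x *\<^sub>R (h x - g x))" for s t .
  from primitive_on_add[OF prim_q this]
  have P': "primitive_on s t (\<lambda>x. q x + \<phi> (max a (min b x))) (\<lambda>x. g x + indicator {a..b} x *\<^sub>R (h x - g x))"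
    (is "primitive_on s t ?r ?h") for s t .
  have in': "?r x = r x" "?h x = h x" if "x \<in> {a..b}" for x
    using that by (auto simp: \<phi>_def)
  have out: "?r x = q x" "?h x = g x" if "x \<notin> {a..b}" for x
  proof -
    have "max a (min b x) = a \<or> max a (min b x) = b" using that ab by (auto simp: max_def min_def)
    then show "?r x = q x" using ends by (auto simp: \<phi>_def)
  qed (use that in simp)
  have "?r \<in> Gamma_paths V c A B"
    by (rule Gamma_paths_cong[OF qG P', of a b]) (use in' out V Vq in metis)+
  then have "m \<le> action_on V c UNIV ?r"
    unfolding min_action_def by (rule INF_lower)
  also have "\<dots> = (\<integral>\<^sup>+t. lagrangian V c ?r ?h t \<partial>lborel)"
    using action_on_primitive[OF P', of V c UNIV] by simp
  also have "\<dots> = (\<integral>\<^sup>+t\<in>{a..b}. lagrangian V c ?r ?h t \<partial>lborel) + (\<integral>\<^sup>+t\<in>-{a..b}. lagrangian V c ?r ?h t \<partial>lborel)"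
  proof -
    have "lagrangian V c ?r ?h \<in> borel_measurable borel"
      using primitive_imp_H1_loc(1)[OF P'] primitive_onD(1)[OF P'] contV
      by (intro lagrangian_measurable) (auto simp: H1_loc_def L2_loc_def)
    then show ?thesis using nn_integral_disjoint_pair[of "lagrangian V c ?r ?h" lborel "{a..b}" "-{a..b}"] by simp
  qed
  also have "(\<integral>\<^sup>+t\<in>-{a..b}. lagrangian V c ?r ?h t \<partial>lborel) = (\<integral>\<^sup>+t\<in>-{a..b}. L t \<partial>lborel)"
    by (rule set_nn_integral_cong) (use out in \<open>auto simp: lagrangian_def\<close>)
  also have "(\<integral>\<^sup>+t\<in>{a..b}. lagrangian V c ?r ?h t \<partial>lborel) = (\<integral>\<^sup>+t\<in>{a..b}. lagrangian V c r h t \<partial>lborel)"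
    by (rule set_nn_integral_cong) (use in' in \<open>auto simp: lagrangian_def\<close>)
  finally have le: "m \<le> (\<integral>\<^sup>+t\<in>{a..b}. lagrangian V c r h t \<partial>lborel) + (\<integral>\<^sup>+t\<in>-{a..b}. L t \<partial>lborel)" .
  have split: "m = (\<integral>\<^sup>+t\<in>{a..b}. L t \<partial>lborel) + (\<integral>\<^sup>+t\<in>-{a..b}. L t \<partial>lborel)"
    using nn_integral_disjoint_pair[of L lborel "{a..b}" "-{a..b}"] total_action by simp
  have "(\<integral>\<^sup>+t\<in>-{a..b}. L t \<partial>lborel) < \<infinity>"
    using split fin by (auto simp: less_top)
  then show ?thesis using le unfolding split
    by (simp add: add.commute ennreal_add_left_cancel_le less_top[symmetric])
qed

end

subsection \<open>The Euler-Lagrange equation and conservation of energy\<close>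

lemma GDERIV_mvt:
  fixes V :: "real ^ 'n \<Rightarrow> real"
  assumes grad: "\<And>x. GDERIV V x :> gradV x"
  obtains t where "0 < t" "t < 1" "V (x + h) - V x = gradV (x + t *\<^sub>R h) \<bullet> h"
proof -
  have D: "((\<lambda>t. V (x + t *\<^sub>R h)) has_derivative (\<lambda>s. s * (gradV (x + t *\<^sub>R h) \<bullet> h))) (at t within S)" for t S
  proof -
    have "(V has_derivative (\<lambda>u. u \<bullet> gradV (x + t *\<^sub>R h))) (at (x + t *\<^sub>R h))"
      using grad unfolding gderiv_def .
    moreover have "((\<lambda>t. x + t *\<^sub>R h) has_derivative (\<lambda>s. s *\<^sub>R h)) (at t within S)"
      by (auto intro!: derivative_eq_intros)
    ultimately have "((\<lambda>t. V (x + t *\<^sub>R h)) has_derivative (\<lambda>s. (s *\<^sub>R h) \<bullet> gradV (x + t *\<^sub>R h))) (at t within S)"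
      by (rule has_derivative_compose[rotated])
    then show ?thesis by (simp add: inner_commute)
  qed
  show ?thesis using mvt_simple[of 0 1 "\<lambda>t. V (x + t *\<^sub>R h)", OF _ D] that by auto
qed

text \<open>Uniform continuity of the gradient on the ball of radius r + 1, which contains x + h,
  makes the error uniform in x.\<close>

lemma GDERIV_linearization:
  fixes V :: "real ^ 'n \<Rightarrow> real"
  assumes grad: "\<And>x. GDERIV V x :> gradV x" and contg: "continuous_on UNIV gradV" and "e > 0"
  obtains d where "d > 0" "\<And>x h. norm x \<le> r \<Longrightarrow> norm h < d \<Longrightarrow> \<bar>V (x + h) - V x - gradV x \<bullet> h\<bar> \<le> e * norm h"
proof -
  have "uniformly_continuous_on (cball 0 (r + 1)) gradV"
    by (intro compact_uniformly_continuous continuous_on_subset[OF contg]) auto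
  then obtain d where d: "d > 0" "\<And>x y. x \<in> cball 0 (r+1) \<Longrightarrow> y \<in> cball 0 (r+1) \<Longrightarrow> dist y x < d \<Longrightarrow> dist (gradV y) (gradV x) < e"
    using \<open>e > 0\<close> unfolding uniformly_continuous_on_def by metis
  show ?thesis
  proof
    show "min d 1 > 0" using d by simp
    fix x h :: "real^'n" assume x: "norm x \<le> r" and h: "norm h < min d 1"
    obtain t where t: "0 < t" "t < 1" "V (x + h) - V x = gradV (x + t *\<^sub>R h) \<bullet> h"
      using GDERIV_mvt[OF grad] .
    have "norm (t *\<^sub>R h) \<le> norm h" using t by (auto intro: mult_left_le_one_le)
    then have th: "norm (t *\<^sub>R h) < d" "norm (t *\<^sub>R h) < 1" using h by auto
    have nr: "norm (x + t *\<^sub>R h) \<le> r + 1" using norm_triangle_ineq[of x "t *\<^sub>R h"] x th by linarith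
    have "dist (gradV (x + t *\<^sub>R h)) (gradV x) < e"
    proof (rule d(2)[rotated 2])
      show "dist (x + t *\<^sub>R h) x < d" using th by (simp add: dist_norm)
    qed (use x nr in auto)
    then have "\<bar>(gradV (x + t *\<^sub>R h) - gradV x) \<bullet> h\<bar> \<le> e * norm h"
      using Cauchy_Schwarz_ineq2[of "gradV (x + t *\<^sub>R h) - gradV x" h]
      by (smt (verit) dist_norm mult_right_mono norm_ge_zero)
    then show "\<bar>V (x + h) - V x - gradV x \<bullet> h\<bar> \<le> e * norm h"
      using t by (simp add: inner_diff_left)
  qed
qed

lemma antiderivative_exists:
  fixes f :: "real \<Rightarrow> 'a::euclidean_space"
  assumes "continuous_on UNIV f"
  obtains F where "\<And>t. (F has_vector_derivative f t) (at t)"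
proof -
  have "isCont f x" for x using assms by (simp add: continuous_on_eq_continuous_at)
  then have "\<exists>F. \<forall>x. (-\<infinity>::ereal) < ereal x \<longrightarrow> ereal x < \<infinity> \<longrightarrow> (F has_vector_derivative f x) (at x)"
    by (intro einterval_antiderivative) auto
  then show ?thesis using that by auto
qed

lemma set_nn_integral_eq_LBINT:
  fixes f :: "real \<Rightarrow> real"
  assumes "set_integrable lborel A f" "\<And>t. t \<in> A \<Longrightarrow> f t \<ge> 0"
  shows "(\<integral>\<^sup>+t\<in>A. ennreal (f t) \<partial>lborel) = ennreal (LBINT t:A. f t)"
proof -
  have "(\<integral>\<^sup>+t\<in>A. ennreal (f t) \<partial>lborel) = (\<integral>\<^sup>+t. ennreal (indicator A t *\<^sub>R f t) \<partial>lborel)"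
    by (rule nn_integral_cong) (auto simp: indicator_def)
  also have "\<dots> = ennreal (LBINT t:A. f t)"
    unfolding set_lebesgue_integral_def
    by (rule nn_integral_eq_integral) (use assms in \<open>auto simp: set_integrable_def indicator_def\<close>)
  finally show ?thesis .
qed

context action_minimizer
begin

lemma cont_Vq: "continuous_on S (\<lambda>t. V (q t))"
  by (rule continuous_on_compose2[OF contV cont_q]) auto

lemma cont_gradVq: "continuous_on S (\<lambda>t. gradV (q t))"
  by (rule continuous_on_compose2[OF contg cont_q]) auto

lemma lagrangian_integrable:
  assumes "primitive_on a b r h"
  shows "set_integrable lborel {a..b} (\<lambda>t. 1/2 * (norm (h t))\<^sup>2 + (V (r t) - c))"
proof -
  have "continuous_on {a..b} (\<lambda>t. V (r t) - c)"
    by (intro continuous_intros continuous_on_compose2[OF contV primitive_on_continuous[OF assms]]) auto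
  then have "set_integrable lborel {a..b} (\<lambda>t. V (r t) - c)"
    by (rule borel_integrable_atLeastAtMost')
  moreover have "set_integrable lborel {a..b} (\<lambda>t. 1/2 * (norm (h t))\<^sup>2)"
    using primitive_onD(2)[OF assms] by simp
  ultimately show ?thesis by (intro set_integral_add)
qed

text \<open>The competitor is \<open>q\<close> moved slightly towards the solution \<open>y\<close> of the linear problem
  \<open>y'' = \<nabla>V(q)\<close> with the boundary values of \<open>q\<close>; the first variation in this direction is
  minus the squared \<open>L\<^sup>2\<close> norm of \<open>q' - y'\<close>.\<close>

lemma euler_lagrange:
  assumes ab: "a < b" and above: "\<And>t. t \<in> {a..b} \<Longrightarrow> V (q t) > c"
  obtains v where "\<And>t. t \<in> {a<..<b} \<Longrightarrow> (q has_vector_derivative v t) (at t)"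
    "\<And>t. (v has_vector_derivative gradV (q t)) (at t)"
    "AE t in lborel. t \<in> {a..b} \<longrightarrow> g t = v t"
proof -
  define f where "f t = gradV (q t)" for t
  have cf: "continuous_on S f" for S unfolding f_def by (rule cont_gradVq)
  obtain F where F: "\<And>t. (F has_vector_derivative f t) (at t)" using antiderivative_exists[OF cf] by blast
  have cF: "continuous_on UNIV F"
    using F has_vector_derivative_continuous continuous_at_imp_continuous_on by blast
  obtain G where G: "\<And>t. (G has_vector_derivative F t) (at t)" using antiderivative_exists[OF cF] by blast
  \<comment> \<open>The constant slope that makes y agree with q at b as well as at a.\<close>
  define w where "w = (1 / (b - a)) *\<^sub>R ((q b - q a) - (G b - G a))"
  define y where "y t = q a + (G t - G a) + (t - a) *\<^sub>R w" for t
  define v where "v t = F t + w" for t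
  have y: "(y has_vector_derivative v t) (at t)" for t
    unfolding y_def[abs_def] v_def by (auto intro!: derivative_eq_intros G)
  have v: "(v has_vector_derivative f t) (at t)" for t
    unfolding v_def[abs_def] by (auto intro!: derivative_eq_intros F)
  have cv: "continuous_on UNIV v" unfolding v_def[abs_def] by (intro continuous_intros cF)
  have yab: "y a = q a" "y b = q b" using ab by (auto simp: y_def w_def)
  define \<phi> where "\<phi> t = q t - y t" for t
  define \<psi> where "\<psi> t = g t - v t" for t
  have py: "primitive_on a b y v"
    by (rule primitive_on_C1[OF less_imp_le[OF ab] has_vector_derivative_at_within[OF y] cv])
  have P\<phi>: "primitive_on a b \<phi> \<psi>"
    unfolding \<phi>_def \<psi>_def by (rule primitive_on_diff[OF prim_q py])
  note D = primitive_onD[OF P\<phi>]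
  have \<phi>0: "\<phi> a = 0" "\<phi> b = 0" using yab by (auto simp: \<phi>_def)
  note ibp = integration_by_parts_primitive[OF bounded_bilinear_inner less_imp_le[OF ab] P\<phi>
      has_vector_derivative_at_within[OF v] cf]
  define P where "P = (LBINT t:{a..b}. (norm (\<psi> t))\<^sup>2)"
  have P0: "P \<ge> 0" unfolding P_def set_lebesgue_integral_def by (rule Bochner_Integration.integral_nonneg) auto
  have c\<phi>: "continuous_on {a..b} \<phi>" by (rule primitive_on_continuous[OF P\<phi>])
  have cc: "compact {a..b}" by simp
  obtain C0 where "\<And>t. t \<in> {a..b} \<Longrightarrow> norm (\<phi> t) \<le> C0"
    using compact_imp_bounded[OF compact_continuous_image[OF c\<phi> cc]] by (metis bounded_iff imageI)
  then obtain C where C: "C > 0" "\<And>t. t \<in> {a..b} \<Longrightarrow> norm (\<phi> t) \<le> C"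
    by (meson gt_ex linorder_not_le order_less_imp_le order_trans max.cobounded2 less_max_iff_disj zero_less_one max.coboundedI1)
  obtain r where r: "\<And>t. t \<in> {a..b} \<Longrightarrow> norm (q t) \<le> r"
    using compact_imp_bounded[OF compact_continuous_image[OF cont_q cc]] by (metis bounded_iff imageI)
  obtain \<mu> where \<mu>: "\<mu> > 0" "\<And>t. t \<in> {a..b} \<Longrightarrow> V (q t) \<ge> c + \<mu>"
  proof -
    obtain t0 where "t0 \<in> {a..b}" "\<And>t. t \<in> {a..b} \<Longrightarrow> V (q t0) \<le> V (q t)"
      using continuous_attains_inf[OF cc _ cont_Vq] ab by fastforce
    then show ?thesis using that[of "V (q t0) - c"] above by auto
  qed
  \<comment> \<open>The step size s below depends on e, but the inequality obtained is divided by s,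
    so the final bound does not contain it and e can be taken arbitrarily small.\<close>
  have "P / 2 \<le> e * C * (b - a)" if e: "e > 0" for e
  proof -
    obtain d where d: "d > 0" "\<And>x h. norm x \<le> r \<Longrightarrow> norm h < d \<Longrightarrow> \<bar>V (x + h) - V x - gradV x \<bullet> h\<bar> \<le> e * norm h"
      using GDERIV_linearization[OF grad contg e] by metis
    obtain M where M: "M > 0" "\<And>t. t \<in> {a..b} \<Longrightarrow> norm (f t) \<le> M"
    proof -
      obtain M0 where "\<And>t. t \<in> {a..b} \<Longrightarrow> norm (f t) \<le> M0"
        using compact_imp_bounded[OF compact_continuous_image[OF cf cc]] by (metis bounded_iff imageI)
      then show ?thesis using that[of "max M0 1"] by fastforce
    qed
    \<comment> \<open>The three bounds on s: s \<le> 1 keeps the quadratic term below half of the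
      linear one, s * C < d puts the perturbation in the range of the linearisation, and s * (C * (M
      + e)) \<le> \<mu> keeps V \<ge> c along the competitor.\<close>
    define s where "s = min 1 (min (d / (2 * C)) (\<mu> / (C * (M + e))))"
    have s: "s > 0" "s \<le> 1" "s * C < d" "s * (C * (M + e)) \<le> \<mu>"
    proof -
      have pos: "0 < C * (M + e)" using C M e by simp
      show "s > 0" "s \<le> 1" using d C \<mu> pos by (auto simp: s_def)
      have "s \<le> d / (2 * C)" "s \<le> \<mu> / (C * (M + e))" by (auto simp: s_def)
      then show "s * C < d" "s * (C * (M + e)) \<le> \<mu>"
        using C d pos by (auto simp: pos_le_divide_eq)
    qed
    define r' where "r' t = q t - s *\<^sub>R \<phi> t" for t
    define h' where "h' t = g t - s *\<^sub>R \<psi> t" for t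
    have P': "primitive_on a b r' h'"
      unfolding r'_def h'_def by (rule primitive_on_diff[OF prim_q primitive_on_scaleR[OF P\<phi>]])
    have lin: "V (r' t) - V (q t) \<le> - s * (f t \<bullet> \<phi> t) + e * s * C"
        "V (r' t) - V (q t) \<ge> - s * (f t \<bullet> \<phi> t) - e * s * C" if t: "t \<in> {a..b}" for t
    proof -
      have n: "norm (- s *\<^sub>R \<phi> t) \<le> s * C" using C(2)[OF t] s by simp
      then have "\<bar>V (q t + - s *\<^sub>R \<phi> t) - V (q t) - gradV (q t) \<bullet> (- s *\<^sub>R \<phi> t)\<bar> \<le> e * norm (- s *\<^sub>R \<phi> t)"
        using r[OF t] s(3) n by (intro d(2)) linarith+
      moreover have "e * norm (- s *\<^sub>R \<phi> t) \<le> e * (s * C)" using n e by (intro mult_left_mono) auto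
      ultimately show "V (r' t) - V (q t) \<le> - s * (f t \<bullet> \<phi> t) + e * s * C"
        "V (r' t) - V (q t) \<ge> - s * (f t \<bullet> \<phi> t) - e * s * C"
        by (auto simp: r'_def f_def algebra_simps)
    qed
    have Vr: "V (r' t) \<ge> c" if t: "t \<in> {a..b}" for t
    proof -
      have "\<bar>f t \<bullet> \<phi> t\<bar> \<le> norm (f t) * norm (\<phi> t)" by (rule Cauchy_Schwarz_ineq2)
      also have "\<dots> \<le> M * C" using M C t by (intro mult_mono) auto
      finally have "s * (f t \<bullet> \<phi> t) \<le> s * (M * C)" using s by (intro mult_left_mono) auto
      then show ?thesis using lin(2)[OF t] \<mu>(2)[OF t] s(4) by (simp add: algebra_simps)
    qed
    define I0 where "I0 t = 1/2 * (norm (g t))\<^sup>2 + (V (q t) - c)" for t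
    define I1 where "I1 t = 1/2 * (norm (h' t))\<^sup>2 + (V (r' t) - c)" for t
    have i0: "set_integrable lborel {a..b} I0" unfolding I0_def by (rule lagrangian_integrable[OF prim_q])
    have i1: "set_integrable lborel {a..b} I1" unfolding I1_def by (rule lagrangian_integrable[OF P'])
    have "(\<integral>\<^sup>+t\<in>{a..b}. L t \<partial>lborel) \<le> (\<integral>\<^sup>+t\<in>{a..b}. lagrangian V c r' h' t \<partial>lborel)"
      by (rule action_local_min[OF P']) (use ab \<phi>0 Vr in \<open>auto simp: r'_def\<close>)
    moreover have "(\<integral>\<^sup>+t\<in>{a..b}. L t \<partial>lborel) = ennreal (LBINT t:{a..b}. I0 t)"
      unfolding lagrangian_def I0_def[symmetric]
      by (rule set_nn_integral_eq_LBINT[OF i0]) (simp add: I0_def Vq)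
    moreover have "(\<integral>\<^sup>+t\<in>{a..b}. lagrangian V c r' h' t \<partial>lborel) = ennreal (LBINT t:{a..b}. I1 t)"
      unfolding lagrangian_def I1_def[symmetric]
      by (rule set_nn_integral_eq_LBINT[OF i1]) (simp add: I1_def Vr)
    moreover have "(LBINT t:{a..b}. I1 t) \<ge> 0"
      unfolding set_lebesgue_integral_def
      by (rule Bochner_Integration.integral_nonneg) (auto simp: indicator_def I1_def Vr)
    ultimately have le: "(LBINT t:{a..b}. I0 t) \<le> (LBINT t:{a..b}. I1 t)" by simp
    \<comment> \<open>H bounds the change of the integrand: the kinetic change is exact, as g = v +
      \<psi> becomes v + (1 - s) \<psi>, and the potential is linearised with error e * s *
      C.\<close>
    define H where "H t = (- s + s\<^sup>2 / 2) * (norm (\<psi> t))\<^sup>2 + (- s) * (v t \<bullet> \<psi> t + f t \<bullet> \<phi> t) + e * s * C" for t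
    have ie: "set_integrable lborel {a..b} (\<lambda>_. e * s * C)" by (rule borel_integrable_atLeastAtMost') simp
    have iv: "set_integrable lborel {a..b} (\<lambda>t. v t \<bullet> \<psi> t + f t \<bullet> \<phi> t)"
      by (intro set_integral_add ibp(2,3))
    have ip: "set_integrable lborel {a..b} (\<lambda>t. (- s + s\<^sup>2 / 2) * (norm (\<psi> t))\<^sup>2 + (- s) * (v t \<bullet> \<psi> t + f t \<bullet> \<phi> t))"
      by (rule set_integral_add(1)[OF set_integrable_mult_right[OF D(2)] set_integrable_mult_right[OF iv]])
    have iH: "set_integrable lborel {a..b} H" unfolding H_def by (rule set_integral_add(1)[OF ip ie])
    have "I1 t \<le> I0 t + H t" if t: "t \<in> {a..b}" for t
    proof -
      have h': "h' t = v t + (1 - s) *\<^sub>R \<psi> t" and g': "g t = v t + \<psi> t" by (simp_all add: h'_def \<psi>_def algebra_simps)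
      have "1/2 * (norm (h' t))\<^sup>2 - 1/2 * (norm (g t))\<^sup>2 = (- s + s\<^sup>2 / 2) * (norm (\<psi> t))\<^sup>2 - s * (v t \<bullet> \<psi> t)"
        unfolding h' g' power2_norm_eq_inner by (simp add: inner_add inner_commute power2_eq_square algebra_simps)
      then show ?thesis using lin(1)[OF t] by (simp add: I0_def I1_def H_def algebra_simps)
    qed
    then have "(LBINT t:{a..b}. I1 t) \<le> (LBINT t:{a..b}. I0 t + H t)"
      by (intro set_integral_mono i1 set_integral_add(1)[OF i0 iH])
    also have "\<dots> = (LBINT t:{a..b}. I0 t) + (LBINT t:{a..b}. H t)" by (rule set_integral_add(2)[OF i0 iH])
    finally have "0 \<le> (LBINT t:{a..b}. H t)" using le by simp
    also have "(LBINT t:{a..b}. H t) = (LBINT t:{a..b}. (- s + s\<^sup>2 / 2) * (norm (\<psi> t))\<^sup>2 + (- s) * (v t \<bullet> \<psi> t + f t \<bullet> \<phi> t)) + (LBINT t:{a..b}. e * s * C)"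
      unfolding H_def by (rule set_integral_add(2)[OF ip ie])
    also have "(LBINT t:{a..b}. (- s + s\<^sup>2 / 2) * (norm (\<psi> t))\<^sup>2 + (- s) * (v t \<bullet> \<psi> t + f t \<bullet> \<phi> t))
      = (- s + s\<^sup>2 / 2) * P + (- s) * (LBINT t:{a..b}. v t \<bullet> \<psi> t + f t \<bullet> \<phi> t)"
      using set_integral_add(2)[OF set_integrable_mult_right[OF D(2)] set_integrable_mult_right[OF iv]]
      by (simp only: set_integral_mult_right P_def)
    \<comment> \<open>The mixed term is the integral of the derivative of v \<bullet> \<phi>, and
      \<phi> vanishes at both ends.\<close>
    also have "(LBINT t:{a..b}. v t \<bullet> \<psi> t + f t \<bullet> \<phi> t) = 0"
      using ibp(1) set_integral_add(2)[OF ibp(2,3)] \<phi>0 by simp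
    also have "(LBINT t:{a..b}. e * s * C) = e * s * C * (b - a)"
      using ab by (simp add: set_lebesgue_integral_def)
    finally have "s * ((1 - s / 2) * P) \<le> s * (e * C * (b - a))" by (simp add: algebra_simps power2_eq_square)
    then have "(1 - s / 2) * P \<le> e * C * (b - a)" using s by simp
    moreover have "P / 2 \<le> (1 - s / 2) * P"
      using mult_right_mono[of "1/2" "1 - s/2" P] s P0 by simp
    ultimately show ?thesis by linarith
  qed
  then have small: "P / 2 \<le> e * C * (b - a)" if "e > 0" for e using that .
  have "P \<le> 0"
  proof (rule ccontr)
    assume "\<not> P \<le> 0"
    \<comment> \<open>With this e the bound reads P / 2 \<le> P / 4.\<close>
    then have "P / 2 \<le> P / (4 * C * (b - a)) * C * (b - a)" using C(1) ab by (intro small) simp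
    then show False using C(1) ab \<open>\<not> P \<le> 0\<close> by (simp add: field_simps)
  qed
  then have "P = 0" using P0 by simp
  then have "AE t in lborel. indicator {a..b} t *\<^sub>R (norm (\<psi> t))\<^sup>2 = 0"
    unfolding P_def set_lebesgue_integral_def
    using integral_nonneg_eq_0_iff_AE[OF D(2)[unfolded set_integrable_def]] by simp
  then have ae: "AE t in lborel. t \<in> {a..b} \<longrightarrow> g t = v t"
    by eventually_elim (auto simp: \<psi>_def)
  have qy: "q t = y t" if t: "t \<in> {a..b}" for t
  proof -
    have "q t - q a = (LBINT x:{a..t}. g x)" using t by (intro primitive_onD(4)[OF prim_q]) auto
    also have "\<dots> = (LBINT x:{a..t}. v x)"
      unfolding set_lebesgue_integral_def
    proof (rule integral_cong_AE)
      show "(\<lambda>x. indicat_real {a..t} x *\<^sub>R v x) \<in> borel_measurable lborel"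
        using primitive_onD(1)[OF py] by measurable
      show "AE x in lborel. indicat_real {a..t} x *\<^sub>R g x = indicat_real {a..t} x *\<^sub>R v x"
        using ae by eventually_elim (use t in \<open>auto simp: indicator_def\<close>)
    qed simp
    also have "\<dots> = y t - y a" using t by (intro primitive_onD(4)[OF py, symmetric]) auto
    finally show ?thesis using yab by simp
  qed
  show ?thesis
  proof
    fix t assume t: "t \<in> {a<..<b}"
    show "(q has_vector_derivative v t) (at t)"
      by (rule has_vector_derivative_transform_within_open[OF y, where S="{a<..<b}"]) (use t qy in auto)
  qed (use v ae in \<open>auto simp: f_def\<close>)
qed


section \<open>Regularity and energy while the path is above the level c\<close>

lemma newton_interior:
  assumes I: "open I" "\<And>t. t \<in> I \<Longrightarrow> V (q t) > c" and t: "t \<in> I"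
  shows "(q has_vector_derivative velocity q t) (at t)"
    and "(velocity q has_vector_derivative gradV (q t)) (at t)"
proof -
  obtain e where e: "e > 0" "cball t e \<subseteq> I" using open_contains_cball I(1) t by blast
  then have ab: "V (q s) > c" if "s \<in> {t-e..t+e}" for s
    using I(2) that by (auto simp: cball_eq_atLeastAtMost)
  have lt: "t - e < t + e" using e by simp
  obtain v where v: "\<And>s. s \<in> {t-e<..<t+e} \<Longrightarrow> (q has_vector_derivative v s) (at s)"
    "\<And>s. (v has_vector_derivative gradV (q s)) (at s)"
    "AE s in lborel. s \<in> {t-e..t+e} \<longrightarrow> g s = v s"
    using euler_lagrange[OF lt ab] by metis
  \<comment> \<open>The function v was built for this one interval; uniqueness of derivatives
    identifies it with the global \<open>velocity q\<close>.\<close>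
  have vel: "velocity q s = v s" if "s \<in> {t-e<..<t+e}" for s
    unfolding velocity_def by (rule vector_derivative_at[OF v(1)[OF that]])
  show "(q has_vector_derivative velocity q t) (at t)" using v(1) vel e(1) by simp
  show "(velocity q has_vector_derivative gradV (q t)) (at t)"
    by (rule has_vector_derivative_transform_within_open[OF v(2), where S="{t-e<..<t+e}"]) (use e vel in auto)
qed

lemma weak_deriv_eq_velocity:
  assumes "\<And>t. t \<in> {a..b} \<Longrightarrow> V (q t) > c"
  shows "AE t in lborel. t \<in> {a<..<b} \<longrightarrow> g t = velocity q t"
proof (cases "a < b")
  case True
  obtain v where v: "\<And>s. s \<in> {a<..<b} \<Longrightarrow> (q has_vector_derivative v s) (at s)"
    "AE t in lborel. t \<in> {a..b} \<longrightarrow> g t = v t"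
    using euler_lagrange[OF True assms] by metis
  have vv: "velocity q s = v s" if "s \<in> {a<..<b}" for s
    unfolding velocity_def by (rule vector_derivative_at[OF v(1)[OF that]])
  from v(2) show ?thesis by eventually_elim (use vv in auto)
qed simp

text \<open>The constant is shifted by c, so that energy -c corresponds to E = 0.\<close>

lemma energy_constant:
  assumes I: "open I" "convex I" "\<And>t. t \<in> I \<Longrightarrow> V (q t) > c"
  obtains E where "\<And>t. t \<in> I \<Longrightarrow> 1/2 * (norm (velocity q t))\<^sup>2 - (V (q t) - c) = E"
proof -
  have "((\<lambda>t. 1/2 * (velocity q t \<bullet> velocity q t) - (V (q t) - c)) has_derivative (\<lambda>_. 0)) (at t within I)" if t: "t \<in> I" for t
  proof -
    have q: "(q has_derivative (\<lambda>s. s *\<^sub>R velocity q t)) (at t)"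
      and v: "(velocity q has_derivative (\<lambda>s. s *\<^sub>R gradV (q t))) (at t)"
      using newton_interior[OF I(1,3) t] by (auto simp: has_vector_derivative_def)
    have "(V has_derivative (\<lambda>u. u \<bullet> gradV (q t))) (at (q t))" using grad unfolding gderiv_def .
    from has_derivative_compose[OF q this]
    have Vq': "((\<lambda>t. V (q t)) has_derivative (\<lambda>s. (s *\<^sub>R velocity q t) \<bullet> gradV (q t))) (at t)" .
    have "((\<lambda>t. 1/2 * (velocity q t \<bullet> velocity q t) - (V (q t) - c)) has_derivative
      (\<lambda>s. 1/2 * (velocity q t \<bullet> (s *\<^sub>R gradV (q t)) + (s *\<^sub>R gradV (q t)) \<bullet> velocity q t) - ((s *\<^sub>R velocity q t) \<bullet> gradV (q t) - 0))) (at t)"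
      by (intro has_derivative_diff has_derivative_mult_right has_derivative_inner v Vq' has_derivative_const)
    moreover have "(\<lambda>s. 1/2 * (velocity q t \<bullet> (s *\<^sub>R gradV (q t)) + (s *\<^sub>R gradV (q t)) \<bullet> velocity q t) - ((s *\<^sub>R velocity q t) \<bullet> gradV (q t) - 0)) = (\<lambda>_. 0)"
      by (auto simp: inner_commute)
    ultimately show ?thesis by (simp add: has_derivative_at_withinI)
  qed
  from has_derivative_zero_constant[OF I(2) this]
  obtain E where "\<forall>t\<in>I. 1/2 * (velocity q t \<bullet> velocity q t) - (V (q t) - c) = E"
    by blast
  then show ?thesis using that by (simp add: power2_norm_eq_inner)
qed

lemma set_action_le: "(\<integral>\<^sup>+t\<in>S. L t \<partial>lborel) \<le> m"
  unfolding total_action[symmetric] by (rule nn_integral_mono) (auto simp: indicator_def)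

text \<open>The kinetic part and V(q) - c are both nonnegative with difference E, so their sum is at
  least \<bar>E\<bar>. Over arbitrarily long intervals a finite action leaves only E = 0.\<close>

lemma energy_zero_unbounded:
  assumes I: "\<And>t. t \<in> I \<Longrightarrow> V (q t) > c"
    and E: "\<And>t. t \<in> I \<Longrightarrow> 1/2 * (norm (velocity q t))\<^sup>2 - (V (q t) - c) = E"
    and long: "\<And>K. \<exists>a b. {a..b} \<subseteq> I \<and> b - a \<ge> K"
  shows "E = 0"
proof -
  obtain M where M: "m = ennreal M" "M \<ge> 0" using fin by (cases m) auto
  have "\<bar>E\<bar> * (b - a) \<le> M" if ab: "{a..b} \<subseteq> I" "a \<le> b" for a b
  proof -
    have "ennreal (\<bar>E\<bar> * (b - a)) = (\<integral>\<^sup>+t. ennreal \<bar>E\<bar> * indicator {a<..<b} t \<partial>lborel)"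
      using ab by (simp add: nn_integral_cmult_indicator ennreal_mult)
    also have "\<dots> \<le> (\<integral>\<^sup>+t\<in>{a<..<b}. L t \<partial>lborel)"
    proof (rule nn_integral_mono_AE)
      have "AE t in lborel. t \<in> {a<..<b} \<longrightarrow> g t = velocity q t"
        using ab I by (intro weak_deriv_eq_velocity) auto
      then show "AE t in lborel. ennreal \<bar>E\<bar> * indicator {a<..<b} t \<le> L t * indicator {a<..<b} t"
      proof eventually_elim
        case (elim t)
        show ?case
        proof (cases "t \<in> {a<..<b}")
          case True
          then have t: "t \<in> I" using ab by auto
          have "\<bar>E\<bar> \<le> 1/2 * (norm (g t))\<^sup>2 + (V (q t) - c)"
          proof -
            have "1/2 * (norm (g t))\<^sup>2 - (V (q t) - c) = E" using E[OF t] elim True by simp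
            moreover have "1/2 * (norm (g t))\<^sup>2 \<ge> 0" by simp
            ultimately show ?thesis using I[OF t] unfolding abs_le_iff by linarith
          qed
          then show ?thesis using True by (simp add: lagrangian_def ennreal_leI)
        qed simp
      qed
    qed
    also have "\<dots> \<le> ennreal M" using set_action_le M by simp
    finally show ?thesis using M by simp
  qed
  note bd = this
  show ?thesis
  proof (rule ccontr)
    assume "E \<noteq> 0"
    obtain a b where "{a..b} \<subseteq> I" "b - a \<ge> (M + 1) / \<bar>E\<bar>" using long by blast
    moreover have "(M + 1) / \<bar>E\<bar> \<ge> 0" using M by simp
    ultimately have "\<bar>E\<bar> * ((M + 1) / \<bar>E\<bar>) \<le> M" using bd[of a b] mult_left_mono[of "(M + 1) / \<bar>E\<bar>" "b - a" "\<bar>E\<bar>"] by linarith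
    then show False using \<open>E \<noteq> 0\<close> by simp
  qed
qed

lemma primitive_on_rescale:
  fixes r :: "real \<Rightarrow> 'b::euclidean_space"
  assumes P: "primitive_on a b r h" and l: "l > 0"
  shows "primitive_on (l * a) (l * b) (\<lambda>t. r (t / l)) (\<lambda>t. h (t / l) /\<^sub>R l)"
proof -
  note D = primitive_onD[OF P]
  note [measurable] = D(1)
  have ind: "indicator {l * s..l * t} (0 + l * x) = (indicator {s..t} x :: real)" for s t x
    using l by (auto simp: indicator_def)
  have "integrable lborel (\<lambda>t. indicator {l * a..l * b} t *\<^sub>R (norm (h (t / l) /\<^sub>R l))\<^sup>2)"
  proof (rule lborel_integrable_real_affine_iff[where c=l and t=0, THEN iffD1])
    have "set_integrable lborel {a..b} (\<lambda>x. (1/l)\<^sup>2 * (norm (h x))\<^sup>2)" using D(2) by simp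
    then show "integrable lborel (\<lambda>x. indicator {l * a..l * b} (0 + l * x) *\<^sub>R (norm (h ((0 + l * x) / l) /\<^sub>R l))\<^sup>2)"
      unfolding ind using l by (simp add: set_integrable_def power_mult_distrib power_divide divide_simps)
  qed (use l in simp)
  moreover have "r (t / l) - r (s / l) = (LBINT x:{s..t}. h (x / l) /\<^sub>R l)" if st: "l * a \<le> s" "s \<le> t" "t \<le> l * b" for s t
  proof -
    have "(LBINT x:{s..t}. h (x / l) /\<^sub>R l) = \<bar>l\<bar> *\<^sub>R (LBINT x. indicator {s..t} (0 + l * x) *\<^sub>R (h ((0 + l * x) / l) /\<^sub>R l))"
      unfolding set_lebesgue_integral_def by (rule lborel_integral_real_affine) (use l in simp)
    also have "(\<lambda>x. indicator {s..t} (0 + l * x) *\<^sub>R (h ((0 + l * x) / l) /\<^sub>R l)) = (\<lambda>x. (1 / l) *\<^sub>R (indicator {s/l..t/l} x *\<^sub>R h x))"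
      using l by (auto simp: fun_eq_iff indicator_def field_simps)
    also have "\<bar>l\<bar> *\<^sub>R (LBINT x. (1 / l) *\<^sub>R (indicator {s/l..t/l} x *\<^sub>R h x)) = (LBINT x:{s/l..t/l}. h x)"
      unfolding set_lebesgue_integral_def integral_scaleR_right using l by simp
    also have "\<dots> = r (t / l) - r (s / l)"
      using st l by (intro D(4)[symmetric]) (auto simp: field_simps)
    finally show ?thesis by simp
  qed
  ultimately show ?thesis unfolding primitive_on_def set_integrable_def by simp
qed

text \<open>With kinetic part \<open>K\<close> and potential part \<open>P\<close>, slowing the path down by the factor \<open>l\<close> turns the
  action into \<open>K / l + l * P\<close>; minimality at \<open>l = 1\<close> forces \<open>K = P\<close>.\<close>

lemma energy_zero_bounded:
  assumes ab: "a < b" and ends: "q a \<in> A" "q b \<in> B"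
    and above: "\<And>t. t \<in> {a<..<b} \<Longrightarrow> V (q t) > c"
    and E: "\<And>t. t \<in> {a<..<b} \<Longrightarrow> 1/2 * (norm (velocity q t))\<^sup>2 - (V (q t) - c) = E"
  shows "E = 0"
proof -
  note D = primitive_onD[OF prim_q[of a b]]
  have iK: "set_integrable lborel {a..b} (\<lambda>t. 1/2 * (norm (g t))\<^sup>2)" using D(2) by simp
  have iP: "set_integrable lborel {a..b} (\<lambda>t. V (q t) - c)"
    by (intro borel_integrable_atLeastAtMost' continuous_intros cont_Vq)
  define K where "K = (LBINT t:{a..b}. 1/2 * (norm (g t))\<^sup>2)"
  define P where "P = (LBINT t:{a..b}. V (q t) - c)"
  have nn: "K \<ge> 0" "P \<ge> 0" unfolding K_def P_def set_lebesgue_integral_def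
    by (auto intro!: Bochner_Integration.integral_nonneg simp: Vq)
  \<comment> \<open>The action of the arc on {a..b} is at most the total m. The rescaled arc still
    runs from A to B, so its action is at least m.\<close>
  have scaled: "K + P \<le> K / l + l * P" if l: "l > 0" for l
  proof -
    have "ennreal (K + P) = (\<integral>\<^sup>+t\<in>{a..b}. L t \<partial>lborel)"
      unfolding lagrangian_def K_def P_def set_integral_add(2)[OF iK iP, symmetric]
      by (rule set_nn_integral_eq_LBINT[symmetric]) (use set_integral_add(1)[OF iK iP] Vq in auto)
    also have "\<dots> \<le> m" by (rule set_action_le)
    also have "\<dots> \<le> (\<integral>\<^sup>+t\<in>{l * a..l * b}. lagrangian V c (\<lambda>t. q (t / l)) (\<lambda>t. g (t / l) /\<^sub>R l) t \<partial>lborel)"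
      by (rule min_action_le_crossing[OF primitive_on_rescale[OF prim_q l]]) (use l ab ends in auto)
    also have "\<dots> = \<bar>l\<bar> * (\<integral>\<^sup>+t. lagrangian V c (\<lambda>t. q (t / l)) (\<lambda>t. g (t / l) /\<^sub>R l) (0 + l * t) * indicator {l * a..l * b} (0 + l * t) \<partial>lborel)"
    proof (rule nn_integral_real_affine)
      have "lagrangian V c (\<lambda>t. q (t / l)) (\<lambda>t. g (t / l) /\<^sub>R l) \<in> borel_measurable borel"
        by (intro lagrangian_measurable contV) measurable
      then show "(\<lambda>t. lagrangian V c (\<lambda>t. q (t / l)) (\<lambda>t. g (t / l) /\<^sub>R l) t * indicator {l * a..l * b} t) \<in> borel_measurable borel"
        by measurable
    qed (use l in simp)
    also have "(\<integral>\<^sup>+t. lagrangian V c (\<lambda>t. q (t / l)) (\<lambda>t. g (t / l) /\<^sub>R l) (0 + l * t) * indicator {l * a..l * b} (0 + l * t) \<partial>lborel)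
        = (\<integral>\<^sup>+t\<in>{a..b}. ennreal ((1/l)\<^sup>2 * (1/2 * (norm (g t))\<^sup>2) + (V (q t) - c)) \<partial>lborel)"
    proof (rule nn_integral_cong)
      fix t
      have e1: "(0 + l * t) / l = t" using l by simp
      have e2: "1/2 * (norm (g t /\<^sub>R l))\<^sup>2 = (1/l)\<^sup>2 * (1/2 * (norm (g t))\<^sup>2)"
        using l by (simp add: power_mult_distrib power_divide divide_simps)
      have e3: "indicator {l * a..l * b} (0 + l * t) = (indicator {a..b} t :: ennreal)"
        using l by (auto simp: indicator_def)
      show "lagrangian V c (\<lambda>t. q (t / l)) (\<lambda>t. g (t / l) /\<^sub>R l) (0 + l * t) * indicator {l * a..l * b} (0 + l * t)
        = ennreal ((1/l)\<^sup>2 * (1/2 * (norm (g t))\<^sup>2) + (V (q t) - c)) * indicator {a..b} t"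
        unfolding lagrangian_def e1 e2 e3 ..
    qed
    also have "\<dots> = ennreal (LBINT t:{a..b}. (1/l)\<^sup>2 * (1/2 * (norm (g t))\<^sup>2) + (V (q t) - c))"
      by (rule set_nn_integral_eq_LBINT) (use set_integral_add(1)[OF set_integrable_mult_right[OF iK] iP] Vq in auto)
    also have "(LBINT t:{a..b}. (1/l)\<^sup>2 * (1/2 * (norm (g t))\<^sup>2) + (V (q t) - c)) = (1/l)\<^sup>2 * K + P"
      using set_integral_add(2)[OF set_integrable_mult_right[OF iK] iP]
      by (simp only: set_integral_mult_right K_def P_def)
    also have "ennreal \<bar>l\<bar> * ennreal ((1/l)\<^sup>2 * K + P) = ennreal (l * ((1/l)\<^sup>2 * K + P))"
      using l nn by (simp add: ennreal_mult)
    also have "l * ((1/l)\<^sup>2 * K + P) = K / l + l * P"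
      using l by (simp add: field_simps power2_eq_square)
    finally show ?thesis using l nn by (subst (asm) ennreal_le_iff) auto
  qed
  \<comment> \<open>Instead of differentiating at l = 1, the two inequalities come from l = 1/z and
    l = z with z < 1: a factor 1 - z cancels, and z is then arbitrarily close to 1.\<close>
  have KP: "K = P"
  proof (rule antisym)
    show "K \<le> P"
    proof (rule field_le_mult_one_interval)
      fix z :: real assume z: "0 < z" "z < 1"
      have "K + P \<le> K * z + P / z" using scaled[of "1/z"] z by simp
      then have "z * (K + P) \<le> z * (K * z + P / z)" using z by (intro mult_left_mono) auto
      then have "(1 - z) * (z * K) \<le> (1 - z) * P" using z by (simp add: algebra_simps)
      then show "z * K \<le> P" using z by simp
    qed
    show "P \<le> K"
    proof (rule field_le_mult_one_interval)
      fix z :: real assume z: "0 < z" "z < 1"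
      have "K + P \<le> K / z + z * P" using scaled[of z] z by simp
      then have "z * (K + P) \<le> z * (K / z + z * P)" using z by (intro mult_left_mono) auto
      then have "(1 - z) * (z * P) \<le> (1 - z) * K" using z by (simp add: algebra_simps)
      then show "z * P \<le> K" using z by simp
    qed
  qed
  \<comment> \<open>At a and b themselves V(q) = c, while \<open>weak_deriv_eq_velocity\<close>
    wants V(q) > c on a closed interval, so the open interval is exhausted by closed ones.\<close>
  have "AE t in lborel. \<forall>n. t \<in> {a + 1 / real (Suc n)<..<b - 1 / real (Suc n)} \<longrightarrow> g t = velocity q t"
    unfolding AE_all_countable
  proof
    fix n
    have "0 < 1 / real (Suc n)" by simp
    then show "AE t in lborel. t \<in> {a + 1 / real (Suc n)<..<b - 1 / real (Suc n)} \<longrightarrow> g t = velocity q t"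
      by (intro weak_deriv_eq_velocity above) (simp only: atLeastAtMost_iff greaterThanLessThan_iff, linarith)
  qed
  then have gv: "AE t in lborel. t \<in> {a<..<b} \<longrightarrow> g t = velocity q t"
  proof eventually_elim
    case (elim t)
    show ?case
    proof
      assume "t \<in> {a<..<b}"
      then have "0 < min (t - a) (b - t)" by simp
      then obtain n where "inverse (real (Suc n)) < min (t - a) (b - t)" using reals_Archimedean by blast
      then have "t \<in> {a + 1 / real (Suc n)<..<b - 1 / real (Suc n)}"
        by (simp only: inverse_eq_divide greaterThanLessThan_iff min_less_iff_conj) linarith
      then show "g t = velocity q t" using elim by blast
    qed
  qed
  have "K = (LBINT t:{a..b}. (V (q t) - c) + E)"
    unfolding K_def set_lebesgue_integral_def
  proof (rule integral_cong_AE)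
    show "AE t in lborel. indicat_real {a..b} t *\<^sub>R (1/2 * (norm (g t))\<^sup>2) = indicat_real {a..b} t *\<^sub>R ((V (q t) - c) + E)"
      using gv AE_lborel_singleton[of a] AE_lborel_singleton[of b]
    proof eventually_elim
      case (elim t)
      then show ?case using E[of t] by (auto simp: indicator_def)
    qed
    have "(\<lambda>t. V (q t)) \<in> borel_measurable borel" by (rule borel_measurable_continuous_onI) (rule cont_Vq)
    then show "(\<lambda>t. indicat_real {a..b} t *\<^sub>R ((V (q t) - c) + E)) \<in> borel_measurable lborel" by measurable
  qed measurable
  also have "\<dots> = P + (LBINT t:{a..b}. E)"
    unfolding P_def by (rule set_integral_add(2)[OF iP]) (rule borel_integrable_atLeastAtMost', simp)
  also have "(LBINT t:{a..b}. E) = E * (b - a)" using ab by (simp add: set_lebesgue_integral_def)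
  finally have "E * (b - a) = 0" using KP by simp
  then show ?thesis using ab by simp
qed

end

subsection \<open>Reflection at turning points\<close>

text \<open>Compare f with an antiderivative F of f', made continuous on the whole line by clamping
  the argument to [w - e, w + e]. There f - F is continuous with zero derivative off the single
  point w, hence constant.\<close>

lemma has_vector_derivative_removable:
  fixes f :: "real \<Rightarrow> 'a::euclidean_space"
  assumes "d > 0" and f: "isCont f w"
    and D: "\<And>t. t \<in> ball w d \<Longrightarrow> t \<noteq> w \<Longrightarrow> (f has_vector_derivative f' t) (at t)"
    and f': "\<And>t. t \<in> ball w d \<Longrightarrow> isCont f' t"
  shows "(f has_vector_derivative f' w) (at w)"
proof -
  define e where "e = d / 2"
  have e: "e > 0" "e < d" using \<open>d > 0\<close> by (auto simp: e_def)
  define k where "k t = f' (max (w - e) (min (w + e) t))" for t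
  have cl: "max (w - e) (min (w + e) t) \<in> ball w d" for t
    using e by (auto simp: dist_real_def abs_if)
  have "isCont k t" for t
    unfolding k_def by (rule isCont_o2[where g=f']) (auto intro!: continuous_intros f' cl[simplified])
  then obtain F where F: "\<And>t. (F has_vector_derivative k t) (at t)"
    using antiderivative_exists[of k] continuous_at_imp_continuous_on by blast
  have kf: "k t = f' t" if "t \<in> {w-e..w+e}" for t using that by (simp add: k_def)
  have "continuous_on {w-e..w+e} f"
  proof (rule continuous_at_imp_continuous_on, rule ballI)
    fix t assume "t \<in> {w-e..w+e}"
    then have "t \<in> ball w d" using e by (auto simp: dist_real_def abs_if)
    then show "isCont f t" using D f has_vector_derivative_continuous by metis
  qed
  moreover have "continuous_on {w-e..w+e} F"
    using has_vector_derivative_continuous[OF F] by (intro continuous_at_imp_continuous_on) auto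
  ultimately have c: "continuous_on {w-e..w+e} (\<lambda>t. f t - F t)" by (rule continuous_on_diff)
  have const: "f t - F t = f (w-e) - F (w-e)" if "t \<in> {w-e..w+e}" for t
  proof (rule has_derivative_zero_unique_strong_interval[OF _ c refl _ that, of "{w}"])
    fix s assume s: "s \<in> {w-e..w+e} - {w}"
    then have "s \<in> ball w d" using e by (auto simp: dist_real_def abs_if)
    then have "((\<lambda>t. f t - F t) has_vector_derivative (f' s - k s)) (at s)"
      using s by (intro has_vector_derivative_diff D F) auto
    then show "((\<lambda>t. f t - F t) has_derivative (\<lambda>h. 0)) (at s within {w-e..w+e})"
      using kf[of s] s by (auto simp: has_vector_derivative_def intro: has_derivative_at_withinI)
  qed simp
  have "((\<lambda>t. F t + (f (w-e) - F (w-e))) has_vector_derivative k w + 0) (at w)"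
    by (intro has_vector_derivative_add F has_vector_derivative_const)
  then have "(f has_vector_derivative k w + 0) (at w)"
    by (rule has_vector_derivative_transform_within_open[where S="{w-e<..<w+e}"]) (use e const in \<open>auto simp: algebra_simps\<close>)
  then show ?thesis using kf[of w] e by simp
qed

text \<open>A pointwise form of "solution of energy -c", so that pieces of an orbit can be checked
  separately and then glued.\<close>

definition newton_energy_at ::
    "(real ^ 'n \<Rightarrow> real) \<Rightarrow> (real ^ 'n \<Rightarrow> real ^ 'n) \<Rightarrow> real \<Rightarrow> (real \<Rightarrow> real ^ 'n) \<Rightarrow> real \<Rightarrow> bool" where
  "newton_energy_at V gradV c p t \<longleftrightarrow>
     (p has_vector_derivative velocity p t) (at t) \<and>
     (velocity p has_vector_derivative gradV (p t)) (at t) \<and>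
     1/2 * (norm (velocity p t))\<^sup>2 = V (p t) - c"

lemma newton_energy_at_cong:
  assumes S: "open S" "t \<in> S" and eq: "\<And>s. s \<in> S \<Longrightarrow> p s = q s"
    and q: "\<And>s. s \<in> S \<Longrightarrow> newton_energy_at V gradV c q s"
  shows "newton_energy_at V gradV c p t"
proof -
  have D: "(p has_vector_derivative velocity q s) (at s)" if "s \<in> S" for s
    by (rule has_vector_derivative_transform_within_open[where f=q, OF _ S(1) that])
       (use q[OF that] eq in \<open>auto simp: newton_energy_at_def\<close>)
  then have v: "velocity p s = velocity q s" if "s \<in> S" for s
    using that unfolding velocity_def by (simp add: vector_derivative_at)
  have "(velocity p has_vector_derivative gradV (q t)) (at t)"
    by (rule has_vector_derivative_transform_within_open[where f="velocity q", OF _ S])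
       (use q[OF S(2)] v in \<open>auto simp: newton_energy_at_def\<close>)
  then show ?thesis using D[OF S(2)] v[OF S(2)] q[OF S(2)] eq[OF S(2)] by (simp add: newton_energy_at_def)
qed

text \<open>Time reversal changes the sign of the velocity and leaves its square and the second
  derivative unchanged.\<close>

lemma newton_energy_at_reflect:
  assumes S: "open S" "2 * w - t \<in> S"
    and q: "\<And>s. s \<in> S \<Longrightarrow> newton_energy_at V gradV c q s"
  shows "newton_energy_at V gradV c (\<lambda>t. q (2 * w - t)) t"
proof -
  let ?p = "\<lambda>t. q (2 * w - t)"
  have A: "((\<lambda>s. 2 * w - s) has_vector_derivative -1) (at s)" for s :: real
    by (auto intro!: derivative_eq_intros)
  have S': "open ((\<lambda>s. 2 * w - s) -` S)" "t \<in> (\<lambda>s. 2 * w - s) -` S"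
    using S by (auto intro!: continuous_open_vimage continuous_intros)
  have D: "(?p has_vector_derivative - velocity q (2 * w - s)) (at s)" if "2 * w - s \<in> S" for s
    using vector_diff_chain_at[OF A, of q "velocity q (2 * w - s)" s] q[OF that]
    by (simp add: newton_energy_at_def o_def)
  then have v: "velocity ?p s = - velocity q (2 * w - s)" if "2 * w - s \<in> S" for s
    using that unfolding velocity_def[of ?p] by (simp add: vector_derivative_at)
  have "((\<lambda>s. - velocity q (2 * w - s)) has_vector_derivative - (- gradV (q (2 * w - t)))) (at t)"
    using vector_diff_chain_at[OF A, of "velocity q" "gradV (q (2 * w - t))" t] q[OF S(2)]
    by (intro has_vector_derivative_minus) (simp add: newton_energy_at_def o_def)
  then have "(velocity ?p has_vector_derivative - (- gradV (q (2 * w - t)))) (at t)"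
    by (rule has_vector_derivative_transform_within_open[OF _ S']) (use v in auto)
  then show ?thesis using D[OF S(2)] v[OF S(2)] q[OF S(2)] by (simp add: newton_energy_at_def)
qed

lemma newton_energy_at_shift:
  assumes per: "\<And>t. p (t + T) = p t"
  shows "newton_energy_at V gradV c p (t + T) \<longleftrightarrow> newton_energy_at V gradV c p t"
proof -
  have *: "(f has_vector_derivative D) (at (t + T)) \<longleftrightarrow> (f has_vector_derivative D) (at t)"
    if "\<And>t. f (t + T) = f t" for f :: "real \<Rightarrow> real ^ 'a" and D t
  proof
    have A: "((\<lambda>s. s + k) has_vector_derivative 1) (at s)" for s k :: real
      by (auto intro!: derivative_eq_intros)
    assume "(f has_vector_derivative D) (at (t + T))"
    then have "((f \<circ> (\<lambda>s. s + T)) has_vector_derivative 1 *\<^sub>R D) (at t)"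
      by (intro vector_diff_chain_at A)
    then show "(f has_vector_derivative D) (at t)" by (simp add: o_def that)
  next
    have A: "((\<lambda>s. s + k) has_vector_derivative 1) (at s)" for s k :: real
      by (auto intro!: derivative_eq_intros)
    have per': "f (s - T) = f s" for s using that[of "s - T"] by simp
    assume "(f has_vector_derivative D) (at t)"
    then have "((f \<circ> (\<lambda>s. s + - T)) has_vector_derivative 1 *\<^sub>R D) (at (t + T))"
      by (intro vector_diff_chain_at A) simp
    then show "(f has_vector_derivative D) (at (t + T))" by (simp add: o_def per')
  qed
  have v: "velocity p (s + T) = velocity p s" for s
    unfolding velocity_def vector_derivative_def *[of p, OF per] ..
  show ?thesis unfolding newton_energy_at_def *[of p, OF per] *[of "velocity p", OF v] v per ..
qed

text \<open>At a turning point the velocity vanishes by energy conservation, so the even extension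
  is again a solution. The sign \<open>\<sigma>\<close> tells on which side of \<open>w\<close> the solution \<open>q\<close> is given.\<close>

lemma newton_energy_at_even_extension:
  assumes \<sigma>: "\<sigma> = 1 \<or> \<sigma> = (-1::real)" and cq: "continuous_on UNIV q" and cV: "continuous_on UNIV V"
    and cg: "continuous_on UNIV gradV"
    and q: "\<And>s. 0 < s \<Longrightarrow> s < d \<Longrightarrow> newton_energy_at V gradV c q (w + \<sigma> * s)"
    and p: "\<And>t. \<bar>t - w\<bar> < d \<Longrightarrow> p t = q (w + \<sigma> * \<bar>t - w\<bar>)"
    and turn: "V (q w) = c" and t: "\<bar>t - w\<bar> < d"
  shows "newton_energy_at V gradV c p t"
proof -
  define S where "S = {s. 0 < \<sigma> * (s - w) \<and> \<sigma> * (s - w) < d}"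
  have "open S" unfolding S_def by (intro open_Collect_conj open_Collect_less continuous_intros)
  have qS: "newton_energy_at V gradV c q s" if "s \<in> S" for s
    using q[of "\<sigma> * (s - w)"] that \<sigma> by (auto simp: S_def)
  have off: "newton_energy_at V gradV c p s" if s: "\<bar>s - w\<bar> < d" "s \<noteq> w" for s
  proof (cases "s \<in> S")
    case True
    show ?thesis
      by (rule newton_energy_at_cong[OF \<open>open S\<close> True _ qS]) (use p \<sigma> in \<open>auto simp: S_def abs_if\<close>)
  next
    case False
    let ?S = "(\<lambda>s. 2 * w - s) -` S"
    have "open ?S" using \<open>open S\<close> by (intro continuous_open_vimage continuous_intros)
    moreover have "s \<in> ?S" using s False \<sigma> by (auto simp: S_def abs_if split: if_splits)
    ultimately show ?thesis
    proof (rule newton_energy_at_cong[where q="\<lambda>t. q (2 * w - t)"])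
      fix r assume r: "r \<in> ?S"
      then show "p r = q (2 * w - r)" using p[of r] \<sigma> by (auto simp: S_def abs_if algebra_simps split: if_splits)
      show "newton_energy_at V gradV c (\<lambda>t. q (2 * w - t)) r"
        by (rule newton_energy_at_reflect[OF \<open>open S\<close> _ qS]) (use r in auto)
    qed
  qed
  show ?thesis
  proof (cases "t = w")
    case False
    then show ?thesis using off t by blast
  next
    case True
    then have d: "d > 0" using t by simp
    have "isCont (\<lambda>t. q (w + \<sigma> * \<bar>t - w\<bar>)) w"
      by (rule isCont_o2[where g=q]) (use cq in \<open>auto intro!: continuous_intros simp: continuous_on_eq_continuous_at\<close>)
    moreover have "\<forall>\<^sub>F t in nhds w. q (w + \<sigma> * \<bar>t - w\<bar>) = p t"
      unfolding eventually_nhds_metric using p d by (auto simp: dist_real_def)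
    ultimately have cp: "isCont p w" using isCont_cong by fast
    have pw: "p w = q w" using p[of w] d by simp
    \<comment> \<open>The velocity of p at w is not known yet, so its expected value 0 is
      prescribed. Energy conservation makes v continuous there, and \<open>pD\<close> then shows
      that v is the velocity.\<close>
    define v where "v s = (if s = w then 0 else velocity p s)" for s
    have vD: "(v has_vector_derivative gradV (p s)) (at s)" if s: "s \<in> ball w d" "s \<noteq> w" for s
    proof (rule has_vector_derivative_transform_within_open[where f="velocity p" and S="-{w}"])
      show "(velocity p has_vector_derivative gradV (p s)) (at s)"
        using off[of s] s by (auto simp: newton_energy_at_def dist_real_def)
    qed (use s in \<open>auto simp: v_def\<close>)
    have vw: "isCont v w"
    proof -
      have "((\<lambda>s. V (p s) - c) \<longlongrightarrow> V (p w) - c) (at w)"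
        using cp cV by (intro tendsto_intros continuous_on_tendsto_compose[OF cV]) (auto simp: isCont_def)
      then have "((\<lambda>s. sqrt (2 * (V (p s) - c))) \<longlongrightarrow> sqrt (2 * (V (p w) - c))) (at w)"
        by (intro tendsto_real_sqrt tendsto_mult tendsto_const)
      then have l: "((\<lambda>s. sqrt (2 * (V (p s) - c))) \<longlongrightarrow> 0) (at w)" using turn pw by simp
      have "\<forall>\<^sub>F s in at w. norm (v s) \<le> sqrt (2 * (V (p s) - c))"
        unfolding eventually_at
      proof (intro exI[of _ d] conjI ballI impI d)
        fix s assume "s \<noteq> w \<and> dist s w < d"
        then have "1/2 * (norm (velocity p s))\<^sup>2 = V (p s) - c" "s \<noteq> w"
          using off[of s] by (auto simp: newton_energy_at_def dist_real_def)
        then have "(norm (v s))\<^sup>2 = 2 * (V (p s) - c)" by (simp add: v_def)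
        then show "norm (v s) \<le> sqrt (2 * (V (p s) - c))" by (intro real_le_rsqrt) simp
      qed
      then have "(v \<longlongrightarrow> 0) (at w)" using l by (rule Lim_null_comparison)
      then show ?thesis by (simp add: isCont_def v_def)
    qed
    have cv: "isCont v s" if "s \<in> ball w d" for s
      using vw vD[OF that] has_vector_derivative_continuous by (cases "s = w") auto
    have pD: "(p has_vector_derivative v w) (at w)"
    proof (rule has_vector_derivative_removable[OF d cp _ cv])
      fix s assume "s \<in> ball w d" "s \<noteq> w"
      then show "(p has_vector_derivative v s) (at s)"
        using off[of s] by (auto simp: newton_energy_at_def dist_real_def v_def)
    qed
    then have "velocity p w = 0" unfolding velocity_def by (simp add: vector_derivative_at v_def)
    then have v: "v = velocity p" by (auto simp: v_def fun_eq_iff)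
    have "(v has_vector_derivative gradV (p w)) (at w)"
    proof (rule has_vector_derivative_removable[OF d vw vD])
      fix s assume s: "s \<in> ball w d"
      have "isCont p s"
        using cp off[of s] s has_vector_derivative_continuous
        by (cases "s = w") (auto simp: newton_energy_at_def dist_real_def abs_minus_commute)
      moreover have "isCont gradV (p s)" using cg by (simp add: continuous_on_eq_continuous_at)
      ultimately show "isCont (\<lambda>s. gradV (p s)) s" by (rule isCont_o2)
    qed
    then show ?thesis using True pD v turn pw \<open>velocity p w = 0\<close> by (simp add: newton_energy_at_def)
  qed
qed

text \<open>Stated for predicates because it is applied to "the equation holds at t" as well as to
  "p takes a given value at t".\<close>

lemma periodic_representative:
  assumes T: "T > (0::real)" and per: "\<And>t. P (t + T) \<longleftrightarrow> P t"
  obtains s where "b \<le> s" "s < b + T" "P s \<longleftrightarrow> P t"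
proof -
  have nsh: "P (s + real n * T) \<longleftrightarrow> P s" for s n
  proof (induction n)
    case (Suc n)
    have eq: "s + real (Suc n) * T = (s + real n * T) + T" by (simp add: algebra_simps)
    show ?case unfolding eq per by (rule Suc)
  qed simp
  have ish: "P (s + real_of_int k * T) \<longleftrightarrow> P s" for s k
  proof (cases "k \<ge> 0")
    case True
    then show ?thesis using nsh[of s "nat k"] by simp
  next
    case False
    then show ?thesis using nsh[of "s + real_of_int k * T" "nat (-k)"] by simp
  qed
  define k where "k = \<lfloor>(t - b) / T\<rfloor>"
  have "real_of_int k \<le> (t - b) / T" "(t - b) / T < real_of_int k + 1" unfolding k_def by linarith+
  then have "real_of_int k * T \<le> t - b" "t - b < (real_of_int k + 1) * T"
    using T by (simp_all add: pos_le_divide_eq pos_divide_less_eq)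
  then show ?thesis
    using that[of "t - real_of_int k * T"] ish[of "t - real_of_int k * T" k] by (auto simp: algebra_simps)
qed

section \<open>The minimizer between its end times and its reflected extension\<close>

locale reflected_minimizer = action_minimizer V c A B gradV q
  for V :: "real ^ 'n \<Rightarrow> real" and c A B gradV q +
  fixes p :: "real \<Rightarrow> real ^ 'n"
  assumes sol: "minimization_solution A B q p"
begin

abbreviation \<alpha> where "\<alpha> \<equiv> alpha_time A q"
abbreviation \<omega> where "\<omega> \<equiv> omega_time A B q"
definition I where "I = {t. \<alpha> < ereal t \<and> ereal t < \<omega>}"

lemma above: "t \<in> I \<Longrightarrow> V (q t) > c"
proof -
  assume t: "t \<in> I"
  have "q t \<notin> A"
  proof
    assume "q t \<in> A"
    then have "ereal t \<le> \<alpha>" unfolding alpha_time_def by (intro Sup_upper) auto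
    then show False using t by (auto simp: I_def dest: leD)
  qed
  moreover have "q t \<notin> B"
  proof
    assume "q t \<in> B"
    then have "\<omega> \<le> ereal t" unfolding omega_time_def using t by (intro Inf_lower) (auto simp: I_def)
    then show False using t by (auto simp: I_def dest: leD)
  qed
  ultimately have "q t \<notin> sublevel V c" unfolding union[symmetric] by simp
  then show "V (q t) > c" by (simp add: sublevel_def)
qed

lemma alpha_attained: "\<alpha> = ereal a \<Longrightarrow> q a \<in> A"
proof -
  assume a: "\<alpha> = ereal a"
  define S where "S = {t. q t \<in> A}"
  have sup: "(SUP t\<in>S. ereal t) = ereal a" using a by (simp add: alpha_time_def S_def)
  then have "S \<noteq> {}" by (auto simp: bot_ereal_def)
  moreover have "bdd_above S"
  proof (rule bdd_aboveI)
    fix t assume "t \<in> S"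
    then have "ereal t \<le> (SUP t\<in>S. ereal t)" by (rule SUP_upper)
    then show "t \<le> a" using sup by simp
  qed
  moreover have "closed S" unfolding S_def vimage_def[symmetric]
    by (intro closed_vimage closed_A cont_q)
  ultimately have "Sup S \<in> S" by (rule closed_contains_Sup)
  moreover have "Sup S = a" using ereal_Sup[of S] sup by simp
  ultimately show "q a \<in> A" by (simp add: S_def)
qed

lemma omega_attained:
  assumes w: "\<omega> = ereal w" and \<alpha>: "\<alpha> = -\<infinity> \<or> \<alpha> = ereal a"
  shows "q w \<in> B" "\<alpha> < ereal w"
proof -
  define S where "S = {t. \<alpha> < ereal t \<and> q t \<in> B}"
  have inf: "(INF t\<in>S. ereal t) = ereal w" using w by (simp add: omega_time_def S_def)
  then have ne: "S \<noteq> {}" by (auto simp: top_ereal_def)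
  have "closed S"
  proof (cases "\<alpha> = -\<infinity>")
    case True
    then have "S = q -` B" by (auto simp: S_def)
    then show ?thesis using closed_vimage[OF closed_B cont_q] by simp
  next
    case False
    then have a: "\<alpha> = ereal a" using \<alpha> by simp
    \<comment> \<open>The infimum defining \<omega> runs over t > a. Since q a lies in A and not in
      B, the strict inequality may be weakened, which makes S closed.\<close>
    then have "q a \<notin> B" using alpha_attained disj by auto
    then have "S = {a..} \<inter> q -` B" using a by (auto simp: S_def less_le)
    then show ?thesis using closed_vimage[OF closed_B cont_q] by auto
  qed
  moreover have "bdd_below S"
  proof (rule bdd_belowI)
    fix t assume "t \<in> S"
    then have "(INF t\<in>S. ereal t) \<le> ereal t" by (rule INF_lower)
    then show "w \<le> t" using inf by simp
  qed
  ultimately have "Inf S \<in> S" using ne by (intro closed_contains_Inf)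
  moreover have "Inf S = w" using ereal_Inf[of S] inf by simp
  ultimately have "w \<in> S" by simp
  then show "q w \<in> B" "\<alpha> < ereal w" by (auto simp: S_def)
qed

text \<open>Absolute values describe p on both sides of a turning point at once, in the form needed
  by \<open>newton_energy_at_even_extension\<close>. In the bounded case the symmetry about a is
  derived from the one about w and the period.\<close>

lemma cases_I:
  obtains (line) "\<alpha> = -\<infinity>" "\<omega> = \<infinity>" "I = UNIV" "p = q"
  | (left) w where "\<alpha> = -\<infinity>" "\<omega> = ereal w" "I = {..<w}" "q w \<in> B" "\<And>t. p t = q (w - \<bar>t - w\<bar>)"
  | (right) a where "\<alpha> = ereal a" "\<omega> = \<infinity>" "I = {a<..}" "q a \<in> A" "\<And>t. p t = q (a + \<bar>t - a\<bar>)"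
  | (bounded) a w where "\<alpha> = ereal a" "\<omega> = ereal w" "I = {a<..<w}" "q a \<in> A" "q w \<in> B" "a < w"
      "\<And>t. \<bar>t - w\<bar> \<le> w - a \<Longrightarrow> p t = q (w - \<bar>t - w\<bar>)" "\<And>t. \<bar>t - a\<bar> \<le> w - a \<Longrightarrow> p t = q (a + \<bar>t - a\<bar>)"
      "\<And>t. p (t + 2 * (w - a)) = p t"
proof -
  consider "\<alpha> = -\<infinity>" "\<omega> = \<infinity>" "p = q"
    | w where "\<alpha> = -\<infinity>" "\<omega> = ereal w" "\<forall>t\<le>w. p t = q t \<and> p (2 * w - t) = q t"
    | a where "\<alpha> = ereal a" "\<omega> = \<infinity>" "\<forall>t\<ge>a. p t = q t \<and> p (2 * a - t) = q t"
    | a w where "\<alpha> = ereal a" "\<omega> = ereal w" "\<forall>t\<in>{a..w}. p t = q t \<and> p (2 * w - t) = q t"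
        "\<forall>t. p (t + 2 * (w - a)) = p t"
    using sol unfolding minimization_solution_def extends_by_reflection_def by blast
  then show ?thesis
  proof cases
    case 1
    then show ?thesis by (intro line) (auto simp: I_def)
  next
    case 2
    have "p t = q (w - \<bar>t - w\<bar>)" for t
      using 2(3)[rule_format, of t] 2(3)[rule_format, of "2 * w - t"] by (cases "t \<le> w") (auto simp: abs_if)
    then show ?thesis using 2 omega_attained by (intro left[of w]) (auto simp: I_def)
  next
    case 3
    have "p t = q (a + \<bar>t - a\<bar>)" for t
      using 3(3)[rule_format, of t] 3(3)[rule_format, of "2 * a - t"] by (cases "a \<le> t") (auto simp: abs_if)
    then show ?thesis using 3 alpha_attained by (intro right[of a]) (auto simp: I_def)
  next
    case 4
    have B: "q w \<in> B" "\<alpha> < ereal w" using omega_attained[of w a] 4 by auto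
    then have aw: "a < w" using 4 by simp
    have r: "p t = q (w - \<bar>t - w\<bar>)" if "\<bar>t - w\<bar> \<le> w - a" for t
      using 4(3)[rule_format, of t] 4(3)[rule_format, of "2 * w - t"] that
      by (cases "t \<le> w") (auto simp: abs_if)
    have l: "p t = q (a + \<bar>t - a\<bar>)" if "\<bar>t - a\<bar> \<le> w - a" for t
    proof (cases "a \<le> t")
      case True
      then show ?thesis using 4(3)[rule_format, of t] that by (auto simp: abs_if)
    next
      case False
      then have "p t = p (t + 2 * (w - a))" using 4 by simp
      also have "\<dots> = q (w - \<bar>(t + 2 * (w - a)) - w\<bar>)" using False that aw by (intro r) (auto simp: abs_if)
      also have "w - \<bar>(t + 2 * (w - a)) - w\<bar> = a + \<bar>t - a\<bar>" using False that aw by (auto simp: abs_if)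
      finally show ?thesis .
    qed
    show ?thesis by (rule bounded[of a w]) (use 4 B aw r l alpha_attained in \<open>auto simp: I_def\<close>)
  qed
qed

lemma I_props: "open I" "convex I"
proof -
  consider "I = UNIV" | w where "I = {..<w}" | a where "I = {a<..}" | a w where "I = {a<..<w}"
    by (rule cases_I; blast)
  note c = this
  from c show "open I" by cases simp_all
  from c show "convex I" by cases (simp_all add: convex_real_interval)
qed

lemma p_eq_q: "t \<in> I \<Longrightarrow> p t = q t"
proof (rule cases_I)
  fix w assume "t \<in> I" "I = {..<w}" "\<And>t. p t = q (w - \<bar>t - w\<bar>)"
  then show "p t = q t" by simp
next
  fix a assume "t \<in> I" "I = {a<..}" "\<And>t. p t = q (a + \<bar>t - a\<bar>)"
  then show "p t = q t" by simp
next
  fix a w assume "t \<in> I" "I = {a<..<w}" "\<And>t. \<bar>t - w\<bar> \<le> w - a \<Longrightarrow> p t = q (w - \<bar>t - w\<bar>)"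
  then show "p t = q t" by simp
qed simp

lemma newton_q: "t \<in> I \<Longrightarrow> newton_energy_at V gradV c q t"
proof -
  assume t: "t \<in> I"
  obtain E where E: "\<And>t. t \<in> I \<Longrightarrow> 1/2 * (norm (velocity q t))\<^sup>2 - (V (q t) - c) = E"
    using energy_constant[OF I_props above] by blast
  have Z: "E = 0" if long: "\<And>K. \<exists>a b. {a..b} \<subseteq> I \<and> b - a \<ge> K"
  proof (rule energy_zero_unbounded[of I E])
    show "\<exists>a b. {a..b} \<subseteq> I \<and> b - a \<ge> K" for K by (rule long)
  qed (fact above, fact E)
  have "E = 0"
  proof (rule cases_I)
    assume "I = UNIV"
    then have "\<exists>a b. {a..b} \<subseteq> I \<and> b - a \<ge> K" for K by (intro exI[of _ 0] exI[of _ K]) simp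
    then show ?thesis by (rule Z)
  next
    fix w assume I: "I = {..<w}"
    have "{w - 1 - K..w - 1} \<subseteq> I" for K unfolding I by (rule subsetI) simp
    then have "\<exists>a b. {a..b} \<subseteq> I \<and> b - a \<ge> K" for K
      by (intro exI[of _ "w - 1 - K"] exI[of _ "w - 1"]) simp
    then show ?thesis by (rule Z)
  next
    fix a assume I: "I = {a<..}"
    have "{a + 1..a + 1 + K} \<subseteq> I" for K unfolding I by (rule subsetI) simp
    then have "\<exists>b d. {b..d} \<subseteq> I \<and> d - b \<ge> K" for K
      by (intro exI[of _ "a + 1"] exI[of _ "a + 1 + K"]) simp
    then show ?thesis by (rule Z)
  next
    fix a w assume "I = {a<..<w}" "q a \<in> A" "q w \<in> B" "a < w"
    then show ?thesis using above E by (intro energy_zero_bounded[of a w E]) simp_all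
  qed
  then show ?thesis
    using newton_interior[OF I_props(1) above t] E[OF t] by (simp add: newton_energy_at_def)
qed

lemma V_turning: "q t \<in> A \<union> B \<Longrightarrow> V (q t) = c"
proof -
  assume "q t \<in> A \<union> B"
  then have "V (q t) \<le> c" unfolding union by (simp add: sublevel_def)
  then show "V (q t) = c" using Vq[of t] by (rule antisym)
qed

lemma newton_p: "newton_energy_at V gradV c p t"
proof (rule cases_I)
  assume "I = UNIV" "p = q"
  then show ?thesis using newton_q by simp
next
  fix w assume *: "I = {..<w}" "q w \<in> B" "\<And>t. p t = q (w - \<bar>t - w\<bar>)"
  show ?thesis
    by (rule newton_energy_at_even_extension[of "-1" q V gradV "\<bar>t - w\<bar> + 1" c w])
       (use * newton_q V_turning in \<open>auto intro: cont_q contV contg\<close>)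
next
  fix w assume *: "I = {w<..}" "q w \<in> A" "\<And>t. p t = q (w + \<bar>t - w\<bar>)"
  show ?thesis
    by (rule newton_energy_at_even_extension[of "1" q V gradV "\<bar>t - w\<bar> + 1" c w])
       (use * newton_q V_turning in \<open>auto intro: cont_q contV contg\<close>)
next
  fix a w assume *: "I = {a<..<w}" "q a \<in> A" "q w \<in> B" "a < w"
      "\<And>t. \<bar>t - w\<bar> \<le> w - a \<Longrightarrow> p t = q (w - \<bar>t - w\<bar>)" "\<And>t. \<bar>t - a\<bar> \<le> w - a \<Longrightarrow> p t = q (a + \<bar>t - a\<bar>)"
      "\<And>t. p (t + 2 * (w - a)) = p t"
  define T where "T = 2 * (w - a)"
  have T: "T > 0" using * by (simp add: T_def)
  have 1: "newton_energy_at V gradV c p s" if "\<bar>s - w\<bar> < w - a" for s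
    by (rule newton_energy_at_even_extension[of "-1" q V gradV "w - a" c w])
       (use * newton_q V_turning that in \<open>auto intro: cont_q contV contg\<close>)
  have 2: "newton_energy_at V gradV c p s" if "\<bar>s - a\<bar> < w - a" for s
    by (rule newton_energy_at_even_extension[of "1" q V gradV "w - a" c a])
       (use * newton_q V_turning that in \<open>auto intro: cont_q contV contg\<close>)
  have sh: "newton_energy_at V gradV c p (s + T) \<longleftrightarrow> newton_energy_at V gradV c p s" for s
    using newton_energy_at_shift[of p T] *(7) by (simp add: T_def)
  \<comment> \<open>The open intervals of radius w - a about a and w cover more than one period but
    omit the point a - (w - a), so the period is started half a length before a.\<close>
  obtain s where "a - (w - a) / 2 \<le> s" "s < a - (w - a) / 2 + T"
    "newton_energy_at V gradV c p s \<longleftrightarrow> newton_energy_at V gradV c p t"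
    using periodic_representative[of T "newton_energy_at V gradV c p", OF T sh] by metis
  note s = this
  have "\<bar>s - w\<bar> < w - a \<or> \<bar>s - a\<bar> < w - a"
    using *(4) s(1,2) unfolding T_def abs_less_iff by argo
  then have "newton_energy_at V gradV c p s" using 1 2 by blast
  then show ?thesis using s(3) by simp
qed

lemma I_interval: "s \<in> I \<Longrightarrow> t \<in> I \<Longrightarrow> {s..t} \<subseteq> I"
proof
  fix r assume "s \<in> I" "t \<in> I" "r \<in> {s..t}"
  then have "\<alpha> < ereal s" "ereal s \<le> ereal r" "ereal r \<le> ereal t" "ereal t < \<omega>" by (simp_all add: I_def)
  then show "r \<in> I" unfolding I_def using less_le_trans le_less_trans by blast
qed

lemma eventually_right_of: "s \<in> I \<Longrightarrow> eventually (\<lambda>t. t \<in> I \<and> t < s) (right_of \<alpha>)" "right_of \<alpha> \<noteq> bot"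
proof -
  show "right_of \<alpha> \<noteq> bot" by (simp add: right_of_def)
  assume s: "s \<in> I"
  show "eventually (\<lambda>t. t \<in> I \<and> t < s) (right_of \<alpha>)"
  proof (rule cases_I)
    assume a: "\<alpha> = -\<infinity>" and I: "I = UNIV"
    have "right_of \<alpha> = at_bot" unfolding a right_of_def by simp
    then show ?thesis unfolding I using eventually_gt_at_bot[of s] by simp
  next
    fix w assume a: "\<alpha> = -\<infinity>" and I: "I = {..<w}"
    have "right_of \<alpha> = at_bot" unfolding a right_of_def by simp
    moreover have "s < w" using s unfolding I by simp
    ultimately show ?thesis unfolding I by (simp add: eventually_conj_iff eventually_gt_at_bot)
  next
    fix a assume a: "\<alpha> = ereal a" and I: "I = {a<..}"
    have "right_of \<alpha> = at_right a" unfolding a right_of_def by simp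
    moreover have "a < s" using s unfolding I by simp
    ultimately show ?thesis unfolding I by (auto simp: eventually_at_right_field)
  next
    fix a w assume a: "\<alpha> = ereal a" and I: "I = {a<..<w}"
    have "right_of \<alpha> = at_right a" unfolding a right_of_def by simp
    moreover have "a < s" "s < w" using s unfolding I by simp_all
    ultimately show ?thesis unfolding I by (auto simp: eventually_at_right_field)
  qed
qed

lemma eventually_left_of: "s \<in> I \<Longrightarrow> eventually (\<lambda>t. t \<in> I \<and> s < t) (left_of \<omega>)" "left_of \<omega> \<noteq> bot"
proof -
  show "left_of \<omega> \<noteq> bot" by (simp add: left_of_def)
  assume s: "s \<in> I"
  show "eventually (\<lambda>t. t \<in> I \<and> s < t) (left_of \<omega>)"
  proof (rule cases_I)
    assume a: "\<omega> = \<infinity>" and I: "I = UNIV"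
    have "left_of \<omega> = at_top" unfolding a left_of_def by simp
    then show ?thesis unfolding I using eventually_gt_at_top[of s] by simp
  next
    fix w assume a: "\<omega> = \<infinity>" and I: "I = {w<..}"
    have "left_of \<omega> = at_top" unfolding a left_of_def by simp
    moreover have "w < s" using s unfolding I by simp
    ultimately show ?thesis unfolding I by (simp add: eventually_conj_iff eventually_gt_at_top)
  next
    fix w assume a: "\<omega> = ereal w" and I: "I = {..<w}"
    have "left_of \<omega> = at_left w" unfolding a left_of_def by simp
    moreover have "s < w" using s unfolding I by simp
    ultimately show ?thesis unfolding I by (auto simp: eventually_at_left_field)
  next
    fix a w assume a: "\<omega> = ereal w" and I: "I = {a<..<w}"
    have "left_of \<omega> = at_left w" unfolding a left_of_def by simp
    moreover have "a < s" "s < w" using s unfolding I by simp_all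
    ultimately show ?thesis unfolding I by (auto simp: eventually_at_left_field)
  qed
qed

lemma I_nonempty: "I \<noteq> {}"
proof -
  consider "I = UNIV" | w where "I = {..<w}" | a where "I = {a<..}" | a w where "I = {a<..<w}" "a < w"
    by (rule cases_I; blast)
  then show ?thesis by cases (auto simp: lt_ex gt_ex dense)
qed

text \<open>A finite end of \<open>I\<close> is a point where \<open>p\<close> meets the level \<open>c\<close>.\<close>

lemma leaves_I_right: "s \<in> I \<Longrightarrow> s \<le> t \<Longrightarrow> t \<notin> I \<Longrightarrow> \<exists>w. s \<le> w \<and> w \<le> t \<and> V (p w) = c"
proof -
  assume s: "s \<in> I" and t: "s \<le> t" "t \<notin> I"
  show ?thesis
  proof (rule cases_I)
    fix w assume "I = {..<w}" "q w \<in> B" "\<And>t. p t = q (w - \<bar>t - w\<bar>)"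
    then show ?thesis using s t V_turning[of w] by (intro exI[of _ w]) auto
  next
    fix a w assume "I = {a<..<w}" "q w \<in> B" "a < w" "\<And>t. \<bar>t - w\<bar> \<le> w - a \<Longrightarrow> p t = q (w - \<bar>t - w\<bar>)"
    then show ?thesis using s t V_turning[of w] by (intro exI[of _ w]) auto
  qed (use s t in auto)
qed

lemma leaves_I_left: "s \<in> I \<Longrightarrow> t \<le> s \<Longrightarrow> t \<notin> I \<Longrightarrow> \<exists>w. t \<le> w \<and> w \<le> s \<and> V (p w) = c"
proof -
  assume s: "s \<in> I" and t: "t \<le> s" "t \<notin> I"
  show ?thesis
  proof (rule cases_I)
    fix a assume "I = {a<..}" "q a \<in> A" "\<And>t. p t = q (a + \<bar>t - a\<bar>)"
    then show ?thesis using s t V_turning[of a] by (intro exI[of _ a]) auto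
  next
    fix a w assume "I = {a<..<w}" "q a \<in> A" "a < w" "\<And>t. \<bar>t - a\<bar> \<le> w - a \<Longrightarrow> p t = q (a + \<bar>t - a\<bar>)"
    then show ?thesis using s t V_turning[of a] by (intro exI[of _ a]) auto
  qed (use s t in auto)
qed

end

subsection \<open>Periodic wells\<close>

lemma int_lattice_add: "x \<in> int_lattice \<Longrightarrow> y \<in> int_lattice \<Longrightarrow> x + y \<in> int_lattice"
  and int_lattice_diff: "x \<in> int_lattice \<Longrightarrow> y \<in> int_lattice \<Longrightarrow> x - y \<in> int_lattice"
  and int_lattice_0: "0 \<in> int_lattice"
  and int_lattice_scaleR: "x \<in> int_lattice \<Longrightarrow> real_of_int k *\<^sub>R x \<in> int_lattice"
  by (auto simp: int_lattice_def)

lemma int_lattice_sum: "(\<And>i. i \<in> S \<Longrightarrow> f i \<in> int_lattice) \<Longrightarrow> sum f S \<in> int_lattice"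
  by (induction S rule: infinite_finite_induct) (auto intro: int_lattice_add int_lattice_0)

lemma int_lattice_axis: "axis i 1 \<in> int_lattice"
  by (auto simp: int_lattice_def axis_def)

lemma int_lattice_separated:
  assumes "x \<in> int_lattice" "y \<in> int_lattice" "norm (x - y) < 1"
  shows "x = y"
proof -
  have "x $ i = y $ i" for i
  proof -
    have "\<bar>(x - y) $ i\<bar> < 1" using component_le_norm_cart[of "x - y" i] assms(3) by linarith
    moreover have "(x - y) $ i \<in> \<int>" using assms by (auto simp: int_lattice_def)
    ultimately have "(x - y) $ i = 0" using Ints_nonzero_abs_ge1 by fastforce
    then show ?thesis by simp
  qed
  then show ?thesis by (simp add: vec_eq_iff)
qed

lemma int_lattice_round:
  obtains z :: "real ^ 'n" where "z \<in> int_lattice" "norm (x - z) \<le> real CARD('n)"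
proof
  let ?z = "\<chi> i. real_of_int \<lfloor>x $ i\<rfloor>"
  show "?z \<in> int_lattice" by (simp add: int_lattice_def)
  have "norm (x - ?z) \<le> (\<Sum>i\<in>UNIV. \<bar>(x - ?z) $ i\<bar>)" by (rule norm_le_l1_cart)
  also have "\<dots> \<le> (\<Sum>i\<in>(UNIV :: 'n set). 1)"
  proof (rule sum_mono)
    fix i :: 'n
    show "\<bar>(x - ?z) $ i\<bar> \<le> 1" by simp linarith
  qed
  finally show "norm (x - ?z) \<le> real CARD('n)" by simp
qed

lemma lattice_spanI: "(\<Sum>i=1..j. real_of_int (m i) *\<^sub>R \<xi> i) \<in> lattice_span \<xi> j"
  unfolding lattice_span_def by blast

lemma lattice_span_0: "0 \<in> lattice_span \<xi> j"
  unfolding lattice_span_def by (intro CollectI exI[of _ "\<lambda>_. 0"]) simp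

lemma lattice_span_add:
  assumes "x \<in> lattice_span \<xi> j" "y \<in> lattice_span \<xi> j"
  shows "x + y \<in> lattice_span \<xi> j"
proof -
  obtain m k where "x = (\<Sum>i=1..j. real_of_int (m i) *\<^sub>R \<xi> i)" "y = (\<Sum>i=1..j. real_of_int (k i) *\<^sub>R \<xi> i)"
    using assms by (auto simp: lattice_span_def)
  then have "x + y = (\<Sum>i=1..j. real_of_int (m i + k i) *\<^sub>R \<xi> i)"
    by (simp add: sum.distrib scaleR_add_left)
  then show ?thesis by (simp only: lattice_spanI)
qed

lemma lattice_span_scaleR:
  assumes "x \<in> lattice_span \<xi> j"
  shows "real_of_int k *\<^sub>R x \<in> lattice_span \<xi> j"
proof -
  obtain m where "x = (\<Sum>i=1..j. real_of_int (m i) *\<^sub>R \<xi> i)"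
    using assms by (auto simp: lattice_span_def)
  then have "real_of_int k *\<^sub>R x = (\<Sum>i=1..j. real_of_int (k * m i) *\<^sub>R \<xi> i)"
    by (simp add: scaleR_sum_right)
  then show ?thesis by (simp only: lattice_spanI)
qed

lemma lattice_span_diff:
  assumes "x \<in> lattice_span \<xi> j" "y \<in> lattice_span \<xi> j"
  shows "x - y \<in> lattice_span \<xi> j"
  using lattice_span_add[OF assms(1) lattice_span_scaleR[OF assms(2), of "-1"]] by simp

lemma lattice_span_subset:
  assumes "\<And>i. i \<in> {1..j} \<Longrightarrow> \<xi> i \<in> int_lattice"
  shows "lattice_span \<xi> j \<subseteq> int_lattice"
  unfolding lattice_span_def using assms by (auto intro!: int_lattice_sum int_lattice_scaleR)

lemma lattice_span_generator:
  assumes "i \<in> {1..j}"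
  shows "\<xi> i \<in> lattice_span \<xi> j"
proof -
  have "(\<Sum>l=1..j. real_of_int (if l = i then 1 else 0) *\<^sub>R \<xi> l) = (\<Sum>l=1..j. if l = i then \<xi> l else 0)"
    by (rule sum.cong) auto
  also have "\<dots> = \<xi> i" using assms by simp
  finally show ?thesis using lattice_spanI[of "\<lambda>l. if l = i then 1 else 0" \<xi> j] by (simp only:)
qed

lemma lattice_span_sum: "(\<And>i. i \<in> S \<Longrightarrow> f i \<in> lattice_span \<xi> j) \<Longrightarrow> sum f S \<in> lattice_span \<xi> j"
  by (induction S rule: infinite_finite_induct) (auto intro: lattice_span_add lattice_span_0)

text \<open>A span containing every unit vector would be the whole lattice. The missing one is the
  far end of the cheap segment in \<open>min_action_le_M_p\<close>.\<close>

lemma lattice_span_misses_axis: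
  fixes \<xi> :: "nat \<Rightarrow> real ^ 'n"
  assumes "lattice_span \<xi> j \<subseteq> int_lattice" "lattice_span \<xi> j \<noteq> int_lattice"
  obtains i where "axis i 1 \<notin> lattice_span \<xi> j"
proof (rule ccontr)
  assume "\<not> thesis"
  then have ax: "axis i 1 \<in> lattice_span \<xi> j" for i using that by blast
  have "x \<in> lattice_span \<xi> j" if x: "x \<in> int_lattice" for x
  proof -
    have "x $ i *\<^sub>R axis i 1 \<in> lattice_span \<xi> j" for i
    proof -
      obtain k where "x $ i = real_of_int k" using x by (auto simp: int_lattice_def elim: Ints_cases)
      then show ?thesis using lattice_span_scaleR[OF ax, of k i] by simp
    qed
    then have "(\<Sum>i\<in>UNIV. x $ i *\<^sub>R axis i 1) \<in> lattice_span \<xi> j" by (rule lattice_span_sum)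
    then show ?thesis using basis_expansion[of x] by (simp add: scalar_mult_eq_scaleR)
  qed
  then show False using assms by blast
qed

text \<open>Take t as the first time with f \<ge> v and s as the last time before t with f \<le> u.
  Minimality, maximality and the intermediate value theorem give equality at both ends and the
  bounds in between.\<close>

lemma crossing_interval:
  fixes f :: "real \<Rightarrow> real"
  assumes f: "continuous_on {a..b} f" and "a \<le> b" and uv: "u < v"
    and ends: "f a \<le> u" "v \<le> f b"
  obtains s t where "a \<le> s" "s \<le> t" "t \<le> b" "f s = u" "f t = v" "\<And>r. r \<in> {s..t} \<Longrightarrow> u \<le> f r \<and> f r \<le> v"
proof -
  define S where "S = {a..b} \<inter> f -` {v..}"
  have "compact S" "S \<noteq> {}"
    using continuous_closed_preimage[OF f _ closed_atLeast[of v]] assms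
    by (auto simp: S_def compact_eq_bounded_closed intro: bounded_Int)
  from compact_attains_inf[OF this] obtain t where t: "t \<in> S" "\<And>x. x \<in> S \<Longrightarrow> t \<le> x" by blast
  define S' where "S' = {a..t} \<inter> f -` {..u}"
  have ft: "continuous_on {a..t} f" using t by (auto intro: continuous_on_subset[OF f] simp: S_def)
  have "compact S'" "S' \<noteq> {}"
    using continuous_closed_preimage[OF ft _ closed_atMost[of u]] assms t
    by (auto simp: S_def S'_def compact_eq_bounded_closed intro: bounded_Int)
  from compact_attains_sup[OF this] obtain s where s: "s \<in> S'" "\<And>x. x \<in> S' \<Longrightarrow> x \<le> s" by blast
  have o: "a \<le> s" "s \<le> t" "t \<le> b" "f s \<le> u" "v \<le> f t" using s t by (auto simp: S_def S'_def)
  have fst': "continuous_on {s..t} f" using o by (auto intro: continuous_on_subset[OF f])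
  have lo: "u \<le> f r" if r: "r \<in> {s..t}" for r
  proof (rule ccontr)
    assume "\<not> u \<le> f r"
    then have "r \<in> S'" using r o by (auto simp: S'_def)
    then have "r = s" using s(2)[of r] r by auto
    moreover obtain x where "s \<le> x" "x \<le> t" "f x = u"
      using IVT'[of f s u t] o uv fst' by auto
    then have "x \<in> S'" using o by (auto simp: S'_def)
    then have "x = s" using s(2)[of x] \<open>s \<le> x\<close> by simp
    ultimately show False using \<open>\<not> u \<le> f r\<close> \<open>f x = u\<close> by simp
  qed
  have hi: "f r \<le> v" if r: "r \<in> {s..t}" for r
  proof (rule ccontr)
    assume "\<not> f r \<le> v"
    obtain x where "s \<le> x" "x \<le> r" "f x = v"
      using IVT'[of f s v r] o uv r \<open>\<not> f r \<le> v\<close> continuous_on_subset[OF fst', of "{s..r}"] by auto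
    then have "x \<in> S" using o r by (auto simp: S_def)
    then have "t \<le> x" by (rule t(2))
    then have "x = r" using \<open>x \<le> r\<close> r by auto
    then show False using \<open>f x = v\<close> \<open>\<not> f r \<le> v\<close> by simp
  qed
  show ?thesis
    using that[of s t] o lo hi lo[of s] hi[of t] by (auto intro: antisym)
qed

lemma crossing_interval':
  fixes f :: "real \<Rightarrow> real"
  assumes f: "continuous_on {a..b} f" and "a \<le> b" and uv: "u < v"
    and ends: "f a \<le> u \<and> v \<le> f b \<or> f b \<le> u \<and> v \<le> f a"
  obtains s t where "a \<le> s" "s \<le> t" "t \<le> b" "\<bar>f t - f s\<bar> = v - u" "\<And>r. r \<in> {s..t} \<Longrightarrow> u \<le> f r \<and> f r \<le> v"
  using ends
proof
  assume "f a \<le> u \<and> v \<le> f b"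
  then obtain s t where "a \<le> s" "s \<le> t" "t \<le> b" "f s = u" "f t = v" "\<And>r. r \<in> {s..t} \<Longrightarrow> u \<le> f r \<and> f r \<le> v"
    using crossing_interval[OF f assms(2) uv] by blast
  then show ?thesis using that[of s t] uv by auto
next
  assume e: "f b \<le> u \<and> v \<le> f a"
  have "continuous_on {a..b} (\<lambda>x. f (a + b - x))"
    by (intro continuous_on_compose2[OF f] continuous_intros) auto
  then obtain s t where st: "a \<le> s" "s \<le> t" "t \<le> b" "f (a + b - s) = u" "f (a + b - t) = v"
    "\<And>r. r \<in> {s..t} \<Longrightarrow> u \<le> f (a + b - r) \<and> f (a + b - r) \<le> v"
    using crossing_interval[of a b "\<lambda>x. f (a + b - x)" u v] assms(2) uv e by auto
  show ?thesis
  proof (rule that[of "a + b - t" "a + b - s"])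
    fix r assume "r \<in> {a + b - t..a + b - s}"
    then show "u \<le> f r \<and> f r \<le> v" using st(6)[of "a + b - r"] by auto
  qed (use st uv in auto)
qed

section \<open>The potential near and away from its wells\<close>

locale periodic_well =
  fixes V :: "real ^ 'n \<Rightarrow> real" and gradV :: "real ^ 'n \<Rightarrow> real ^ 'n" and cp :: real
  assumes grad: "\<And>x. GDERIV V x :> gradV x" and contg: "continuous_on UNIV gradV"
    and per: "\<And>x z. z \<in> int_lattice \<Longrightarrow> V (x + z) = V x"
    and nonneg: "\<And>x. V x \<ge> 0" and zero: "\<And>x. V x = 0 \<longleftrightarrow> x \<in> int_lattice"
    and lip: "\<And>x. \<exists>r>0. \<exists>L. L-lipschitz_on (ball x r) gradV"
    and cp: "admissible_cp V cp"
begin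

lemma contV: "continuous_on S V"
  using grad by (auto simp: gderiv_def intro!: continuous_at_imp_continuous_on has_derivative_continuous)

lemma per_diff: "z \<in> int_lattice \<Longrightarrow> V (x - z) = V x"
  using per[of z "x - z"] by simp

text \<open>Every point is within distance N of a lattice point, so by periodicity it suffices to
  look at a compact ball. On its points at distance at least \<epsilon> from the lattice V has a
  positive minimum, unless there are none.\<close>

lemma well:
  assumes "\<epsilon> > 0"
  obtains \<beta> where "\<beta> > 0" "\<And>x. V x < \<beta> \<Longrightarrow> \<exists>z\<in>int_lattice. norm (x - z) < \<epsilon>"
proof -
  define K where "K = cball 0 (real CARD('n)) \<inter> (\<Inter>z\<in>int_lattice. {x::real^'n. norm (x - z) \<ge> \<epsilon>})"
  have "closed (\<Inter>z\<in>int_lattice. {x::real^'n. norm (x - z) \<ge> \<epsilon>})"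
    by (intro closed_INT ballI closed_Collect_le continuous_intros)
  then have "compact K" unfolding K_def by (rule compact_Int_closed[OF compact_cball])
  have red: "\<exists>z\<in>int_lattice. norm (x - z) < \<epsilon>" if K: "\<And>y. y \<in> K \<Longrightarrow> \<beta> \<le> V y" and x: "V x < \<beta>" for x \<beta>
  proof -
    obtain z0 where z0: "z0 \<in> int_lattice" "norm (x - z0) \<le> real CARD('n)" by (rule int_lattice_round)
    have "x - z0 \<notin> K" using K[of "x - z0"] x per_diff[OF z0(1), of x] by auto
    then obtain z where "z \<in> int_lattice" "norm (x - z0 - z) < \<epsilon>" using z0 by (auto simp: K_def not_le)
    then show ?thesis using z0 by (intro bexI[of _ "z0 + z"]) (auto simp: int_lattice_add diff_diff_eq)
  qed
  show ?thesis
  proof (cases "K = {}")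
    case True
    then show ?thesis using red[of 1] that[of 1] by auto
  next
    case False
    obtain x0 where x0: "x0 \<in> K" "\<And>y. y \<in> K \<Longrightarrow> V x0 \<le> V y"
      using continuous_attains_inf[OF \<open>compact K\<close> False contV] by blast
    have "x0 \<notin> int_lattice"
    proof
      assume "x0 \<in> int_lattice"
      then have "norm (x0 - x0) \<ge> \<epsilon>" using x0(1) unfolding K_def by blast
      then show False using assms by simp
    qed
    then have "V x0 > 0" using zero[of x0] nonneg[of x0] by linarith
    then show ?thesis using that[of "V x0"] red[of "V x0"] x0(2) by blast
  qed
qed

text \<open>The lattice point supplied by the hypothesis is within \<epsilon> + 1/3 < 1 of \<eta>,
  hence equal to it.\<close>

lemma sublevel_at_subset_ball:
  assumes "\<And>x. V x < \<beta> \<Longrightarrow> \<exists>z\<in>int_lattice. norm (x - z) < \<epsilon>" "\<epsilon> \<le> 1/3" "c < \<beta>" "\<eta> \<in> int_lattice"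
  shows "sublevel_at V c \<eta> \<subseteq> ball \<eta> \<epsilon>"
proof
  fix x assume "x \<in> sublevel_at V c \<eta>"
  then have x: "V x \<le> c" "norm (x - \<eta>) < 1/3" by (auto simp: sublevel_at_def sublevel_def dist_norm norm_minus_commute)
  then obtain z where z: "z \<in> int_lattice" "norm (x - z) < \<epsilon>" using assms(1)[of x] assms(3) by auto
  have "norm (z - \<eta>) \<le> norm (x - \<eta>) + norm (x - z)"
    using norm_triangle_ineq4[of "x - \<eta>" "x - z"] by simp
  then have "norm (z - \<eta>) < 1" using x z assms(2) by linarith
  then have "z = \<eta>" using int_lattice_separated z assms(4) by blast
  then show "x \<in> ball \<eta> \<epsilon>" using z by (simp add: dist_norm norm_minus_commute)
qed

lemma lattice_in_sublevel_at: "\<eta> \<in> int_lattice \<Longrightarrow> 0 \<le> c \<Longrightarrow> \<eta> \<in> sublevel_at V c \<eta>"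
  using zero[of \<eta>] by (simp add: sublevel_at_def sublevel_def)

text \<open>Closedness needs an argument, as the balls are open and the unions may be infinite:
  since the balls cover the sublevel set and are disjoint, each part is the closed sublevel set
  minus the open balls around the other lattice points.\<close>

lemma decomposition_lattice:
  assumes H: "H \<subseteq> int_lattice" and c: "0 \<le> c" "c < cp"
  shows "decomposition V c (\<Union>\<eta>\<in>H. sublevel_at V c \<eta>) (\<Union>\<eta>\<in>int_lattice - H. sublevel_at V c \<eta>)"
proof
  have cov: "sublevel V c \<subseteq> (\<Union>\<eta>\<in>int_lattice. ball \<eta> (1/3))"
    using cp c unfolding admissible_cp_def by auto
  have uniq: "\<eta> = \<theta>" if "x \<in> ball \<eta> (1/3)" "x \<in> ball \<theta> (1/3)" "\<eta> \<in> int_lattice" "\<theta> \<in> int_lattice" for x \<eta> \<theta> :: "real^'n"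
  proof (rule int_lattice_separated)
    have "dist \<eta> \<theta> \<le> dist \<eta> x + dist \<theta> x" by (rule dist_triangle2)
    then show "norm (\<eta> - \<theta>) < 1" using that by (simp add: dist_norm)
  qed (use that in auto)
  have cls: "closed (\<Union>\<eta>\<in>G. sublevel_at V c \<eta>)" if G: "G \<subseteq> int_lattice" for G
  proof -
    have "(\<Union>\<eta>\<in>G. sublevel_at V c \<eta>) = sublevel V c \<inter> - (\<Union>\<eta>\<in>int_lattice - G. ball \<eta> (1/3))"
    proof (intro equalityI subsetI)
      fix x assume "x \<in> (\<Union>\<eta>\<in>G. sublevel_at V c \<eta>)"
      then obtain \<eta> where e: "\<eta> \<in> G" "x \<in> sublevel V c" "x \<in> ball \<eta> (1/3)" unfolding sublevel_at_def by blast
      have "x \<notin> ball \<theta> (1/3)" if "\<theta> \<in> int_lattice - G" for \<theta>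
        using uniq[of x \<eta> \<theta>] e that G by blast
      then show "x \<in> sublevel V c \<inter> - (\<Union>\<eta>\<in>int_lattice - G. ball \<eta> (1/3))" using e by blast
    next
      fix x assume x: "x \<in> sublevel V c \<inter> - (\<Union>\<eta>\<in>int_lattice - G. ball \<eta> (1/3))"
      then obtain \<eta> where "\<eta> \<in> int_lattice" "x \<in> ball \<eta> (1/3)" using cov by blast
      then show "x \<in> (\<Union>\<eta>\<in>G. sublevel_at V c \<eta>)" using x unfolding sublevel_at_def by blast
    qed
    moreover have "closed (sublevel V c)" unfolding sublevel_def by (intro closed_Collect_le contV continuous_intros)
    moreover have "open (\<Union>\<eta>\<in>int_lattice - G. ball \<eta> (1/3))" by (intro open_UN ballI open_ball)
    ultimately show ?thesis by (simp only: closed_Int closed_Compl)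
  qed
  show "closed (\<Union>\<eta>\<in>H. sublevel_at V c \<eta>)" by (rule cls[OF H])
  show "closed (\<Union>\<eta>\<in>int_lattice - H. sublevel_at V c \<eta>)" by (rule cls) auto
  show "continuous_on UNIV V" by (rule contV)
  show "(\<Union>\<eta>\<in>H. sublevel_at V c \<eta>) \<inter> (\<Union>\<eta>\<in>int_lattice - H. sublevel_at V c \<eta>) = {}"
    using uniq H unfolding sublevel_at_def by blast
  show "(\<Union>\<eta>\<in>H. sublevel_at V c \<eta>) \<union> (\<Union>\<eta>\<in>int_lattice - H. sublevel_at V c \<eta>) = sublevel V c"
    using cov H unfolding sublevel_at_def by blast
qed

lemma M_p_bound: "norm x \<le> 1 \<Longrightarrow> 1/2 + V x \<le> M_p V"
proof -
  assume x: "norm x \<le> 1"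
  have "compact (V ` cball 0 1)" by (intro compact_continuous_image contV compact_cball)
  then have "bdd_above (V ` cball 0 1)" by (rule bounded_imp_bdd_above[OF compact_imp_bounded])
  then have "V x \<le> (SUP x\<in>cball 0 1. V x)" using x by (intro cSUP_upper) auto
  then show ?thesis by (simp add: M_p_def)
qed

text \<open>The segment from 0 to a unit vector, run at speed 1, stays in the closed unit ball and
  has kinetic density 1/2, which accounts for the value of \<open>M_p\<close>. The bound does not
  depend on c.\<close>

lemma min_action_le_M_p:
  assumes c: "0 \<le> c" "c < cp" and H: "H \<subseteq> int_lattice" "0 \<in> H" "axis i 1 \<notin> H"
  shows "min_action V c (\<Union>\<eta>\<in>H. sublevel_at V c \<eta>) (\<Union>\<eta>\<in>int_lattice - H. sublevel_at V c \<eta>) \<le> ennreal (M_p V)"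
proof -
  interpret decomposition V c "\<Union>\<eta>\<in>H. sublevel_at V c \<eta>" "\<Union>\<eta>\<in>int_lattice - H. sublevel_at V c \<eta>"
    by (rule decomposition_lattice[OF H(1) c])
  define l where "l t = t *\<^sub>R (axis i 1 :: real^'n)" for t
  have "primitive_on 0 1 l (\<lambda>_. axis i 1)"
    unfolding l_def by (rule primitive_on_C1) (auto intro!: derivative_eq_intros)
  then have "min_action V c (\<Union>\<eta>\<in>H. sublevel_at V c \<eta>) (\<Union>\<eta>\<in>int_lattice - H. sublevel_at V c \<eta>)
    \<le> (\<integral>\<^sup>+t\<in>{0..1}. lagrangian V c l (\<lambda>_. axis i 1) t \<partial>lborel)"
  proof (rule min_action_le_crossing)
    show "l 0 \<in> (\<Union>\<eta>\<in>H. sublevel_at V c \<eta>)"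
      using H lattice_in_sublevel_at[OF int_lattice_0 c(1)] by (auto simp: l_def)
    show "l 1 \<in> (\<Union>\<eta>\<in>int_lattice - H. sublevel_at V c \<eta>)"
      using H lattice_in_sublevel_at[OF int_lattice_axis[of i] c(1)] int_lattice_axis[of i] by (auto simp: l_def)
  qed simp
  also have "\<dots> \<le> (\<integral>\<^sup>+t. ennreal (M_p V) * indicator {0..1::real} t \<partial>lborel)"
  proof (rule nn_integral_mono)
    fix t :: real
    show "lagrangian V c l (\<lambda>_. axis i 1) t * indicator {0..1} t \<le> ennreal (M_p V) * indicator {0..1} t"
    proof (cases "t \<in> {0..1}")
      case True
      then have "norm (l t) \<le> 1" by (simp add: l_def)
      then have "1/2 + (V (l t) - c) \<le> M_p V" using M_p_bound[of "l t"] c by linarith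
      then show ?thesis using True by (simp add: lagrangian_def ennreal_leI)
    qed simp
  qed
  also have "\<dots> = ennreal (M_p V)" by (simp add: nn_integral_cmult_indicator)
  finally show ?thesis .
qed

end

subsection \<open>Minimizers avoid intermediate wells\<close>

lemma infdist_lessD:
  assumes "infdist x A < r" "A \<noteq> {}"
  obtains a where "a \<in> A" "dist x a < r"
proof -
  have "(INF a\<in>A. dist x a) < r" using assms by (simp add: infdist_notempty)
  then show ?thesis using that by (subst (asm) cINF_less_iff) (use assms in \<open>auto intro: bdd_belowI2[where m=0]\<close>)
qed

lemma nn_integral_Icc_split:
  fixes f :: "real \<Rightarrow> ennreal"
  assumes [measurable]: "f \<in> borel_measurable borel" and "a \<le> b" "b \<le> c"
  shows "(\<integral>\<^sup>+x\<in>{a..c}. f x \<partial>lborel) = (\<integral>\<^sup>+x\<in>{a..b}. f x \<partial>lborel) + (\<integral>\<^sup>+x\<in>{b..c}. f x \<partial>lborel)"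
proof -
  have "(\<integral>\<^sup>+x\<in>{a..c}. f x \<partial>lborel) = (\<integral>\<^sup>+x. f x * indicator {a..b} x + f x * indicator {b..c} x \<partial>lborel)"
  proof (rule nn_integral_cong_AE)
    show "AE x in lborel. f x * indicator {a..c} x = f x * indicator {a..b} x + f x * indicator {b..c} x"
      using AE_lborel_singleton[of b] by eventually_elim (use assms in \<open>auto simp: indicator_def\<close>)
  qed
  then show ?thesis by (simp add: nn_integral_add)
qed

context periodic_well
begin

text \<open>On the annulus between radii 1/6 and 1/3 around z no lattice point is within 1/6, so V
  \<ge> \<beta> there. With c \<le> \<beta>/2 the integrand is at least \<bar>h\<bar>^2/2 +
  \<beta>/2 \<ge> sqrt \<beta> * \<bar>h\<bar>, and the annulus has width 1/6.\<close>

lemma crossing_cost: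
  assumes \<beta>: "\<And>x. V x < \<beta> \<Longrightarrow> \<exists>z\<in>int_lattice. norm (x - z) < 1/6" "\<beta> > 0" and c: "c \<le> \<beta> / 2"
    and P: "primitive_on a b r h" and "a \<le> b" and z: "z \<in> int_lattice"
    and ends: "norm (r a - z) \<le> 1/6 \<and> 1/3 \<le> norm (r b - z) \<or> norm (r b - z) \<le> 1/6 \<and> 1/3 \<le> norm (r a - z)"
  shows "ennreal (sqrt \<beta> / 6) \<le> (\<integral>\<^sup>+t\<in>{a..b}. lagrangian V c r h t \<partial>lborel)"
proof -
  have "continuous_on {a..b} (\<lambda>t. norm (r t - z))"
    by (intro continuous_intros primitive_on_continuous[OF P])
  then obtain s t where st: "a \<le> s" "s \<le> t" "t \<le> b" "\<bar>norm (r t - z) - norm (r s - z)\<bar> = 1/3 - 1/6"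
    "\<And>x. x \<in> {s..t} \<Longrightarrow> 1/6 \<le> norm (r x - z) \<and> norm (r x - z) \<le> 1/3"
    using crossing_interval'[of a b "\<lambda>t. norm (r t - z)" "1/6" "1/3"] ends assms(5) by auto
  have V: "V (r x) \<ge> \<beta>" if x: "x \<in> {s..t}" for x
  proof (rule ccontr)
    assume "\<not> V (r x) \<ge> \<beta>"
    then have "V (r x) < \<beta>" by simp
    from \<beta>(1)[OF this] obtain z' where z': "z' \<in> int_lattice" "norm (r x - z') < 1/6" by blast
    have "norm (z - z') \<le> norm (r x - z') + norm (r x - z)"
      using norm_triangle_ineq4[of "r x - z'" "r x - z"] by simp
    then have "z = z'" using st(5)[OF x] z' z by (intro int_lattice_separated) auto
    then show False using st(5)[OF x] z' by auto
  qed
  have P': "primitive_on s t r h" by (rule primitive_on_subset[OF P st(1,3)])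
  note D = primitive_onD[OF P']
  have ih: "set_integrable lborel {s..t} (\<lambda>x. norm (h x))" by (rule set_integrable_norm[OF D(3)])
  have "1/6 \<le> norm (r t - r s)"
    using st(4) norm_triangle_ineq3[of "r t - z" "r s - z"] by simp
  also have "r t - r s = (LBINT x:{s..t}. h x)" using D(4)[of s t] st by simp
  also have "norm \<dots> \<le> (LBINT x:{s..t}. norm (h x))"
    using integral_norm_bound[of lborel "\<lambda>x. indicator {s..t} x *\<^sub>R h x"] by (simp add: set_lebesgue_integral_def)
  finally have "sqrt \<beta> * (1/6) \<le> sqrt \<beta> * (LBINT x:{s..t}. norm (h x))"
    using \<beta>(2) by (intro mult_left_mono) auto
  then have "ennreal (sqrt \<beta> / 6) \<le> ennreal (LBINT x:{s..t}. sqrt \<beta> * norm (h x))" by (simp add: ennreal_leI)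
  also have "\<dots> = (\<integral>\<^sup>+x\<in>{s..t}. ennreal (sqrt \<beta> * norm (h x)) \<partial>lborel)"
    by (rule set_nn_integral_eq_LBINT[symmetric]) (use ih \<beta>(2) in auto)
  also have "\<dots> \<le> (\<integral>\<^sup>+x\<in>{a..b}. lagrangian V c r h x \<partial>lborel)"
  proof (rule nn_integral_mono)
    fix x
    show "ennreal (sqrt \<beta> * norm (h x)) * indicator {s..t} x \<le> lagrangian V c r h x * indicator {a..b} x"
    proof (cases "x \<in> {s..t}")
      case True
      have "0 \<le> (norm (h x) - sqrt \<beta>)\<^sup>2" by simp
      then have "sqrt \<beta> * norm (h x) \<le> 1/2 * (norm (h x))\<^sup>2 + \<beta> / 2"
        using \<beta>(2) by (simp add: power2_diff mult.commute[of "sqrt \<beta>"])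
      also have "\<dots> \<le> 1/2 * (norm (h x))\<^sup>2 + (V (r x) - c)" using V[OF True] c by simp
      finally show ?thesis using True st by (auto simp: lagrangian_def indicator_def intro: ennreal_leI)
    qed simp
  qed
  finally show ?thesis .
qed

end

section \<open>Minimizers for the lattice decompositions\<close>

locale lattice_minimizer = periodic_well V gradV cp +
  reflected_minimizer V c "\<Union>\<eta>\<in>H. sublevel_at V c \<eta>" "\<Union>\<eta>\<in>int_lattice - H. sublevel_at V c \<eta>" gradV q p
  for V :: "real ^ 'n \<Rightarrow> real" and gradV cp c H q p +
  fixes \<eta> \<theta> :: "real ^ 'n"
  assumes H: "H \<subseteq> int_lattice" and c: "0 \<le> c"
    and \<eta>: "\<eta> \<in> H" and \<theta>: "\<theta> \<in> int_lattice - H"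
    and lim_\<alpha>: "((\<lambda>t. infdist (p t) (sublevel_at V c \<eta>)) \<longlongrightarrow> 0) (right_of \<alpha>)"
    and lim_\<omega>: "((\<lambda>t. infdist (p t) (sublevel_at V c \<theta>)) \<longlongrightarrow> 0) (left_of \<omega>)"
begin

lemma \<eta>_lattice: "\<eta> \<in> int_lattice" and \<theta>_lattice: "\<theta> \<in> int_lattice"
  using H \<eta> \<theta> by auto

lemma near_of_infdist:
  assumes "sublevel_at V c z \<subseteq> ball z (d/2)" "z \<in> int_lattice" "infdist x (sublevel_at V c z) < d / 2"
  shows "norm (x - z) < d"
proof -
  have "sublevel_at V c z \<noteq> {}" using lattice_in_sublevel_at[OF assms(2) c] by blast
  then obtain y where "y \<in> sublevel_at V c z" "dist x y < d/2" using infdist_lessD[OF assms(3)] by blast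
  then have "dist x y < d/2" "dist z y < d/2" using assms(1) by auto
  then have "dist x z < d" using dist_triangle2[of x z y] by linarith
  then show ?thesis by (simp add: dist_norm)
qed

lemma near_start:
  assumes "sublevel_at V c \<eta> \<subseteq> ball \<eta> (d/2)" "d > 0" "s \<in> I"
  obtains t where "t \<in> I" "t < s" "norm (p t - \<eta>) < d"
proof -
  have "\<forall>\<^sub>F t in right_of \<alpha>. infdist (p t) (sublevel_at V c \<eta>) < d / 2"
    using lim_\<alpha> by (rule order_tendstoD(2)) (use assms in simp)
  with eventually_right_of(1)[OF assms(3)]
  have "\<forall>\<^sub>F t in right_of \<alpha>. (t \<in> I \<and> t < s) \<and> infdist (p t) (sublevel_at V c \<eta>) < d / 2"
    by (rule eventually_conj)
  then show ?thesis
    using eventually_happens'[OF eventually_right_of(2)] that near_of_infdist[OF assms(1) \<eta>_lattice] by blast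
qed

lemma near_end:
  assumes "sublevel_at V c \<theta> \<subseteq> ball \<theta> (d/2)" "d > 0" "s \<in> I"
  obtains t where "t \<in> I" "s < t" "norm (p t - \<theta>) < d"
proof -
  have "\<forall>\<^sub>F t in left_of \<omega>. infdist (p t) (sublevel_at V c \<theta>) < d / 2"
    using lim_\<omega> by (rule order_tendstoD(2)) (use assms in simp)
  with eventually_left_of(1)[OF assms(3)]
  have "\<forall>\<^sub>F t in left_of \<omega>. (t \<in> I \<and> s < t) \<and> infdist (p t) (sublevel_at V c \<theta>) < d / 2"
    by (rule eventually_conj)
  then show ?thesis
    using eventually_happens'[OF eventually_left_of(2)] that near_of_infdist[OF assms(1) \<theta>_lattice] by blast
qed

text \<open>The scales: \<beta> is the height of V on the annuli, d is the distance that counts as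
  close to a lattice point, and e bounds V at that distance. By \<open>cheap\<close>, the two
  bridges together cost less than one annulus crossing.\<close>

context
  fixes \<beta> d e :: real
  assumes \<beta>: "\<And>x. V x < \<beta> \<Longrightarrow> \<exists>z\<in>int_lattice. norm (x - z) < 1/6" "\<beta> > 0" "c \<le> \<beta> / 2"
    and d: "0 < d" "d \<le> 1/6" "\<And>z x. z \<in> int_lattice \<Longrightarrow> norm (x - z) \<le> d \<Longrightarrow> V x \<le> e"
    and cheap: "d\<^sup>2 + 2 * e < sqrt \<beta> / 6"
    and small: "\<And>z. z \<in> int_lattice \<Longrightarrow> sublevel_at V c z \<subseteq> ball z (d/2)"
begin

lemma bridge_bound:
  assumes s: "s \<in> I" and t: "t \<in> I" and st: "s \<le> t"
    and z: "z \<in> H" "norm (p s - z) \<le> d" and y: "y \<in> int_lattice - H" "norm (p t - y) \<le> d"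
  shows "m \<le> (\<integral>\<^sup>+x\<in>{s..t}. L x \<partial>lborel) + ennreal (d\<^sup>2 + 2 * e)"
proof (rule min_action_le_bridge[OF prim_q st c meas_q])
  show "z \<in> (\<Union>\<eta>\<in>H. sublevel_at V c \<eta>)" using z lattice_in_sublevel_at[OF _ c, of z] H by blast
  show "y \<in> (\<Union>\<eta>\<in>int_lattice - H. sublevel_at V c \<eta>)" using y lattice_in_sublevel_at[OF _ c, of y] by blast
  show "norm (q s - z) \<le> d" "norm (q t - y) \<le> d" using z y p_eq_q s t by auto
  show "V x \<le> e" if "x \<in> cball z d" for x
    using d(3)[of z x] z H that by (auto simp: dist_norm norm_minus_commute)
  show "V x \<le> e" if "x \<in> cball y d" for x
    using d(3)[of y x] y that by (auto simp: dist_norm norm_minus_commute)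
qed

text \<open>If the arc over {s..t} almost realises the minimum after adding two bridges, the rest of
  the orbit can afford no annulus crossing. The crossing lies before or after the arc; in the
  applications the other interval is degenerate.\<close>

lemma no_excursion:
  assumes ab: "a \<le> b" "b \<le> s" "s \<le> t" "t \<le> a'" "a' \<le> b'"
    and bound: "m \<le> (\<integral>\<^sup>+x\<in>{s..t}. L x \<partial>lborel) + ennreal (d\<^sup>2 + 2 * e)"
    and cost: "ennreal (sqrt \<beta> / 6) \<le> (\<integral>\<^sup>+x\<in>{a..b}. L x \<partial>lborel) \<or> ennreal (sqrt \<beta> / 6) \<le> (\<integral>\<^sup>+x\<in>{a'..b'}. L x \<partial>lborel)"
  shows False
proof -
  let ?J = "\<lambda>u v. (\<integral>\<^sup>+x\<in>{u..v}. L x \<partial>lborel)"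
  have "?J a b' = ?J a b + (?J b s + (?J s t + (?J t a' + ?J a' b')))"
    using ab by (simp add: nn_integral_Icc_split[OF meas_L, of a b b'] nn_integral_Icc_split[OF meas_L, of b s b']
        nn_integral_Icc_split[OF meas_L, of s t b'] nn_integral_Icc_split[OF meas_L, of t a' b'])
  then have le: "?J a b + (?J b s + (?J s t + (?J t a' + ?J a' b'))) \<le> m" using set_action_le by metis
  have "ennreal (sqrt \<beta> / 6) + ?J s t \<le> ?J a b + (?J b s + (?J s t + (?J t a' + ?J a' b')))"
    using cost
  proof
    assume "ennreal (sqrt \<beta> / 6) \<le> ?J a b"
    then show ?thesis by (intro add_mono) (auto intro: add_increasing add_increasing2)
  next
    assume "ennreal (sqrt \<beta> / 6) \<le> ?J a' b'"
    then have "?J s t + ennreal (sqrt \<beta> / 6) \<le> ?J s t + (?J t a' + ?J a' b')"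
      by (intro add_left_mono add_increasing) auto
    also have "\<dots> \<le> ?J b s + (?J s t + (?J t a' + ?J a' b'))" by (rule add_increasing) auto
    also have "\<dots> \<le> ?J a b + (?J b s + (?J s t + (?J t a' + ?J a' b')))" by (rule add_increasing) auto
    finally show ?thesis unfolding add.commute[of "ennreal (sqrt \<beta> / 6)"] .
  qed
  then have "ennreal (sqrt \<beta> / 6) + ?J s t \<le> m" using le by (rule order_trans)
  also note bound
  finally have *: "?J s t + ennreal (sqrt \<beta> / 6) \<le> ?J s t + ennreal (d\<^sup>2 + 2 * e)" by (simp add: add.commute)
  have "?J s t < \<infinity>" using set_action_le[of "{s..t}"] fin by (rule order_le_less_trans)
  then have "ennreal (sqrt \<beta> / 6) \<le> ennreal (d\<^sup>2 + 2 * e)"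
    using * by (simp add: ennreal_add_left_cancel_le less_top[symmetric])
  moreover have "d\<^sup>2 + 2 * e \<ge> 0"
    using d(3)[OF \<eta>_lattice, of \<eta>] d(1) nonneg[of \<eta>] by simp
  ultimately have "sqrt \<beta> / 6 \<le> d\<^sup>2 + 2 * e" by (subst (asm) ennreal_le_iff) auto
  then show False using cheap by simp
qed

text \<open>Otherwise the arc of \<open>q\<close> before \<open>t\<close>, which crosses an annulus around \<open>\<eta>\<close>, could be replaced by a
  cheaper straight segment issuing from \<open>z\<close>. The next lemma does the same at the other end.\<close>

lemma near_H_imp_start:
  assumes t: "t \<in> I" and z: "z \<in> H" "norm (p t - z) \<le> d" and t': "t' \<in> I" "t' \<le> t"
  shows "norm (p t' - \<eta>) < 1/3"
proof (rule ccontr)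
  assume far: "\<not> norm (p t' - \<eta>) < 1/3"
  obtain t0 where t0: "t0 \<in> I" "t0 < t'" "norm (p t0 - \<eta>) < d"
    using near_start[OF small[OF \<eta>_lattice] d(1) t'(1)] .
  obtain T where T: "T \<in> I" "t < T" "norm (p T - \<theta>) < d"
    using near_end[OF small[OF \<theta>_lattice] d(1) t] .
  have b: "m \<le> (\<integral>\<^sup>+x\<in>{t..T}. L x \<partial>lborel) + ennreal (d\<^sup>2 + 2 * e)"
    by (rule bridge_bound[OF t T(1) _ z \<theta>]) (use T in auto)
  have "ennreal (sqrt \<beta> / 6) \<le> (\<integral>\<^sup>+x\<in>{t0..t'}. L x \<partial>lborel)"
    by (rule crossing_cost[OF \<beta> prim_q _ \<eta>_lattice]) (use far t0 t' d(2) p_eq_q in auto)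
  then show False using no_excursion[of t0 t' t T T T] b t0 t' T by auto
qed

lemma near_complement_imp_end:
  assumes t: "t \<in> I" and z: "z \<in> int_lattice - H" "norm (p t - z) \<le> d" and t': "t' \<in> I" "t \<le> t'"
  shows "norm (p t' - \<theta>) < 1/3"
proof (rule ccontr)
  assume far: "\<not> norm (p t' - \<theta>) < 1/3"
  obtain t0 where t0: "t0 \<in> I" "t0 < t" "norm (p t0 - \<eta>) < d"
    using near_start[OF small[OF \<eta>_lattice] d(1) t] .
  obtain T where T: "T \<in> I" "t' < T" "norm (p T - \<theta>) < d"
    using near_end[OF small[OF \<theta>_lattice] d(1) t'(1)] .
  have b: "m \<le> (\<integral>\<^sup>+x\<in>{t0..t}. L x \<partial>lborel) + ennreal (d\<^sup>2 + 2 * e)"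
    by (rule bridge_bound[OF t0(1) t _ \<eta> _ z]) (use t0 in auto)
  have "ennreal (sqrt \<beta> / 6) \<le> (\<integral>\<^sup>+x\<in>{t'..T}. L x \<partial>lborel)"
    by (rule crossing_cost[OF \<beta> prim_q _ \<theta>_lattice]) (use far T t' d(2) p_eq_q in auto)
  then show False using no_excursion[of t0 t0 t0 t t' T] b t0 t' T by auto
qed

text \<open>The time found here becomes the origin of the normalised orbit. It exists because the
  orbit comes d-close to both \<eta> and \<theta>, which are at least 1 apart.\<close>

lemma leaves_start:
  obtains s where "s \<in> I" "norm (p s - \<eta>) = 1/3"
proof -
  obtain s0 where s0: "s0 \<in> I" using I_nonempty by blast
  obtain s where s: "s \<in> I" "s < s0" "norm (p s - \<eta>) < d"
    using near_start[OF small[OF \<eta>_lattice] d(1) s0] .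
  obtain t where t: "t \<in> I" "s < t" "norm (p t - \<theta>) < d"
    using near_end[OF small[OF \<theta>_lattice] d(1) s(1)] .
  have "\<not> norm (\<theta> - \<eta>) < 1" using int_lattice_separated[OF \<theta>_lattice \<eta>_lattice] \<eta> \<theta> by auto
  moreover have "norm (\<theta> - \<eta>) \<le> norm (p t - \<eta>) + norm (p t - \<theta>)"
    using norm_triangle_ineq4[of "p t - \<eta>" "p t - \<theta>"] by simp
  ultimately have far: "1/3 \<le> norm (p t - \<eta>)" using t(3) d(2) by linarith
  have sub: "{s..t} \<subseteq> I" by (rule I_interval[OF s(1) t(1)])
  have "continuous_on {s..t} (\<lambda>x. norm (p x - \<eta>))"
  proof (intro continuous_intros)
    show "continuous_on {s..t} p"
      using continuous_on_cong[of "{s..t}" "{s..t}" p q] p_eq_q sub cont_q by blast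
  qed
  then obtain x where "s \<le> x" "x \<le> t" "norm (p x - \<eta>) = 1/3"
    using IVT'[of "\<lambda>x. norm (p x - \<eta>)" s "1/3" t] s t far d(2) by auto
  then show ?thesis using that sub by auto
qed

end

text \<open>Dropping the kinetic part leaves a bound that, with K = \<open>M_p V\<close>, is uniform
  in c and survives the passage to the limit.\<close>

lemma potential_integral_le:
  assumes "{a..b} \<subseteq> I" "a \<le> b" "m \<le> ennreal K" "K \<ge> 0"
  shows "integral {a..b} (\<lambda>t. V (p t) - c) \<le> K"
proof -
  have i: "set_integrable lborel {a..b} (\<lambda>t. V (q t) - c)"
    by (intro borel_integrable_atLeastAtMost' continuous_intros cont_Vq)
  have "ennreal (LBINT t:{a..b}. V (q t) - c) = (\<integral>\<^sup>+t\<in>{a..b}. ennreal (V (q t) - c) \<partial>lborel)"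
    by (rule set_nn_integral_eq_LBINT[symmetric, OF i]) (use Vq in simp)
  also have "\<dots> \<le> (\<integral>\<^sup>+t\<in>{a..b}. L t \<partial>lborel)"
    by (rule nn_integral_mono) (auto simp: lagrangian_def indicator_def intro: ennreal_leI)
  also have "\<dots> \<le> ennreal K" using set_action_le assms(3) by (rule order_trans)
  finally have "(LBINT t:{a..b}. V (q t) - c) \<le> K" using assms(4) by (subst (asm) ennreal_le_iff) auto
  moreover have "(LBINT t:{a..b}. V (q t) - c) = integral {a..b} (\<lambda>t. V (q t) - c)"
    by (rule set_borel_integral_eq_integral(2)[OF i])
  moreover have "integral {a..b} (\<lambda>t. V (p t) - c) = integral {a..b} (\<lambda>t. V (q t) - c)"
    by (rule integral_cong) (use assms(1) p_eq_q in auto)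
  ultimately show ?thesis by simp
qed

end

subsection \<open>Compactness of bounded solutions\<close>

text \<open>Ascoli's theorem on the whole line: a subsequence converges at all rationals, and the
  common Lipschitz constant carries this to every point and, by finite covers with balls of radius e
  / (4 * K), to uniform convergence on intervals.\<close>

lemma lipschitz_convergent_subsequence:
  fixes F :: "nat \<Rightarrow> real \<Rightarrow> 'b::euclidean_space"
  assumes K: "K > 0" "\<And>n s t. norm (F n s - F n t) \<le> K * \<bar>s - t\<bar>" and M: "\<And>n t. norm (F n t) \<le> M"
  shows "\<exists>r G. strict_mono (r :: nat \<Rightarrow> nat) \<and> (\<forall>a b. uniform_limit {a..b} (\<lambda>n. F (r n)) G sequentially)"
proof -
  obtain r where r: "strict_mono (r :: nat \<Rightarrow> nat)" "\<And>x. x \<in> \<rat> \<Longrightarrow> \<exists>l. (\<lambda>n. F (r n) x) \<longlonglongrightarrow> l"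
    using function_convergent_subsequence[OF countable_rat, of F M] M by blast
  have "convergent (\<lambda>n. F (r n) t)" for t
  proof (rule Cauchy_convergent, rule metric_CauchyI)
    fix e :: real assume e: "e > 0"
    define d where "d = e / (4 * K)"
    have d: "d > 0" "K * d = e / 4" using e K by (auto simp: d_def)
    obtain x where x: "x \<in> \<rat>" "t < x" "x < t + d" using Rats_dense_in_real[of t "t + d"] d by auto
    obtain l where "(\<lambda>n. F (r n) x) \<longlonglongrightarrow> l" using r(2)[OF x(1)] by blast
    then have "Cauchy (\<lambda>n. F (r n) x)" by (rule LIMSEQ_imp_Cauchy)
    then obtain N where N: "\<And>m n. m \<ge> N \<Longrightarrow> n \<ge> N \<Longrightarrow> dist (F (r m) x) (F (r n) x) < e / 4"
      using metric_CauchyD[of _ "e/4"] e by (metis zero_less_divide_iff zero_less_numeral)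
    have near: "dist (F (r n) t) (F (r n) x) \<le> e / 4" for n
    proof -
      have "norm (F (r n) t - F (r n) x) \<le> K * \<bar>t - x\<bar>" by (rule K(2))
      also have "\<dots> \<le> K * d" using x K(1) by (intro mult_left_mono) auto
      finally show ?thesis using d by (simp add: dist_norm)
    qed
    have "dist (F (r m) t) (F (r n) t) < e" if "m \<ge> N" "n \<ge> N" for m n
    proof -
      have "dist (F (r m) t) (F (r n) t) \<le> dist (F (r m) t) (F (r m) x) + dist (F (r m) x) (F (r n) x) + dist (F (r n) x) (F (r n) t)"
        using dist_triangle[of "F (r m) t" "F (r n) t" "F (r m) x"] dist_triangle[of "F (r m) x" "F (r n) t" "F (r n) x"] by linarith
      then show ?thesis using near[of m] near[of n] N[OF that] e by (simp add: dist_commute)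
    qed
    then show "\<exists>N. \<forall>m\<ge>N. \<forall>n\<ge>N. dist (F (r m) t) (F (r n) t) < e" by blast
  qed
  then obtain G where G: "\<And>t. (\<lambda>n. F (r n) t) \<longlonglongrightarrow> G t" unfolding convergent_def by metis
  have GK: "norm (G s - G t) \<le> K * \<bar>s - t\<bar>" for s t
    by (rule tendsto_upperbound[OF tendsto_norm[OF tendsto_diff[OF G G]]]) (auto simp: K)
  have "uniform_limit {a..b} (\<lambda>n. F (r n)) G sequentially" for a b
  proof (rule uniform_limitI)
    fix e :: real assume e: "e > 0"
    define d where "d = e / (4 * K)"
    have d: "d > 0" "K * d = e / 4" using e K by (auto simp: d_def)
    obtain C where C: "C \<subseteq> {a..b}" "finite C" "{a..b} \<subseteq> (\<Union>x\<in>C. ball x d)"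
    proof -
      have "\<And>x. x \<in> {a..b} \<Longrightarrow> open (ball x d)" "{a..b} \<subseteq> (\<Union>x\<in>{a..b}. ball x d)" using d(1) by auto
      from compactE_image[OF compact_Icc this] show ?thesis using that by blast
    qed
    have "\<forall>\<^sub>F n in sequentially. \<forall>x\<in>C. dist (F (r n) x) (G x) < e / 4"
      using C(2) G e by (intro eventually_ball_finite ballI tendstoD) auto
    then show "\<forall>\<^sub>F n in sequentially. \<forall>t\<in>{a..b}. dist (F (r n) t) (G t) < e"
    proof eventually_elim
      case (elim n)
      show ?case
      proof
        fix t assume "t \<in> {a..b}"
        then obtain x where x: "x \<in> C" "dist x t < d" using C(3) by auto
        have "K * \<bar>t - x\<bar> \<le> K * d" using x K(1) by (intro mult_left_mono) (auto simp: dist_real_def)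
        then have "dist (F (r n) t) (F (r n) x) \<le> e / 4" "dist (G x) (G t) \<le> e / 4"
          using K(2)[of "r n" t x] GK[of x t] d by (auto simp: dist_norm abs_minus_commute)
        moreover have "dist (F (r n) t) (G t) \<le> dist (F (r n) t) (F (r n) x) + dist (F (r n) x) (G x) + dist (G x) (G t)"
          using dist_triangle[of "F (r n) t" "G t" "F (r n) x"] dist_triangle[of "F (r n) x" "G t" "G x"] by linarith
        ultimately show "dist (F (r n) t) (G t) < e" using elim x(1) e by fastforce
      qed
    qed
  qed
  then show ?thesis using r(1) by blast
qed

lemma has_vector_derivative_uniform_limit:
  fixes f :: "nat \<Rightarrow> real \<Rightarrow> 'a::banach"
  assumes f: "\<And>n t. (f n has_vector_derivative f' n t) (at t)"
    and lim: "\<And>t. (\<lambda>n. f n t) \<longlonglongrightarrow> g t"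
    and f': "\<And>a b. uniform_limit {a..b} f' g' sequentially"
  shows "(g has_vector_derivative g' t) (at t)"
proof -
  let ?S = "{t - 1..t + 1}"
  have "\<exists>h. \<forall>x\<in>?S. (\<lambda>n. f n x) \<longlonglongrightarrow> h x \<and> (h has_derivative (\<lambda>s. s *\<^sub>R g' x)) (at x within ?S)"
  proof (rule has_derivative_sequence[where ?x0.0=t and f'="\<lambda>n x s. s *\<^sub>R f' n x"])
    show "(f n has_derivative (\<lambda>s. s *\<^sub>R f' n x)) (at x within ?S)" for n x
      using f has_derivative_at_withinI unfolding has_vector_derivative_def by blast
    fix e :: real assume "e > 0"
    from uniform_limitD[OF f' this, of "t-1" "t+1"]
    show "\<forall>\<^sub>F n in sequentially. \<forall>x\<in>?S. \<forall>s. norm (s *\<^sub>R f' n x - s *\<^sub>R g' x) \<le> e * norm s"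
    proof eventually_elim
      case (elim n)
      show ?case
      proof (intro ballI allI)
        fix x s assume "x \<in> ?S"
        then have "norm (f' n x - g' x) \<le> e" using elim by (auto simp: dist_norm intro: less_imp_le)
        then have "\<bar>s\<bar> * norm (f' n x - g' x) \<le> \<bar>s\<bar> * e" by (intro mult_left_mono) auto
        then show "norm (s *\<^sub>R f' n x - s *\<^sub>R g' x) \<le> e * norm s"
          by (simp add: scaleR_diff_right[symmetric] mult.commute)
      qed
    qed
  qed (use lim in auto)
  then obtain h where h: "\<And>x. x \<in> ?S \<Longrightarrow> (\<lambda>n. f n x) \<longlonglongrightarrow> h x"
    "\<And>x. x \<in> ?S \<Longrightarrow> (h has_derivative (\<lambda>s. s *\<^sub>R g' x)) (at x within ?S)" by blast
  have hg: "h x = g x" if "x \<in> ?S" for x using LIMSEQ_unique[OF h(1)[OF that] lim] .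
  have "(h has_vector_derivative g' t) (at t)"
    using h(2)[of t] at_within_interior[of t ?S] by (simp add: has_vector_derivative_def)
  then show ?thesis
    by (rule has_vector_derivative_transform_within_open[where S="{t-1<..<t+1}"]) (use hg in auto)
qed

lemma newton_energy_at_velocity:
  assumes "\<And>t. newton_energy_at V gradV c p t"
  shows "velocity (velocity p) t = gradV (p t)"
  using assms[of t] unfolding newton_energy_at_def velocity_def[of "velocity p"]
  by (intro vector_derivative_at) simp

lemma newton_energy_at_imp_solution:
  assumes N: "\<And>t. newton_energy_at V gradV c p t" and cg: "continuous_on UNIV gradV"
  shows "newton_solution gradV p"
proof -
  have p: "(p has_vector_derivative velocity p t) (at t)"
    and v: "(velocity p has_vector_derivative gradV (p t)) (at t)" for t
    using N[of t] by (auto simp: newton_energy_at_def)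
  have "continuous_on UNIV p" "continuous_on UNIV (velocity p)"
    using has_vector_derivative_continuous[OF p] has_vector_derivative_continuous[OF v]
    by (auto intro!: continuous_at_imp_continuous_on)
  moreover from this have "continuous_on UNIV (\<lambda>t. gradV (p t))"
    by (intro continuous_on_compose2[OF cg]) auto
  ultimately show ?thesis
    unfolding newton_solution_def C2_curve_def C1_differentiable_on_def
    using p v newton_energy_at_velocity[OF N]
    by (intro conjI exI[of _ "velocity p"] exI[of _ "\<lambda>t. gradV (p t)"] allI ballI) auto
qed

lemma vector_derivative_bounded_imp_lipschitz:
  fixes f :: "real \<Rightarrow> 'a::real_normed_vector"
  assumes f: "\<And>t. (f has_vector_derivative f' t) (at t)" and B: "\<And>t. norm (f' t) \<le> B"
  shows "norm (f s - f t) \<le> B * \<bar>s - t\<bar>"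
proof -
  have "norm (f s - f t) \<le> B * norm (s - t)"
  proof (rule differentiable_bound[OF convex_UNIV, where f'="\<lambda>t s. s *\<^sub>R f' t"])
    show "(f has_derivative (\<lambda>s. s *\<^sub>R f' t)) (at t within UNIV)" for t
      using f unfolding has_vector_derivative_def by simp
    show "onorm (\<lambda>s. s *\<^sub>R f' t) \<le> B" for t
    proof (rule onorm_bound)
      show "0 \<le> B" using order_trans[OF norm_ge_zero B[of t]] .
      show "norm (x *\<^sub>R f' t) \<le> B * norm x" for x
        using mult_left_mono[OF B[of t], of "\<bar>x\<bar>"] by (simp add: mult.commute)
    qed
  qed auto
  then show ?thesis by simp
qed

text \<open>The energy identity bounds the velocities and the equation bounds the accelerations, so
  the pairs of position and velocity are bounded and uniformly Lipschitz, and one extraction serves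
  for both. The second derivatives then converge because they equal \<open>gradV\<close> along the
  curves.\<close>

lemma newton_compactness:
  fixes V :: "real ^ 'n \<Rightarrow> real"
  assumes cV: "continuous_on UNIV V" and cg: "continuous_on UNIV gradV" and c: "c \<longlonglongrightarrow> 0" "\<And>n. c n \<ge> 0"
    and N: "\<And>n t. newton_energy_at V gradV (c n) (f n) t" and R: "\<And>n t. norm (f n t) \<le> R"
  obtains r Q where "strict_mono (r :: nat \<Rightarrow> nat)" "\<And>t. newton_energy_at V gradV 0 Q t" "\<And>t. norm (Q t) \<le> R"
    "C2_loc_converges (\<lambda>n. f (r n)) Q"
proof -
  obtain V1 where V1: "\<And>x. norm x \<le> R \<Longrightarrow> V x \<le> V1"
  proof -
    have "bounded (V ` cball 0 R)"
      by (intro compact_imp_bounded compact_continuous_image continuous_on_subset[OF cV]) auto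
    then obtain V1 where "\<And>x. x \<in> cball 0 R \<Longrightarrow> norm (V x) \<le> V1" by (metis bounded_iff imageI)
    then show ?thesis using that[of V1] by (metis abs_le_D1 mem_cball_0 real_norm_def)
  qed
  obtain G1 where G1: "\<And>x. norm x \<le> R \<Longrightarrow> norm (gradV x) \<le> G1"
  proof -
    have "bounded (gradV ` cball 0 R)"
      by (intro compact_imp_bounded compact_continuous_image continuous_on_subset[OF cg]) auto
    then obtain G1 where "\<And>x. x \<in> cball 0 R \<Longrightarrow> norm (gradV x) \<le> G1" by (metis bounded_iff imageI)
    then show ?thesis using that[of G1] by (metis mem_cball_0)
  qed
  have D: "(f n has_vector_derivative velocity (f n) t) (at t)"
    "(velocity (f n) has_vector_derivative gradV (f n t)) (at t)"
    "1/2 * (norm (velocity (f n) t))\<^sup>2 = V (f n t) - c n" for n t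
    using N[of n t] by (auto simp: newton_energy_at_def)
  define B where "B = sqrt (2 * V1)"
  have vB: "norm (velocity (f n) t) \<le> B" for n t
  proof -
    have "(norm (velocity (f n) t))\<^sup>2 \<le> 2 * V1" using D(3)[of n t] V1[OF R[of n t]] c(2)[of n] by linarith
    then show ?thesis unfolding B_def by (rule real_le_rsqrt)
  qed
  have gB: "norm (gradV (f n t)) \<le> G1" for n t using G1 R by blast
  have B0: "B \<ge> 0" "G1 \<ge> 0" using order_trans[OF norm_ge_zero vB[of 0 0]] order_trans[OF norm_ge_zero gB[of 0 0]] by auto
  have L1: "norm (f n s - f n t) \<le> B * \<bar>s - t\<bar>" for n s t
    by (rule vector_derivative_bounded_imp_lipschitz[OF D(1) vB])
  have L2: "norm (velocity (f n) s - velocity (f n) t) \<le> G1 * \<bar>s - t\<bar>" for n s t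
    by (rule vector_derivative_bounded_imp_lipschitz[OF D(2) gB])
  define F where "F n t = (f n t, velocity (f n) t)" for n t
  \<comment> \<open>The summand 1 makes the Lipschitz constant strictly positive, as
    \<open>lipschitz_convergent_subsequence\<close> requires.\<close>
  have LF: "norm (F n s - F n t) \<le> (B + G1 + 1) * \<bar>s - t\<bar>" for n s t
  proof -
    have "norm (F n s - F n t) \<le> norm (f n s - f n t) + norm (velocity (f n) s - velocity (f n) t)"
      using norm_Pair_le[of "f n s - f n t" "velocity (f n) s - velocity (f n) t"] by (simp add: F_def)
    also have "\<dots> \<le> B * \<bar>s - t\<bar> + G1 * \<bar>s - t\<bar>" by (intro add_mono L1 L2)
    also have "\<dots> \<le> (B + G1 + 1) * \<bar>s - t\<bar>" by (simp add: distrib_right)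
    finally show ?thesis .
  qed
  have MF: "norm (F n t) \<le> R + B" for n t
    using norm_Pair_le[of "f n t" "velocity (f n) t"] R[of n t] vB[of n t] by (simp add: F_def)
  have K0: "B + G1 + 1 > 0" using B0 by simp
  obtain r G where r: "strict_mono (r :: nat \<Rightarrow> nat)"
    and G: "\<And>a b. uniform_limit {a..b} (\<lambda>n. F (r n)) G sequentially"
    using lipschitz_convergent_subsequence[of "B + G1 + 1" F "R + B", OF K0 LF MF] by blast
  define Q where "Q t = fst (G t)" for t
  define v where "v t = snd (G t)" for t
  have uQ: "uniform_limit {a..b} (\<lambda>n. f (r n)) Q sequentially"
    and uv: "uniform_limit {a..b} (\<lambda>n. velocity (f (r n))) v sequentially" for a b
  proof -
    show "uniform_limit {a..b} (\<lambda>n. f (r n)) Q sequentially"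
    proof (rule uniform_limitI)
      fix e :: real assume "e > 0"
      from uniform_limitD[OF G this, of a b]
      show "\<forall>\<^sub>F n in sequentially. \<forall>t\<in>{a..b}. dist (f (r n) t) (Q t) < e"
      proof eventually_elim
        case (elim n)
        show ?case
        proof
          fix t assume "t \<in> {a..b}"
          then have "dist (F (r n) t) (G t) < e" using elim by blast
          then have "dist (fst (F (r n) t)) (fst (G t)) < e" by (rule order_le_less_trans[OF dist_fst_le])
          then show "dist (f (r n) t) (Q t) < e" by (simp add: F_def Q_def)
        qed
      qed
    qed
    show "uniform_limit {a..b} (\<lambda>n. velocity (f (r n))) v sequentially"
    proof (rule uniform_limitI)
      fix e :: real assume "e > 0"
      from uniform_limitD[OF G this, of a b]
      show "\<forall>\<^sub>F n in sequentially. \<forall>t\<in>{a..b}. dist (velocity (f (r n)) t) (v t) < e"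
      proof eventually_elim
        case (elim n)
        show ?case
        proof
          fix t assume "t \<in> {a..b}"
          then have "dist (F (r n) t) (G t) < e" using elim by blast
          then have "dist (snd (F (r n) t)) (snd (G t)) < e" by (rule order_le_less_trans[OF dist_snd_le])
          then show "dist (velocity (f (r n)) t) (v t) < e" by (simp add: F_def v_def)
        qed
      qed
    qed
  qed
  have ptQ: "(\<lambda>n. f (r n) t) \<longlonglongrightarrow> Q t" and ptv: "(\<lambda>n. velocity (f (r n)) t) \<longlonglongrightarrow> v t" for t
    using tendsto_uniform_limitI[OF uQ[of t t], of t] tendsto_uniform_limitI[OF uv[of t t], of t] by auto
  have QR: "norm (Q t) \<le> R" for t
    by (rule tendsto_upperbound[OF tendsto_norm[OF ptQ]]) (auto simp: R)
  have ug: "uniform_limit {a..b} (\<lambda>n t. gradV (f (r n) t)) (\<lambda>t. gradV (Q t)) sequentially" for a b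
  proof (rule uniform_limit_compose_uniformly_continuous_on[OF uQ, where B="cball 0 R"])
    show "uniformly_continuous_on (cball 0 R) gradV"
      by (intro compact_uniformly_continuous continuous_on_subset[OF cg]) auto
  qed (use R in auto)
  have Q': "(Q has_vector_derivative v t) (at t)" for t
    by (rule has_vector_derivative_uniform_limit[OF D(1) ptQ uv])
  have v': "(v has_vector_derivative gradV (Q t)) (at t)" for t
    by (rule has_vector_derivative_uniform_limit[OF D(2) ptv ug])
  have vel: "velocity Q = v" unfolding velocity_def[abs_def] by (rule ext) (rule vector_derivative_at[OF Q'])
  have E: "newton_energy_at V gradV 0 Q t" for t
  proof -
    have l1: "(\<lambda>n. V (f (r n) t) - c (r n)) \<longlonglongrightarrow> V (Q t) - 0"
      by (intro tendsto_diff continuous_on_tendsto_compose[OF cV ptQ] LIMSEQ_subseq_LIMSEQ[OF c(1) r, unfolded o_def]) auto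
    have "(\<lambda>n. 1/2 * (norm (velocity (f (r n)) t))\<^sup>2) \<longlonglongrightarrow> 1/2 * (norm (v t))\<^sup>2"
      by (intro tendsto_intros ptv)
    from LIMSEQ_unique[OF this[unfolded D(3)] l1] have "1/2 * (norm (v t))\<^sup>2 = V (Q t) - 0" .
    then show ?thesis using Q' v' vel by (simp add: newton_energy_at_def)
  qed
  have "C2_loc_converges (\<lambda>n. f (r n)) Q"
    unfolding C2_loc_converges_def
  proof (intro conjI allI impI)
    show "C2_curve (f (r n))" for n
      using newton_energy_at_imp_solution[OF N cg] by (simp add: newton_solution_def)
    show "C2_curve Q" using newton_energy_at_imp_solution[OF E cg] by (simp add: newton_solution_def)
    fix K :: "real set" assume "compact K"
    then obtain M where M: "\<And>x. x \<in> K \<Longrightarrow> \<bar>x\<bar> \<le> M" using compact_imp_bounded bounded_iff by (metis real_norm_def)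
    have K: "K \<subseteq> {-M..M}"
    proof
      fix x assume "x \<in> K"
      from M[OF this] show "x \<in> {-M..M}" by (simp add: abs_le_iff)
    qed
    show "uniform_limit K (\<lambda>n. f (r n)) Q sequentially" by (rule uniform_limit_on_subset[OF uQ K])
    show "uniform_limit K (\<lambda>n. velocity (f (r n))) (velocity Q) sequentially"
      unfolding vel by (rule uniform_limit_on_subset[OF uv K])
    have "velocity (velocity (f (r n))) = (\<lambda>t. gradV (f (r n) t))" for n
      by (rule ext) (rule newton_energy_at_velocity[OF N])
    moreover have "velocity (velocity Q) = (\<lambda>t. gradV (Q t))"
      by (rule ext) (rule newton_energy_at_velocity[OF E])
    ultimately show "uniform_limit K (\<lambda>n. velocity (velocity (f (r n)))) (velocity (velocity Q)) sequentially"
      using uniform_limit_on_subset[OF ug K] by simp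
  qed
  then show ?thesis using that r E QR by blast
qed

section \<open>Zero-energy solutions near the lattice\<close>

context periodic_well
begin

lemma gradV_lattice: "z \<in> int_lattice \<Longrightarrow> gradV z = 0"
proof -
  assume "z \<in> int_lattice"
  then have "V z = 0" using zero by simp
  then have "(\<lambda>h. h \<bullet> gradV z) = (\<lambda>h. 0)"
    using grad[of z] nonneg unfolding gderiv_def by (intro has_derivative_local_min) auto
  then show "gradV z = 0" by (metis inner_eq_zero_iff)
qed

lemma gradV_periodic: "z \<in> int_lattice \<Longrightarrow> gradV (x + z) = gradV x"
proof -
  assume z: "z \<in> int_lattice"
  have "(V has_derivative (\<lambda>h. h \<bullet> gradV (x + z))) (at (x + z))" using grad unfolding gderiv_def .
  moreover have "((\<lambda>y. y + z) has_derivative (\<lambda>h. h)) (at x)" by (auto intro!: derivative_eq_intros)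
  ultimately have "((\<lambda>y. V (y + z)) has_derivative (\<lambda>h. h \<bullet> gradV (x + z))) (at x)"
    by (rule has_derivative_compose[rotated])
  then have "(V has_derivative (\<lambda>h. h \<bullet> gradV (x + z))) (at x)" unfolding per[OF z] .
  moreover have "(V has_derivative (\<lambda>h. h \<bullet> gradV x)) (at x)" using grad unfolding gderiv_def .
  ultimately have "(\<lambda>h. h \<bullet> gradV (x + z)) = (\<lambda>h. h \<bullet> gradV x)" by (rule has_derivative_unique)
  from fun_cong[OF this, of "gradV (x + z) - gradV x"]
  have "(gradV (x + z) - gradV x) \<bullet> (gradV (x + z) - gradV x) = 0" by (simp add: inner_diff_right)
  then show "gradV (x + z) = gradV x" by simp
qed

text \<open>The gradient vanishes at the minimum z and is Lipschitz nearby, so the mean value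
  theorem gives the quadratic growth. This is what keeps a zero-energy solution from reaching z in
  finite time.\<close>

lemma quadratic_bound:
  assumes z: "z \<in> int_lattice"
  obtains \<rho> C where "\<rho> > 0" "C \<ge> 0" "\<And>x. norm (x - z) < \<rho> \<Longrightarrow> V x \<le> C * (norm (x - z))\<^sup>2"
proof -
  obtain \<rho> C where \<rho>: "\<rho> > 0" and C: "C-lipschitz_on (ball z \<rho>) gradV" using lip by blast
  have C0: "C \<ge> 0" using C by (rule lipschitz_on_nonneg)
  have "V x \<le> C * (norm (x - z))\<^sup>2" if x: "norm (x - z) < \<rho>" for x
  proof -
    define h where "h = x - z"
    obtain t where t: "0 < t" "t < 1" "V (z + h) - V z = gradV (z + t *\<^sub>R h) \<bullet> h"
      using GDERIV_mvt[OF grad] .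
    have th: "norm (t *\<^sub>R h) \<le> norm h" using t by (auto intro: mult_left_le_one_le)
    then have "dist (gradV (z + t *\<^sub>R h)) (gradV z) \<le> C * dist (z + t *\<^sub>R h) z"
      using x \<rho> by (intro lipschitz_onD[OF C]) (auto simp: h_def dist_norm)
    then have "norm (gradV (z + t *\<^sub>R h)) \<le> C * norm (t *\<^sub>R h)" using gradV_lattice[OF z] by (simp add: dist_norm)
    also have "\<dots> \<le> C * norm h" using th C0 by (rule mult_left_mono)
    finally have "norm (gradV (z + t *\<^sub>R h)) * norm h \<le> C * norm h * norm h" by (rule mult_right_mono) simp
    moreover have "V x = gradV (z + t *\<^sub>R h) \<bullet> h" using t z zero[of z] by (simp add: h_def)
    ultimately show ?thesis using norm_cauchy_schwarz[of "gradV (z + t *\<^sub>R h)" h]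
      by (simp add: h_def power2_eq_square mult.assoc)
  qed
  then show ?thesis using that \<rho> C0 by blast
qed

text \<open>A Gronwall argument: near a lattice point \<open>z\<close> the energy identity gives
  \<open>|Q'| \<le> K |Q - z|\<close>.\<close>

lemma zero_energy_avoids_lattice:
  assumes N: "\<And>t. newton_energy_at V gradV 0 Q t" and T: "Q T \<in> int_lattice"
  shows "Q t = Q T"
proof -
  define z where "z = Q T"
  obtain \<rho> C where C: "\<rho> > 0" "C \<ge> 0" "\<And>x. norm (x - z) < \<rho> \<Longrightarrow> V x \<le> C * (norm (x - z))\<^sup>2"
    using quadratic_bound T unfolding z_def by blast
  define K where "K = sqrt (2 * C) + 1"
  have K: "K > 0" using C by (simp add: K_def add_nonneg_pos)
  have D: "(Q has_vector_derivative velocity Q t) (at t)" and E: "1/2 * (norm (velocity Q t))\<^sup>2 = V (Q t)" for t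
    using N[of t] by (auto simp: newton_energy_at_def)
  have cQ: "continuous_on S Q" for S
    using has_vector_derivative_continuous[OF D] by (auto intro: continuous_at_imp_continuous_on)
  have vel: "norm (velocity Q t) \<le> K * norm (Q t - z)" if "norm (Q t - z) < \<rho>" for t
  proof (rule power2_le_imp_le)
    have "(norm (velocity Q t))\<^sup>2 \<le> 2 * (C * (norm (Q t - z))\<^sup>2)" using C(3)[OF that] E[of t] by linarith
    also have "\<dots> \<le> K\<^sup>2 * (norm (Q t - z))\<^sup>2"
    proof -
      have "2 * C \<le> K\<^sup>2" using C by (simp add: K_def power2_sum)
      then show ?thesis using mult_right_mono[of "2 * C" "K\<^sup>2" "(norm (Q t - z))\<^sup>2"] by simp
    qed
    finally show "(norm (velocity Q t))\<^sup>2 \<le> (K * norm (Q t - z))\<^sup>2" by (simp add: power_mult_distrib)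
  qed (use K in simp)
  \<comment> \<open>The times spent at z form a set that is open and closed in the connected line,
    and T belongs to it.\<close>
  have "open {t. Q t = z}"
    unfolding open_dist
  proof (intro ballI)
    fix s assume "s \<in> {t. Q t = z}"
    then have s: "Q s = z" by simp
    have "isCont Q s" by (rule has_vector_derivative_continuous[OF D])
    then obtain h0 where h0: "h0 > 0" "\<And>t. dist t s < h0 \<Longrightarrow> dist (Q t) (Q s) < \<rho>"
      using C(1) unfolding continuous_at_eps_delta by blast
    \<comment> \<open>Within h of s the curve stays where \<open>vel\<close> applies, and K * h
      \<le> 1/2 makes the maximum of \<bar>Q - z\<bar> at most half of itself, hence zero.\<close>
    define h where "h = min (h0 / 2) (1 / (2 * K))"
    have h: "h > 0" "h < h0" "K * h \<le> 1/2" using h0 K by (auto simp: h_def min_def field_simps)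
    have "\<exists>x\<in>{s-h..s+h}. \<forall>y\<in>{s-h..s+h}. norm (Q y - z) \<le> norm (Q x - z)"
      using h by (intro continuous_attains_sup continuous_intros cQ) auto
    then obtain x where x: "x \<in> {s-h..s+h}" "\<And>y. y \<in> {s-h..s+h} \<Longrightarrow> norm (Q y - z) \<le> norm (Q x - z)" by blast
    have "norm (Q x - Q s) \<le> (K * norm (Q x - z)) * norm (x - s)"
    proof (rule differentiable_bound[of "{s-h..s+h}" Q "\<lambda>t r. r *\<^sub>R velocity Q t"])
      fix t assume t: "t \<in> {s-h..s+h}"
      show "(Q has_derivative (\<lambda>r. r *\<^sub>R velocity Q t)) (at t within {s-h..s+h})"
        using D has_derivative_at_withinI unfolding has_vector_derivative_def by blast
      have "dist t s < h0" using t h by (auto simp: dist_real_def)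
      then have "norm (Q t - z) < \<rho>" using h0(2) s by (simp add: dist_norm)
      then have "norm (velocity Q t) \<le> K * norm (Q t - z)" by (rule vel)
      also have "\<dots> \<le> K * norm (Q x - z)" using x(2)[OF t] K by (intro mult_left_mono) auto
      finally have le: "norm (velocity Q t) \<le> K * norm (Q x - z)" .
      show "onorm (\<lambda>r. r *\<^sub>R velocity Q t) \<le> K * norm (Q x - z)"
      proof (intro onorm_bound)
        show "norm (y *\<^sub>R velocity Q t) \<le> K * norm (Q x - z) * norm y" for y
          using mult_left_mono[OF le, of "\<bar>y\<bar>"] by (simp add: mult.commute)
      qed (use K in simp)
    qed (use x h in auto)
    also have "\<dots> \<le> (K * norm (Q x - z)) * h"
      using x(1) K by (intro mult_left_mono) (auto simp: abs_le_iff)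
    also have "\<dots> = (K * h) * norm (Q x - z)" by simp
    also have "\<dots> \<le> 1/2 * norm (Q x - z)" using h by (intro mult_right_mono) auto
    finally have "norm (Q x - z) = 0" using s by simp
    then have "Q y = z" if "y \<in> {s-h..s+h}" for y using x(2)[OF that] by simp
    then show "\<exists>e>0. \<forall>y. dist y s < e \<longrightarrow> y \<in> {t. Q t = z}"
      using h by (intro exI[of _ h]) (auto simp: dist_real_def abs_less_iff)
  qed
  moreover have "closed {t. Q t = z}"
    by (intro closed_Collect_eq cQ continuous_on_const)
  ultimately have "{t. Q t = z} = {} \<or> {t. Q t = z} = UNIV"
    using connected_clopen[of UNIV] by (auto simp: connected_UNIV)
  then show ?thesis unfolding z_def by blast
qed

end

text \<open>Carries the uniform bound of q over to its extension.\<close>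

lemma (in reflected_minimizer) p_in_range: "p t \<in> range q"
proof (rule cases_I)
  fix a w assume "a < w" and r: "\<And>t. \<bar>t - w\<bar> \<le> w - a \<Longrightarrow> p t = q (w - \<bar>t - w\<bar>)"
    and per: "\<And>t. p (t + 2 * (w - a)) = p t"
  then obtain s where "a \<le> s" "s < a + 2 * (w - a)" "p s = p t \<longleftrightarrow> p t = p t"
    using periodic_representative[of "2 * (w - a)" "\<lambda>s. p s = p t" a t] by auto
  then show ?thesis using r[of s] by auto (metis abs_diff_le_iff rangeI diff_le_eq)
qed auto

subsection \<open>Heteroclinic limits\<close>

lemma newton_energy_at_affine:
  fixes p :: "real \<Rightarrow> real ^ 'n"
  assumes N: "\<And>t. newton_energy_at V gradV c p t"
    and V: "\<And>x. V (x - z) = V x" and gV: "\<And>x. gradV (x - z) = gradV x"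
  shows "newton_energy_at V gradV c (\<lambda>t. p (t + s) - z) t"
proof -
  let ?f = "\<lambda>t. p (t + s) - z"
  have A: "((\<lambda>x. x + s) has_vector_derivative 1) (at x)" for x
    by (auto intro!: derivative_eq_intros)
  have p: "(p has_vector_derivative velocity p x) (at x)"
    and v: "(velocity p has_vector_derivative gradV (p x)) (at x)" for x
    using N[of x] by (auto simp: newton_energy_at_def)
  have "((p \<circ> (\<lambda>x. x + s)) has_vector_derivative 1 *\<^sub>R velocity p (x + s)) (at x)" for x
    by (intro vector_diff_chain_at A p)
  from has_vector_derivative_diff[OF this has_vector_derivative_const[of z]]
  have D: "(?f has_vector_derivative velocity p (x + s)) (at x)" for x by (simp add: o_def)
  then have vel: "velocity ?f = (\<lambda>x. velocity p (x + s))"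
    unfolding velocity_def[of ?f, abs_def] by (auto simp: vector_derivative_at)
  have "((velocity p \<circ> (\<lambda>x. x + s)) has_vector_derivative 1 *\<^sub>R gradV (p (t + s))) (at t)"
    by (intro vector_diff_chain_at A v)
  then have "(velocity ?f has_vector_derivative gradV (p (t + s) - z)) (at t)"
    unfolding vel gV by (simp add: o_def)
  then show ?thesis using D[of t] N[of "t + s"] unfolding newton_energy_at_def vel V by auto
qed

text \<open>What is needed of a normalised connecting orbit \<open>f\<close> of energy \<open>-c\<close> between the wells at \<open>0\<close> and
  \<open>\<zeta>\<close>: as long as it has not met the level set \<open>c\<close> again, its potential action is at most \<open>K\<close> and
  it cannot come \<open>d\<close>-close to a lattice point other than the expected one.\<close>

definition connecting_orbit ::
    "(real ^ 'n \<Rightarrow> real) \<Rightarrow> (real ^ 'n \<Rightarrow> real ^ 'n) \<Rightarrow> real \<Rightarrow> real \<Rightarrow> real \<Rightarrow> real ^ 'n \<Rightarrow> (real \<Rightarrow> real ^ 'n) \<Rightarrow> bool" where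
  "connecting_orbit V gradV K d c \<zeta> f \<longleftrightarrow>
     norm (f 0) = 1/3 \<and> (\<forall>t. newton_energy_at V gradV c f t) \<and>
     (\<forall>t\<ge>0. (\<forall>x\<in>{0..t}. V (f x) \<noteq> c) \<longrightarrow> integral {0..t} (\<lambda>x. V (f x) - c) \<le> K \<and>
        (\<forall>z\<in>int_lattice. norm (f t - z) \<le> d \<longrightarrow> z = \<zeta>)) \<and>
     (\<forall>t\<le>0. (\<forall>x\<in>{t..0}. V (f x) \<noteq> c) \<longrightarrow> integral {t..0} (\<lambda>x. V (f x) - c) \<le> K \<and>
        (\<forall>z\<in>int_lattice. norm (f t - z) \<le> d \<longrightarrow> z = 0))"

text \<open>At the time s taken as origin the orbit is at distance 1/3 from \<eta> and at least 2/3
  from \<theta>. A later approach to H would force the first distance below 1/3, and an earlier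
  approach to the complement would force the second below 1/3. So only the complement is approached
  after s and only H before s, and the same two estimates at the time of approach identify the point
  as \<theta> or \<eta>.\<close>

lemma (in lattice_minimizer) connecting_orbit_exists:
  assumes \<beta>: "\<And>x. V x < \<beta> \<Longrightarrow> \<exists>z\<in>int_lattice. norm (x - z) < 1/6" "\<beta> > 0" "c \<le> \<beta> / 2"
    and d: "0 < d" "d \<le> 1/6" "\<And>z x. z \<in> int_lattice \<Longrightarrow> norm (x - z) \<le> d \<Longrightarrow> V x \<le> e"
    and cheap: "d\<^sup>2 + 2 * e < sqrt \<beta> / 6"
    and small: "\<And>z. z \<in> int_lattice \<Longrightarrow> sublevel_at V c z \<subseteq> ball z (d/2)"
    and K: "m \<le> ennreal K" "K \<ge> 0"
    and grp: "\<And>x. x \<in> int_lattice \<Longrightarrow> x + \<eta> \<in> H \<longleftrightarrow> x \<in> H"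
  obtains s where "connecting_orbit V gradV K d c (\<theta> - \<eta>) (\<lambda>t. p (t + s) - \<eta>)"
proof -
  have "\<exists>s. s \<in> I \<and> norm (p s - \<eta>) = 1/3"
    by (rule leaves_start[OF \<beta> d cheap small]; (assumption | blast))
  then obtain s where s: "s \<in> I" "norm (p s - \<eta>) = 1/3" by blast
  have start: "norm (p t' - \<eta>) < 1/3"
    if "t \<in> I" "z \<in> H" "norm (p t - z) \<le> d" "t' \<in> I" "t' \<le> t" for t t' z
    by (rule near_H_imp_start[OF \<beta> d cheap small that])
  have stop: "norm (p t' - \<theta>) < 1/3"
    if "t \<in> I" "z \<in> int_lattice - H" "norm (p t - z) \<le> d" "t' \<in> I" "t \<le> t'" for t t' z
    by (rule near_complement_imp_end[OF \<beta> d cheap small that])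
  let ?f = "\<lambda>t. p (t + s) - \<eta>"
  have Vf: "V (?f t) = V (p (t + s))" for t by (rule per_diff[OF \<eta>_lattice])
  have gV: "gradV (x - \<eta>) = gradV x" for x
    using gradV_periodic[OF \<eta>_lattice, of "x - \<eta>"] by simp
  have N: "newton_energy_at V gradV c ?f t" for t
    by (rule newton_energy_at_affine[OF newton_p per_diff[OF \<eta>_lattice] gV])
  have right: "t + s \<in> I" if "t \<ge> 0" "\<forall>x\<in>{0..t}. V (?f x) \<noteq> c" for t
  proof (rule ccontr)
    assume "t + s \<notin> I"
    then obtain w where "s \<le> w" "w \<le> t + s" "V (p w) = c"
      using leaves_I_right[OF s(1), of "t + s"] \<open>t \<ge> 0\<close> by auto
    then show False using that(2)[rule_format, of "w - s"] Vf[of "w - s"] by simp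
  qed
  have left: "t + s \<in> I" if "t \<le> 0" "\<forall>x\<in>{t..0}. V (?f x) \<noteq> c" for t
  proof (rule ccontr)
    assume "t + s \<notin> I"
    then obtain w where "t + s \<le> w" "w \<le> s" "V (p w) = c"
      using leaves_I_left[OF s(1), of "t + s"] \<open>t \<le> 0\<close> by auto
    then show False using that(2)[rule_format, of "w - s"] Vf[of "w - s"] by simp
  qed
  have int: "integral {a..b} (\<lambda>x. V (?f x) - c) \<le> K" if "a \<le> b" "a + s \<in> I" "b + s \<in> I" for a b
  proof -
    have "integral {a..b} (\<lambda>x. V (?f x) - c) = integral {a + s..b + s} (\<lambda>x. V (p x) - c)"
      unfolding Vf using integral_shift_real_ivl[of "a + s" s "b + s" "\<lambda>x. V (p x) - c"] by simp
    also have "\<dots> \<le> K"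
      using potential_integral_le[OF I_interval[OF that(2,3)] _ K] that(1) by simp
    finally show ?thesis .
  qed
  have z1: "z = \<zeta>" if "norm (u - z) \<le> d" "norm (u - \<zeta>) < 1/3" "z \<in> int_lattice" "\<zeta> \<in> int_lattice" for u z \<zeta> :: "real^'n"
  proof (rule int_lattice_separated)
    have "norm (z - \<zeta>) \<le> norm (u - \<zeta>) + norm (u - z)"
      using norm_triangle_ineq4[of "u - \<zeta>" "u - z"] by simp
    then show "norm (z - \<zeta>) < 1" using that d(2) by linarith
  qed (use that in auto)
  have sft: "p (t + s) - (z + \<eta>) = ?f t - z" for t z by simp
  have latt: "z + \<eta> \<in> int_lattice" if "z \<in> int_lattice" for z using that \<eta>_lattice by (rule int_lattice_add)
  have "\<not> norm (\<theta> - \<eta>) < 1" using int_lattice_separated[OF \<theta>_lattice \<eta>_lattice] \<eta> \<theta> by auto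
  moreover have "norm (\<theta> - \<eta>) \<le> norm (p s - \<eta>) + norm (p s - \<theta>)"
    using norm_triangle_ineq4[of "p s - \<eta>" "p s - \<theta>"] by simp
  ultimately have far: "norm (p s - \<theta>) \<ge> 2/3" using s by linarith
  have idr: "z = \<theta> - \<eta>" if t: "t \<ge> 0" "t + s \<in> I" and z: "z \<in> int_lattice" "norm (?f t - z) \<le> d" for t z
  proof -
    have nz: "norm (p (t + s) - (z + \<eta>)) \<le> d" using z(2) unfolding sft .
    have "z + \<eta> \<notin> H"
    proof
      assume "z + \<eta> \<in> H"
      from start[OF t(2) this nz s(1)] show False using t(1) s(2) by simp
    qed
    then have "z + \<eta> \<in> int_lattice - H" using latt z by auto
    from stop[OF t(2) this nz t(2)]
    have "norm (p (t + s) - \<theta>) < 1/3" by simp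
    then have "z + \<eta> = \<theta>" using z1[OF nz] latt z \<theta>_lattice by blast
    then show ?thesis by (simp add: eq_diff_eq)
  qed
  have idl: "z = 0" if t: "t \<le> 0" "t + s \<in> I" and z: "z \<in> int_lattice" "norm (?f t - z) \<le> d" for t z
  proof -
    have nz: "norm (p (t + s) - (z + \<eta>)) \<le> d" using z(2) unfolding sft .
    have "z + \<eta> \<in> H"
    proof (rule ccontr)
      assume "z + \<eta> \<notin> H"
      then have "z + \<eta> \<in> int_lattice - H" using latt z by auto
      from stop[OF t(2) this nz s(1)] show False using t(1) far by simp
    qed
    from start[OF t(2) this nz t(2)]
    have "norm (p (t + s) - \<eta>) < 1/3" by simp
    then have "z + \<eta> = \<eta>" using z1[OF nz] latt z \<eta>_lattice by blast
    then show ?thesis by simp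
  qed
  have "connecting_orbit V gradV K d c (\<theta> - \<eta>) ?f"
    unfolding connecting_orbit_def
  proof (intro conjI allI impI ballI)
    show "norm (?f 0) = 1/3" using s by simp
    show "newton_energy_at V gradV c ?f t" for t by (rule N)
  next
    fix t :: real assume t: "0 \<le> t" "\<forall>x\<in>{0..t}. V (?f x) \<noteq> c"
    show "integral {0..t} (\<lambda>x. V (?f x) - c) \<le> K" using int[of 0 t] right[OF t] t s by simp
    fix z assume "z \<in> int_lattice" "norm (?f t - z) \<le> d"
    then show "z = \<theta> - \<eta>" using idr[OF t(1) right[OF t]] by blast
  next
    fix t :: real assume t: "t \<le> 0" "\<forall>x\<in>{t..0}. V (?f x) \<noteq> c"
    show "integral {t..0} (\<lambda>x. V (?f x) - c) \<le> K" using int[of t 0] left[OF t] t s by simp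
    fix z assume "z \<in> int_lattice" "norm (?f t - z) \<le> d"
    then show "z = 0" using idl[OF t(1) left[OF t]] by blast
  qed
  then show ?thesis by (rule that)
qed

text \<open>A form of Barbalat's lemma: h t \<ge> e forces h \<ge> e/2 on [t, t + d] with d = e / (2
  * \<Lambda>), so the integral grows by d * e/2. That is impossible once the integral is within d *
  e/2 of its supremum.\<close>

lemma lipschitz_integrable_tendsto_0:
  fixes h :: "real \<Rightarrow> real"
  assumes h: "\<And>t. h t \<ge> 0" and L: "\<Lambda> > 0" "\<And>s t. \<bar>h s - h t\<bar> \<le> \<Lambda> * \<bar>s - t\<bar>"
    and M: "\<And>T. T \<ge> 0 \<Longrightarrow> integral {0..T} h \<le> M"
  shows "(h \<longlongrightarrow> 0) at_top"
proof (rule tendstoI)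
  fix e :: real assume e: "e > 0"
  have "\<Lambda>-lipschitz_on UNIV h" using L by (intro lipschitz_onI) (auto simp: dist_real_def)
  then have ch: "continuous_on S h" for S
    using lipschitz_on_continuous_on continuous_on_subset by blast
  have hi: "h integrable_on {a..b}" for a b by (rule integrable_continuous_real[OF ch])
  define d where "d = e / (2 * \<Lambda>)"
  have d: "d > 0" "\<Lambda> * d = e / 2" using e L by (auto simp: d_def)
  define S where "S = (\<lambda>T. integral {0..T} h) ` {0..}"
  have bS: "bdd_above S" unfolding S_def using M by (intro bdd_aboveI2[where M=M]) auto
  have "Sup S - d * (e / 2) < Sup S" using d e by simp
  then obtain T0 where T0: "T0 \<ge> 0" "Sup S - d * (e / 2) < integral {0..T0} h"
    using less_cSup_iff[OF _ bS] unfolding S_def by fastforce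
  have "h t < e" if t: "t \<ge> T0" for t
  proof (rule ccontr)
    assume "\<not> h t < e"
    then have ge: "h x \<ge> e / 2" if "x \<in> {t..t+d}" for x
    proof -
      have "\<Lambda> * \<bar>t - x\<bar> \<le> \<Lambda> * d" using that L by (intro mult_left_mono) auto
      then show ?thesis using L(2)[of t x] d(2) \<open>\<not> h t < e\<close> by linarith
    qed
    have "d * (e / 2) = integral {t..t+d} (\<lambda>_. e / 2)" using d by simp
    also have "\<dots> \<le> integral {t..t+d} h" using ge by (intro integral_le hi) auto
    finally have 1: "d * (e / 2) \<le> integral {t..t+d} h" .
    have "integral {0..t+d} h = integral {0..T0} h + integral {T0..t} h + integral {t..t+d} h"
      using Henstock_Kurzweil_Integration.integral_combine[of 0 T0 t h] Henstock_Kurzweil_Integration.integral_combine[of 0 t "t+d" h]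
        hi T0 t d by simp
    moreover have "integral {T0..t} h \<ge> 0" using h by (intro integral_nonneg hi) auto
    moreover have "integral {0..t+d} h \<le> Sup S"
      using T0 t d by (intro cSup_upper bS) (auto simp: S_def)
    ultimately show False using 1 T0 by linarith
  qed
  then show "\<forall>\<^sub>F t in at_top. dist (h t) 0 < e"
    unfolding eventually_at_top_linorder using h by (intro exI[of _ T0]) (auto simp: dist_real_def)
qed

context periodic_well
begin

text \<open>Where V(Q) < \<beta> the curve is within 1/3 of some lattice point. It cannot pass from
  x to another one: at distance exactly 1/3 from x it would be closer than 1/3 to some z, and then z
  = x because the two are less than 1 apart.\<close>

lemma tendsto_lattice_point:
  fixes Q :: "real \<Rightarrow> real ^ 'n"
  assumes Q: "continuous_on UNIV Q" and V: "((\<lambda>t. V (Q t)) \<longlongrightarrow> 0) at_top"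
  obtains x where "x \<in> int_lattice" "(Q \<longlongrightarrow> x) at_top"
proof -
  obtain \<beta> where \<beta>: "\<beta> > 0" "\<And>x. V x < \<beta> \<Longrightarrow> \<exists>z\<in>int_lattice. norm (x - z) < 1/3" using well[of "1/3"] by auto
  obtain T where T: "\<And>t. t \<ge> T \<Longrightarrow> V (Q t) < \<beta>"
    using order_tendstoD(2)[OF V \<beta>(1)] unfolding eventually_at_top_linorder by blast
  obtain x where x: "x \<in> int_lattice" "norm (Q T - x) < 1/3" using \<beta>(2)[OF T] by blast
  have same: "z = x" if "norm (Q s - z) < 1/3" "norm (Q s - x) \<le> 1/3" "z \<in> int_lattice" for s z
  proof (rule int_lattice_separated)
    have "norm (z - x) \<le> norm (Q s - x) + norm (Q s - z)"
      using norm_triangle_ineq4[of "Q s - x" "Q s - z"] by simp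
    then show "norm (z - x) < 1" using that by linarith
  qed (use that x in auto)
  have stay: "norm (Q t - x) \<le> 1/3" if t: "t \<ge> T" for t
  proof (rule ccontr)
    assume far: "\<not> norm (Q t - x) \<le> 1/3"
    have "continuous_on {T..t} (\<lambda>s. norm (Q s - x))"
      by (intro continuous_intros continuous_on_subset[OF Q]) auto
    then obtain s where s: "T \<le> s" "s \<le> t" "norm (Q s - x) = 1/3"
      using IVT'[of "\<lambda>s. norm (Q s - x)" T "1/3" t] x far t by auto
    obtain z where "z \<in> int_lattice" "norm (Q s - z) < 1/3" using \<beta>(2)[OF T[OF s(1)]] by blast
    then show False using same[of s z] s by auto
  qed
  have "(Q \<longlongrightarrow> x) at_top"
  proof (rule tendstoI)
    fix e :: real assume "e > 0"
    then obtain b where b: "b > 0" "\<And>x. V x < b \<Longrightarrow> \<exists>z\<in>int_lattice. norm (x - z) < min e (1/3)"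
      using well[of "min e (1/3)"] by auto
    show "\<forall>\<^sub>F t in at_top. dist (Q t) x < e"
      using order_tendstoD(2)[OF V b(1)] eventually_ge_at_top[of T]
    proof eventually_elim
      case (elim t)
      then obtain z where "z \<in> int_lattice" "norm (Q t - z) < min e (1/3)" using b(2) by blast
      then show ?case using same[of t z] stay[OF elim(2)] by (auto simp: dist_norm)
    qed
  qed
  then show ?thesis using that x by blast
qed

lemma heteroclinic_limit:
  assumes d: "d > 0" and c: "c \<longlonglongrightarrow> 0" "\<And>n. c n \<ge> 0"
    and f: "\<And>n. connecting_orbit V gradV K d (c n) \<zeta> (f n)" and R: "\<And>n t. norm (f n t) \<le> R"
  obtains r Q where "strict_mono (r :: nat \<Rightarrow> nat)" "newton_solution gradV Q" "heteroclinic 0 \<zeta> Q"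
    "C2_loc_converges (\<lambda>n. f (r n)) Q"
proof -
  have N: "newton_energy_at V gradV (c n) (f n) t" for n t using f unfolding connecting_orbit_def by blast
  obtain r Q where r: "strict_mono (r :: nat \<Rightarrow> nat)" and NQ: "\<And>t. newton_energy_at V gradV 0 Q t"
    and QR: "\<And>t. norm (Q t) \<le> R" and conv: "C2_loc_converges (\<lambda>n. f (r n)) Q"
    using newton_compactness[OF contV contg c N R] by blast
  have D: "(Q has_vector_derivative velocity Q t) (at t)" and E: "1/2 * (norm (velocity Q t))\<^sup>2 = V (Q t)" for t
    using NQ[of t] by (auto simp: newton_energy_at_def)
  have cQ: "continuous_on S Q" for S
    using has_vector_derivative_continuous[OF D] by (auto intro: continuous_at_imp_continuous_on)
  have cVQ: "continuous_on S (\<lambda>t. V (Q t))" for S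
    by (rule continuous_on_compose2[OF contV cQ]) auto
  have cr: "(\<lambda>n. c (r n)) \<longlonglongrightarrow> 0" using LIMSEQ_subseq_LIMSEQ[OF c(1) r] by (simp add: o_def)
  have uQ: "uniform_limit {a..b} (\<lambda>n. f (r n)) Q sequentially" for a b
    using conv unfolding C2_loc_converges_def by (meson compact_Icc)
  have ptQ: "(\<lambda>n. f (r n) t) \<longlonglongrightarrow> Q t" for t
    using tendsto_uniform_limitI[OF uQ[of t t], of t] by auto
  have uV: "uniform_limit {a..b} (\<lambda>n t. V (f (r n) t)) (\<lambda>t. V (Q t)) sequentially" for a b
  proof (rule uniform_limit_compose_uniformly_continuous_on[OF uQ, where B="cball 0 R"])
    show "uniformly_continuous_on (cball 0 R) V"
      by (intro compact_uniformly_continuous contV) auto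
  qed (use R in auto)
  have n0: "norm (f (r n) 0) = 1/3" for n using f unfolding connecting_orbit_def by blast
  from tendsto_norm[OF ptQ[of 0]] have "(\<lambda>n. 1/3) \<longlonglongrightarrow> norm (Q 0)" unfolding n0 .
  then have Q0: "norm (Q 0) = 1/3" by (simp add: LIMSEQ_const_iff)
  \<comment> \<open>A solution meeting the lattice would rest there, and the normalisation \<bar>Q
    0\<bar> = 1/3 survives in the limit and excludes this.\<close>
  have avoid: "Q t \<notin> int_lattice" for t
  proof
    assume "Q t \<in> int_lattice"
    then have "Q 0 \<in> int_lattice" using zero_energy_avoids_lattice[OF NQ, of t 0] by simp
    then have "Q 0 = 0" using Q0 int_lattice_0 by (intro int_lattice_separated) auto
    then show False using Q0 by simp
  qed
  \<comment> \<open>V(Q) has a positive minimum on {a..b} while the levels tend to 0. This makes the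
    conditional clauses of \<open>connecting_orbit\<close> available on every compact interval for
    all large n.\<close>
  have nohit: "\<forall>\<^sub>F n in sequentially. \<forall>x\<in>{a..b}. V (f (r n) x) \<noteq> c (r n)" if ab: "a \<le> b" for a b
  proof -
    obtain x0 where x0: "x0 \<in> {a..b}" "\<And>x. x \<in> {a..b} \<Longrightarrow> V (Q x0) \<le> V (Q x)"
      using continuous_attains_inf[OF compact_Icc _ cVQ, of a b] ab by auto
    define \<kappa> where "\<kappa> = V (Q x0)"
    have \<kappa>: "\<kappa> > 0" using avoid[of x0] zero[of "Q x0"] nonneg[of "Q x0"] by (auto simp: \<kappa>_def less_le)
    then have "\<kappa> / 2 > 0" by simp
    from uniform_limitD[OF uV this, of a b] order_tendstoD(2)[OF cr this]
    show ?thesis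
    proof eventually_elim
      case (elim n)
      show ?case
      proof
        fix x assume x: "x \<in> {a..b}"
        then have "\<bar>V (f (r n) x) - V (Q x)\<bar> < \<kappa> / 2" using elim by (auto simp: dist_real_def)
        moreover have "c (r n) < \<kappa> / 2" "\<kappa> \<le> V (Q x)" using elim x0(2)[OF x] by (simp_all add: \<kappa>_def)
        ultimately show "V (f (r n) x) \<noteq> c (r n)" by linarith
      qed
    qed
  qed
  have int: "integral {a..b} (\<lambda>t. V (Q t)) \<le> K" if ab: "a \<le> b"
    and ev: "\<forall>\<^sub>F n in sequentially. integral {a..b} (\<lambda>x. V (f (r n) x) - c (r n)) \<le> K" for a b
  proof (rule field_le_epsilon)
    fix e :: real assume e: "e > 0"
    \<comment> \<open>Two errors of size e', one from uniform convergence and one from the level c,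
      are integrated over length b - a; the summand 1 avoids division by zero.\<close>
    define e' where "e' = e / (2 * (b - a + 1))"
    have e': "e' > 0" "2 * e' * (b - a) \<le> e" using e ab by (auto simp: e'_def field_simps)
    have "\<forall>\<^sub>F n in sequentially. integral {a..b} (\<lambda>t. V (Q t)) \<le> K + e"
      using uniform_limitD[OF uV e'(1), of a b] order_tendstoD(2)[OF cr e'(1)] ev
    proof eventually_elim
      case (elim n)
      have cf: "continuous_on {a..b} (\<lambda>x. V (f (r n) x))"
      proof -
        have "(f (r n) has_vector_derivative velocity (f (r n)) t) (at t)" for t
          using N by (simp add: newton_energy_at_def)
        then have "continuous_on {a..b} (f (r n))"
          using has_vector_derivative_continuous by (blast intro: continuous_at_imp_continuous_on)
        then show ?thesis by (intro continuous_on_compose2[OF contV]) auto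
      qed
      have "integral {a..b} (\<lambda>t. V (Q t)) \<le> integral {a..b} (\<lambda>x. (V (f (r n) x) - c (r n)) + 2 * e')"
      proof (rule integral_le)
        show "(\<lambda>t. V (Q t)) integrable_on {a..b}" by (rule integrable_continuous_real[OF cVQ])
        show "(\<lambda>x. (V (f (r n) x) - c (r n)) + 2 * e') integrable_on {a..b}"
          by (intro integrable_continuous_real continuous_intros cf)
        fix x assume "x \<in> {a..b}"
        then have "\<bar>V (f (r n) x) - V (Q x)\<bar> < e'" using elim by (auto simp: dist_real_def)
        then show "V (Q x) \<le> (V (f (r n) x) - c (r n)) + 2 * e'" using elim by linarith
      qed
      also have "\<dots> = integral {a..b} (\<lambda>x. V (f (r n) x) - c (r n)) + 2 * e' * (b - a)"
        using ab by (subst integral_add) (auto intro!: integrable_continuous_real continuous_intros cf)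
      finally show ?case using elim e' by linarith
    qed
    then show "integral {a..b} (\<lambda>t. V (Q t)) \<le> K + e" by (simp add: eventually_happens')
  qed
  obtain V1 G1 where V1: "\<And>x. norm x \<le> R \<Longrightarrow> V x \<le> V1" and G1: "\<And>x. norm x \<le> R \<Longrightarrow> norm (gradV x) \<le> G1"
  proof -
    have "bounded (V ` cball 0 R)" "bounded (gradV ` cball 0 R)"
      by (intro compact_imp_bounded compact_continuous_image contV continuous_on_subset[OF contg]; simp)+
    then obtain V1 G1 where V1: "\<And>x. x \<in> cball 0 R \<Longrightarrow> norm (V x) \<le> V1" and G1: "\<And>x. x \<in> cball 0 R \<Longrightarrow> norm (gradV x) \<le> G1"
      by (metis bounded_iff imageI)
    show ?thesis
    proof (rule that[of V1 G1])
      show "V x \<le> V1" if "norm x \<le> R" for x using V1[of x] that by simp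
      show "norm (gradV x) \<le> G1" if "norm x \<le> R" for x using G1[of x] that by simp
    qed
  qed
  define \<Lambda> where "\<Lambda> = G1 * sqrt (2 * V1) + 1"
  have G0: "G1 \<ge> 0" using order_trans[OF norm_ge_zero G1[OF QR[of 0]]] .
  have vB: "norm (velocity Q t) \<le> sqrt (2 * V1)" for t
    using E[of t] V1[OF QR[of t]] by (intro real_le_rsqrt) linarith
  have S0: "sqrt (2 * V1) \<ge> 0" using order_trans[OF norm_ge_zero vB[of 0]] .
  have L: "\<bar>V (Q s) - V (Q t)\<bar> \<le> \<Lambda> * \<bar>s - t\<bar>" for s t
  proof -
    have "norm (V (Q s) - V (Q t)) \<le> \<Lambda> * \<bar>s - t\<bar>"
    proof (rule vector_derivative_bounded_imp_lipschitz[where f'="\<lambda>t. velocity Q t \<bullet> gradV (Q t)"])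
      fix t
      have q: "(Q has_derivative (\<lambda>s. s *\<^sub>R velocity Q t)) (at t)" using D by (simp add: has_vector_derivative_def)
      have "(V has_derivative (\<lambda>u. u \<bullet> gradV (Q t))) (at (Q t))" using grad unfolding gderiv_def .
      from has_derivative_compose[OF q this]
      show "((\<lambda>t. V (Q t)) has_vector_derivative velocity Q t \<bullet> gradV (Q t)) (at t)"
        by (simp add: has_vector_derivative_def)
      have "\<bar>velocity Q t \<bullet> gradV (Q t)\<bar> \<le> norm (velocity Q t) * norm (gradV (Q t))"
        by (rule Cauchy_Schwarz_ineq2)
      also have "\<dots> \<le> sqrt (2 * V1) * G1" using vB G1[OF QR] S0 by (intro mult_mono) auto
      finally show "norm (velocity Q t \<bullet> gradV (Q t)) \<le> \<Lambda>" by (simp add: \<Lambda>_def mult.commute)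
    qed
    then show ?thesis by simp
  qed
  have L0: "\<Lambda> > 0" using G0 S0 by (simp add: \<Lambda>_def add_nonneg_pos)
  have V_top: "((\<lambda>t. V (Q t)) \<longlongrightarrow> 0) at_top"
  proof (rule lipschitz_integrable_tendsto_0[OF nonneg L0 L])
    fix T :: real assume T: "T \<ge> 0"
    show "integral {0..T} (\<lambda>t. V (Q t)) \<le> K"
    proof (rule int[OF T])
      show "\<forall>\<^sub>F n in sequentially. integral {0..T} (\<lambda>x. V (f (r n) x) - c (r n)) \<le> K"
        using nohit[OF T]
      proof eventually_elim
        case (elim n)
        then show ?case using f[of "r n"] T unfolding connecting_orbit_def by blast
      qed
    qed
  qed
  have V_bot: "((\<lambda>t. V (Q (- t))) \<longlongrightarrow> 0) at_top"
  proof (rule lipschitz_integrable_tendsto_0[OF nonneg L0])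
    show "\<bar>V (Q (- s)) - V (Q (- t))\<bar> \<le> \<Lambda> * \<bar>s - t\<bar>" for s t
      using L[of "-s" "-t"] by (simp add: abs_minus_commute)
    fix T :: real assume T: "T \<ge> 0"
    have "integral {0..T} (\<lambda>t. V (Q (- t))) = integral {-T..0} (\<lambda>t. V (Q t))"
      using Henstock_Kurzweil_Integration.integral_reflect_real[of 0 "-T" "\<lambda>t. V (Q t)"] by simp
    also have "\<dots> \<le> K"
    proof (rule int)
      show "-T \<le> 0" using T by simp
      show "\<forall>\<^sub>F n in sequentially. integral {-T..0} (\<lambda>x. V (f (r n) x) - c (r n)) \<le> K"
        using nohit[OF \<open>-T \<le> 0\<close>]
      proof eventually_elim
        case (elim n)
        then show ?case using f[of "r n"] \<open>-T \<le> 0\<close> unfolding connecting_orbit_def by blast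
      qed
    qed
    finally show "integral {0..T} (\<lambda>t. V (Q (- t))) \<le> K" .
  qed
  have near: "\<forall>\<^sub>F n in sequentially. norm (f (r n) t - x) \<le> d" if "norm (Q t - x) < d" for t x
  proof -
    have "(\<lambda>n. norm (f (r n) t - x)) \<longlonglongrightarrow> norm (Q t - x)" by (intro tendsto_intros ptQ)
    from order_tendstoD(2)[OF this that] show ?thesis by (rule eventually_mono) simp
  qed
  have top: "(Q \<longlongrightarrow> \<zeta>) at_top"
  proof -
    \<comment> \<open>The limit is identified at a single time t where Q is close to x. The
      resulting equation with \<zeta> does not contain n, so one large n proves it.\<close>
    obtain x where x: "x \<in> int_lattice" "(Q \<longlongrightarrow> x) at_top" using tendsto_lattice_point[OF cQ V_top] .
    have "\<forall>\<^sub>F t in at_top. dist (Q t) x < d \<and> t \<ge> 0"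
      by (intro eventually_conj tendstoD[OF x(2) d] eventually_ge_at_top)
    then obtain t where t: "norm (Q t - x) < d" "t \<ge> 0"
      unfolding dist_norm using eventually_happens'[OF trivial_limit_at_top_linorder] by blast
    have "\<forall>\<^sub>F n in sequentially. x = \<zeta>"
      using near[OF t(1)] nohit[OF t(2)]
    proof eventually_elim
      case (elim n)
      then show ?case using f[of "r n"] t(2) x(1) unfolding connecting_orbit_def by blast
    qed
    then show ?thesis using x(2) by (simp add: eventually_const_iff)
  qed
  have bot: "(Q \<longlongrightarrow> 0) at_bot"
  proof -
    have "continuous_on UNIV (\<lambda>t. Q (- t))"
      by (rule continuous_on_compose2[OF cQ]) (auto intro!: continuous_intros)
    then obtain x where x: "x \<in> int_lattice" "((\<lambda>t. Q (- t)) \<longlongrightarrow> x) at_top" using tendsto_lattice_point[OF _ V_bot] by blast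
    have "\<forall>\<^sub>F t in at_top. dist (Q (- t)) x < d \<and> t \<ge> 0"
      by (intro eventually_conj tendstoD[OF x(2) d] eventually_ge_at_top)
    then obtain t where t: "norm (Q (- t) - x) < d" "t \<ge> 0"
      unfolding dist_norm using eventually_happens'[OF trivial_limit_at_top_linorder] by blast
    then have t0: "- t \<le> 0" by simp
    have "\<forall>\<^sub>F n in sequentially. x = 0"
      using near[OF t(1)] nohit[OF t0]
    proof eventually_elim
      case (elim n)
      then show ?case using f[of "r n"] t0 x(1) unfolding connecting_orbit_def by blast
    qed
    then show ?thesis using x(2) by (simp add: eventually_const_iff filterlim_at_bot_mirror)
  qed
  have vel: "(velocity Q \<longlongrightarrow> 0) F" if "((\<lambda>t. V (Q t)) \<longlongrightarrow> 0) F" for F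
  proof (rule Lim_null_comparison)
    have "norm (velocity Q t) = sqrt (2 * V (Q t))" for t
      using E[of t] by (intro real_sqrt_unique[symmetric]) auto
    then show "\<forall>\<^sub>F t in F. norm (velocity Q t) \<le> sqrt (2 * V (Q t))" by simp
    have "((\<lambda>t. sqrt (2 * V (Q t))) \<longlongrightarrow> sqrt (2 * 0)) F" by (intro tendsto_real_sqrt tendsto_mult tendsto_const that)
    then show "((\<lambda>t. sqrt (2 * V (Q t))) \<longlongrightarrow> 0) F" by simp
  qed
  have "((\<lambda>t. V (Q t)) \<longlongrightarrow> 0) at_bot" using V_bot by (simp add: filterlim_at_bot_mirror)
  then have "heteroclinic 0 \<zeta> Q" unfolding heteroclinic_def using top bot vel V_top by blast
  then show ?thesis using that r conv newton_energy_at_imp_solution[OF NQ contg] by blast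
qed

end

subsection \<open>The inductive construction\<close>

lemma finite_int_lattice_bounded: "finite {x :: real ^ 'n. x \<in> int_lattice \<and> norm x \<le> r}"
proof -
  define D where "D = {-\<lceil>r\<rceil>..\<lceil>r\<rceil>}"
  define G where "G = (\<lambda>k :: 'n \<Rightarrow> int. (\<chi> i. real_of_int (k i)) :: real ^ 'n) ` (UNIV \<rightarrow>\<^sub>E D)"
  have "finite G" unfolding G_def D_def by (intro finite_imageI finite_PiE) auto
  moreover have "x \<in> G" if x: "x \<in> int_lattice" "norm x \<le> r" for x :: "real ^ 'n"
  proof -
    define k where "k i = \<lfloor>x $ i\<rfloor>" for i
    have k: "real_of_int (k i) = x $ i" for i
      using x(1) by (auto simp: int_lattice_def k_def elim!: Ints_cases dest: spec[of _ i])
    have "k i \<in> D" for i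
    proof -
      have "\<bar>real_of_int (k i)\<bar> \<le> r" using component_le_norm_cart[of x i] x(2) unfolding k by linarith
      then show ?thesis unfolding D_def by (auto simp: abs_le_iff) linarith+
    qed
    moreover have "x = (\<chi> i. real_of_int (k i))" by (simp add: k vec_eq_iff)
    ultimately show ?thesis unfolding G_def by (intro image_eqI[where x=k]) auto
  qed
  ultimately show ?thesis using finite_subset[of "{x. x \<in> int_lattice \<and> norm x \<le> r}" G] by blast
qed

lemma C2_loc_converges_subseq:
  assumes C: "C2_loc_converges f g" and h: "strict_mono h"
  shows "C2_loc_converges (\<lambda>n. f (h n)) g"
proof -
  have u: "uniform_limit K (\<lambda>n. F (h n)) G sequentially" if "uniform_limit K F G sequentially"
    for K and F :: "nat \<Rightarrow> real \<Rightarrow> 'a" and G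
    using that filterlim_compose[OF _ filterlim_subseq[OF h]] by blast
  show ?thesis
    unfolding C2_loc_converges_def
  proof (intro conjI allI impI)
    fix K :: "real set" assume K: "compact K"
    show "uniform_limit K (\<lambda>n. f (h n)) g sequentially"
      using C K unfolding C2_loc_converges_def by (intro u) blast
    show "uniform_limit K (\<lambda>n. velocity (f (h n))) (velocity g) sequentially"
      using C K unfolding C2_loc_converges_def by (intro u[where F="\<lambda>n. velocity (f n)"]) blast
    show "uniform_limit K (\<lambda>n. velocity (velocity (f (h n)))) (velocity (velocity g)) sequentially"
      using C K unfolding C2_loc_converges_def by (intro u[where F="\<lambda>n. velocity (velocity (f n))"]) blast
  qed (use C in \<open>auto simp: C2_loc_converges_def\<close>)
qed

text \<open>The sets \<open>sublevel_at\<close> lie in balls of radius 1/3, so both endpoints are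
  within 2/3 < 1 of the curve, however large the admissible c is.\<close>

lemma (in lattice_minimizer) endpoint_bound:
  assumes "\<And>t. norm (p t) \<le> R"
  shows "norm \<eta> \<le> R + 1" "norm \<theta> \<le> R + 1"
proof -
  obtain s where s: "s \<in> I" using I_nonempty by blast
  have b: "sublevel_at V c z \<subseteq> ball z ((2/3) / 2)" for z by (auto simp: sublevel_at_def)
  obtain t where "norm (p t - \<eta>) < 2/3" using near_start[OF b _ s] by auto
  then show "norm \<eta> \<le> R + 1" using norm_triangle_ineq4[of "p t" "p t - \<eta>"] assms[of t] by simp
  obtain t where "norm (p t - \<theta>) < 2/3" using near_end[OF b _ s] by auto
  then show "norm \<theta> \<le> R + 1" using norm_triangle_ineq4[of "p t" "p t - \<theta>"] assms[of t] by simp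
qed

context periodic_well
begin

lemma construction_step_minimizer:
  assumes step: "construction_step V Rp c \<xi> j \<zeta> u" and c: "0 < c" "c < cp"
    and H: "lattice_span \<xi> j \<subseteq> int_lattice" "lattice_span \<xi> j \<noteq> int_lattice"
  obtains q p \<eta> \<theta> where "lattice_minimizer V gradV cp c (lattice_span \<xi> j) q p \<eta> \<theta>"
    "\<zeta> = \<theta> - \<eta>" "u = (\<lambda>t. p t - \<eta>)" "\<And>t. norm (p t) \<le> Rp + 1"
    "min_action V c (\<Union>\<eta>\<in>lattice_span \<xi> j. sublevel_at V c \<eta>)
       (\<Union>\<eta>\<in>int_lattice - lattice_span \<xi> j. sublevel_at V c \<eta>) \<le> ennreal (M_p V)"
proof -
  define A where "A = (\<Union>\<eta>\<in>lattice_span \<xi> j. sublevel_at V c \<eta>)"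
  define B where "B = (\<Union>\<eta>\<in>int_lattice - lattice_span \<xi> j. sublevel_at V c \<eta>)"
  obtain q p \<eta> \<theta> where q: "q \<in> minimizers V c (Rp + 1) A B" and sol: "minimization_solution A B q p"
    and \<eta>: "\<eta> \<in> lattice_span \<xi> j" and \<theta>: "\<theta> \<in> int_lattice - lattice_span \<xi> j"
    and lim: "((\<lambda>t. infdist (p t) (sublevel_at V c \<eta>)) \<longlongrightarrow> 0) (right_of (alpha_time A q))"
      "((\<lambda>t. infdist (p t) (sublevel_at V c \<theta>)) \<longlongrightarrow> 0) (left_of (omega_time A B q))"
    and \<zeta>: "\<zeta> = \<theta> - \<eta>" "u = (\<lambda>t. p t - \<eta>)"
    using step unfolding construction_step_def Let_def V_minus_def V_plus_def A_def[symmetric] B_def[symmetric]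
    by blast
  obtain i where "axis i 1 \<notin> lattice_span \<xi> j" using lattice_span_misses_axis[OF H] .
  then have M: "min_action V c A B \<le> ennreal (M_p V)"
    unfolding A_def B_def using c H(1) lattice_span_0 by (intro min_action_le_M_p) auto
  interpret decomposition V c A B
    unfolding A_def B_def using decomposition_lattice[OF H(1)] c by simp
  interpret reflected_minimizer V c A B gradV q p
  proof
    show "min_action V c A B < \<infinity>" using M by (rule order_le_less_trans) simp
  qed (use q sol grad contg in \<open>auto simp: minimizers_def\<close>)
  have "lattice_minimizer V gradV cp c (lattice_span \<xi> j) q p \<eta> \<theta>"
    using reflected_minimizer_axioms periodic_well_axioms H(1) c \<eta> \<theta> lim
    unfolding lattice_minimizer_def lattice_minimizer_axioms_def A_def B_def by simp
  moreover have "norm (p t) \<le> Rp + 1" for t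
    using p_in_range[of t] q by (auto simp: minimizers_def)
  ultimately show ?thesis using that \<zeta> M unfolding A_def B_def by blast
qed

text \<open>The scale \<open>d\<close> at which passing a lattice point costs less than crossing the annulus
  between the spheres of radius \<open>1/6\<close> and \<open>1/3\<close> around it.\<close>

lemma scales_exist:
  obtains \<beta> d e \<gamma> where "\<And>x. V x < \<beta> \<Longrightarrow> \<exists>z\<in>int_lattice. norm (x - z) < 1/6" "\<beta> > 0"
    "0 < d" "d \<le> 1/6" "\<And>z x. z \<in> int_lattice \<Longrightarrow> norm (x - z) \<le> d \<Longrightarrow> V x \<le> e"
    "d\<^sup>2 + 2 * e < sqrt \<beta> / 6" "\<gamma> > 0"
    "\<And>c z. c < \<gamma> \<Longrightarrow> z \<in> int_lattice \<Longrightarrow> sublevel_at V c z \<subseteq> ball z (d/2)"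
proof -
  obtain \<beta> where \<beta>: "\<beta> > 0" "\<And>x. V x < \<beta> \<Longrightarrow> \<exists>z\<in>int_lattice. norm (x - z) < 1/6" using well[of "1/6"] by auto
  define \<mu> where "\<mu> = sqrt \<beta> / 6"
  have \<mu>: "\<mu> > 0" using \<beta> by (simp add: \<mu>_def)
  have "V 0 = 0" using zero[of 0] int_lattice_0 by simp
  moreover have "isCont V 0" using contV[of UNIV] by (simp add: continuous_on_eq_continuous_at)
  ultimately obtain d0 where d0: "d0 > 0" "\<And>x. dist x 0 < d0 \<Longrightarrow> dist (V x) 0 < \<mu> / 4"
    using \<mu> unfolding continuous_at_eps_delta by (metis divide_pos_pos zero_less_numeral)
  \<comment> \<open>With \<mu> the cost of one crossing and e = \<mu>/4, the bounds d \<le> 1 and d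
    \<le> \<mu>/4 give d^2 + 2e \<le> 3\<mu>/4 < \<mu>.\<close>
  define d where "d = min (d0 / 2) (min (1/6) (\<mu> / 4))"
  have d: "0 < d" "d \<le> 1/6" "d < d0" "d \<le> \<mu> / 4" using d0 \<mu> by (auto simp: d_def)
  obtain \<gamma> where \<gamma>: "\<gamma> > 0" "\<And>x. V x < \<gamma> \<Longrightarrow> \<exists>z\<in>int_lattice. norm (x - z) < d / 2" using well[of "d/2"] d by auto
  have Ve: "V x \<le> \<mu> / 4" if "z \<in> int_lattice" "norm (x - z) \<le> d" for x z
    using d0(2)[of "x - z"] that d per_diff[OF that(1), of x] by (simp add: dist_real_def)
  have "d\<^sup>2 + 2 * (\<mu> / 4) < sqrt \<beta> / 6"
  proof -
    have "d * d \<le> 1 * (\<mu> / 4)" using d by (intro mult_mono) auto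
    then show ?thesis using \<mu> by (simp add: power2_eq_square \<mu>_def[symmetric])
  qed
  then show ?thesis
    using that[of \<beta> d "\<mu> / 4" \<gamma>] \<beta> d Ve \<gamma> sublevel_at_subset_ball[of \<gamma> "d/2"] by auto
qed

end

section \<open>The generators and orbits of a complete run\<close>

context periodic_well
begin

lemma construction_lattice:
  assumes con: "construction V Rp c k \<xi> u" and c: "0 < c" "c < cp"
  shows "j \<le> k \<Longrightarrow> i \<in> {1..j} \<Longrightarrow> \<xi> i \<in> int_lattice"
proof (induction j arbitrary: i)
  case (Suc j)
  then have IH: "\<And>i. i \<in> {1..j} \<Longrightarrow> \<xi> i \<in> int_lattice" by simp
  have H: "lattice_span \<xi> j \<subseteq> int_lattice" by (rule lattice_span_subset[OF IH])
  show ?case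
  proof (cases "i = Suc j")
    case True
    have "construction_step V Rp c \<xi> j (\<xi> (Suc j)) (u (Suc j))"
      using con Suc.prems(1) by (simp add: construction_def)
    then obtain \<eta> \<theta> where "\<eta> \<in> lattice_span \<xi> j" "\<theta> \<in> int_lattice" "\<xi> (Suc j) = \<theta> - \<eta>"
      unfolding construction_step_def Let_def by blast
    then show ?thesis using True H int_lattice_diff by auto
  qed (use IH Suc.prems in auto)
qed simp

lemma construction_minimizer:
  assumes con: "construction V Rp c k \<xi> u" and c: "0 < c" "c < cp" and j: "j < k"
  obtains q p \<eta> \<theta> where "lattice_minimizer V gradV cp c (lattice_span \<xi> j) q p \<eta> \<theta>"
    "\<xi> (Suc j) = \<theta> - \<eta>" "u (Suc j) = (\<lambda>t. p t - \<eta>)" "\<And>t. norm (p t) \<le> Rp + 1"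
    "min_action V c (\<Union>\<eta>\<in>lattice_span \<xi> j. sublevel_at V c \<eta>)
       (\<Union>\<eta>\<in>int_lattice - lattice_span \<xi> j. sublevel_at V c \<eta>) \<le> ennreal (M_p V)"
proof (rule construction_step_minimizer)
  show "construction_step V Rp c \<xi> j (\<xi> (Suc j)) (u (Suc j))" "lattice_span \<xi> j \<noteq> int_lattice"
    using con j by (auto simp: construction_def)
  show "lattice_span \<xi> j \<subseteq> int_lattice"
    using construction_lattice[OF con c, of j] j by (intro lattice_span_subset) auto
qed (use c that in blast)+

text \<open>The radius 2 * (Rp + 2) is that of a difference of two vectors of norm at most Rp + 2:
  the two endpoints, or a point of the orbit and its starting lattice point.\<close>

lemma construction_generator:
  assumes con: "construction V Rp c k \<xi> u" and c: "0 < c" "c < cp" and j: "j < k"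
  shows "\<xi> (Suc j) \<notin> lattice_span \<xi> j" "norm (\<xi> (Suc j)) \<le> 2 * (Rp + 2)" "norm (u (Suc j) t) \<le> 2 * (Rp + 2)"
proof -
  obtain q p \<eta> \<theta> where m: "lattice_minimizer V gradV cp c (lattice_span \<xi> j) q p \<eta> \<theta>"
    and \<xi>: "\<xi> (Suc j) = \<theta> - \<eta>" "u (Suc j) = (\<lambda>t. p t - \<eta>)" and p: "\<And>t. norm (p t) \<le> Rp + 1"
    using construction_minimizer[OF con c j] by metis
  interpret lattice_minimizer V gradV cp c "lattice_span \<xi> j" q p \<eta> \<theta> by (rule m)
  note b = endpoint_bound[of "Rp + 1", OF p]
  show "norm (\<xi> (Suc j)) \<le> 2 * (Rp + 2)" unfolding \<xi> using norm_triangle_ineq4[of \<theta> \<eta>] b by simp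
  show "norm (u (Suc j) t) \<le> 2 * (Rp + 2)" unfolding \<xi> using norm_triangle_ineq4[of "p t" \<eta>] b p[of t] by simp
  show "\<xi> (Suc j) \<notin> lattice_span \<xi> j"
  proof
    assume "\<xi> (Suc j) \<in> lattice_span \<xi> j"
    then have "(\<theta> - \<eta>) + \<eta> \<in> lattice_span \<xi> j" unfolding \<xi> using \<eta> by (rule lattice_span_add)
    then show False using \<theta> by simp
  qed
qed

text \<open>Each generator avoids the span of its predecessors, which contains them and 0; hence the
  generators are distinct and nonzero.\<close>

lemma construction_generators:
  assumes con: "construction V Rp c k \<xi> u" and c: "0 < c" "c < cp"
  shows "inj_on \<xi> {1..k}" "\<xi> ` {1..k} \<subseteq> int_lattice - {0}"
    "\<xi> ` {1..k} \<subseteq> {x. x \<in> int_lattice \<and> norm x \<le> 2 * (Rp + 2)}"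
proof -
  have new: "\<xi> i \<notin> lattice_span \<xi> (i - 1)" "norm (\<xi> i) \<le> 2 * (Rp + 2)" if "i \<in> {1..k}" for i
  proof -
    have i: "i - 1 < k" "Suc (i - 1) = i" using that by auto
    show "\<xi> i \<notin> lattice_span \<xi> (i - 1)" "norm (\<xi> i) \<le> 2 * (Rp + 2)"
      using construction_generator(1,2)[OF con c i(1)] unfolding i(2) by auto
  qed
  have ne: "\<xi> i \<noteq> \<xi> j" if "i \<in> {1..k}" "j \<in> {1..k}" "i < j" for i j
  proof -
    have "i \<in> {1..j - 1}" using that by auto
    then have "\<xi> i \<in> lattice_span \<xi> (j - 1)" by (rule lattice_span_generator)
    then show ?thesis using new(1)[OF that(2)] by auto
  qed
  then show "inj_on \<xi> {1..k}" by (intro inj_onI) (metis linorder_neqE_nat)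
  have l: "\<xi> i \<in> int_lattice" if "i \<in> {1..k}" for i using construction_lattice[OF con c order_refl that] .
  show "\<xi> ` {1..k} \<subseteq> int_lattice - {0}"
  proof
    fix x assume "x \<in> \<xi> ` {1..k}"
    then obtain i where i: "i \<in> {1..k}" "x = \<xi> i" by blast
    then show "x \<in> int_lattice - {0}"
      using new(1)[OF i(1)] l[OF i(1)] lattice_span_0[of \<xi> "i - 1"] by auto
  qed
  show "\<xi> ` {1..k} \<subseteq> {x. x \<in> int_lattice \<and> norm x \<le> 2 * (Rp + 2)}" using new(2) l by blast
qed

lemma construction_connecting_orbit:
  assumes con: "construction V Rp c k \<xi> u" and c: "0 < c" "c < cp" and j: "j < k"
    and \<beta>: "\<And>x. V x < \<beta> \<Longrightarrow> \<exists>z\<in>int_lattice. norm (x - z) < 1/6" "\<beta> > 0" "c \<le> \<beta> / 2"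
    and d: "0 < d" "d \<le> 1/6" "\<And>z x. z \<in> int_lattice \<Longrightarrow> norm (x - z) \<le> d \<Longrightarrow> V x \<le> e"
    and cheap: "d\<^sup>2 + 2 * e < sqrt \<beta> / 6"
    and small: "\<And>z. z \<in> int_lattice \<Longrightarrow> sublevel_at V c z \<subseteq> ball z (d/2)"
  shows "\<exists>s. connecting_orbit V gradV (M_p V) d c (\<xi> (Suc j)) (\<lambda>t. u (Suc j) (t + s))"
proof -
  obtain q p \<eta> \<theta> where m: "lattice_minimizer V gradV cp c (lattice_span \<xi> j) q p \<eta> \<theta>"
    and \<xi>: "\<xi> (Suc j) = \<theta> - \<eta>" "u (Suc j) = (\<lambda>t. p t - \<eta>)"
    and M: "min_action V c (\<Union>\<eta>\<in>lattice_span \<xi> j. sublevel_at V c \<eta>)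
       (\<Union>\<eta>\<in>int_lattice - lattice_span \<xi> j. sublevel_at V c \<eta>) \<le> ennreal (M_p V)"
    using construction_minimizer[OF con c j] by metis
  interpret lattice_minimizer V gradV cp c "lattice_span \<xi> j" q p \<eta> \<theta> by (rule m)
  have M0: "M_p V \<ge> 0" using M_p_bound[of 0] nonneg[of 0] by simp
  have grp: "x + \<eta> \<in> lattice_span \<xi> j \<longleftrightarrow> x \<in> lattice_span \<xi> j" for x
    using lattice_span_add[of x \<xi> j \<eta>] lattice_span_diff[of "x + \<eta>" \<xi> j \<eta>] \<eta> by auto
  show ?thesis unfolding \<xi>
    by (rule connecting_orbit_exists[OF \<beta> d cheap small M M0 grp]; (assumption | blast))
qed

end

section \<open>Extraction of the common subsequence\<close>

theorem proposition3p12: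
  fixes V :: "real ^ 'n \<Rightarrow> real" and gradV :: "real ^ 'n \<Rightarrow> real ^ 'n"
    and cp Rp :: real and c :: "nat \<Rightarrow> real"
    and k :: "nat \<Rightarrow> nat" and \<xi> :: "nat \<Rightarrow> nat \<Rightarrow> real ^ 'n"
    and q :: "nat \<Rightarrow> nat \<Rightarrow> real \<Rightarrow> real ^ 'n"
  assumes "CARD('n) \<ge> 2"
    and "\<And>x. GDERIV V x :> gradV x" and "continuous_on UNIV gradV"
    and "\<And>x z. z \<in> int_lattice \<Longrightarrow> V (x + z) = V x"
    and "\<And>x. V x \<ge> 0" and "\<And>x. V x = 0 \<longleftrightarrow> x \<in> int_lattice"
    and "\<And>x. \<exists>r>0. \<exists>L. L-lipschitz_on (ball x r) gradV"
    and "admissible_cp V cp" and "admissible_Rp V cp Rp"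
    and "\<And>n. 0 < c n" and "\<And>n. c n < cp" and "c \<longlonglongrightarrow> 0"
    and "\<And>n. construction V Rp (c n) (k n) (\<xi> n) (q n)"
  shows "\<exists>r :: nat \<Rightarrow> nat. strict_mono r \<and>
    (\<exists>\<kappa>. (\<forall>n. k (r n) = \<kappa>) \<and>
      (\<exists>\<xi>h. inj_on \<xi>h {1..\<kappa>} \<and> \<xi>h ` {1..\<kappa>} \<subseteq> int_lattice - {0} \<and>
        lattice_span \<xi>h \<kappa> = int_lattice \<and>
        (\<forall>n. \<forall>j\<in>{1..\<kappa>}. \<xi> (r n) j = \<xi>h j) \<and>
        (\<forall>j\<in>{1..\<kappa>}. \<exists>Q \<tau>.
           newton_solution gradV Q \<and> heteroclinic 0 (\<xi>h j) Q \<and>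
           C2_loc_converges (\<lambda>n t. q (r n) j (t - \<tau> n)) Q)))"
proof -
  interpret periodic_well V gradV cp by unfold_locales (use assms in auto)
  note cpos = assms(10) and cless = assms(11) and clim = assms(12) and con = assms(13)
  define F where "F = {x :: real ^ 'n. x \<in> int_lattice \<and> norm x \<le> 2 * (Rp + 2)}"
  have finF: "finite F" unfolding F_def by (rule finite_int_lattice_bounded)
  \<comment> \<open>The list of generators encodes their number as well. Its entries are distinct
    members of the finite set F, so only finitely many lists occur and one of them recurs infinitely
    often.\<close>
  define l where "l n = map (\<xi> n) [1..<Suc (k n)]" for n
  have ln: "l n \<in> {xs. set xs \<subseteq> F \<and> length xs \<le> card F}" for n
  proof -
    have sub: "\<xi> n ` {1..k n} \<subseteq> F"
      using construction_generators(3)[OF con cpos cless, of n] by (simp add: F_def)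
    then have "card (\<xi> n ` {1..k n}) \<le> card F" by (rule card_mono[OF finF])
    then have "k n \<le> card F" using construction_generators(1)[OF con cpos cless, of n] by (simp add: card_image)
    moreover have "set (l n) \<subseteq> F" using sub by (simp add: l_def atLeastLessThanSuc_atLeastAtMost del: upt_Suc)
    ultimately show ?thesis by (simp add: l_def)
  qed
  have "finite (range l)"
    by (rule finite_subset[OF _ finite_lists_length_le[OF finF, of "card F"]]) (use ln in blast)
  then obtain a where "infinite {n. l n = l a}"
    using pigeonhole_infinite[of UNIV l] by auto
  then obtain r0 :: "nat \<Rightarrow> nat" where r0: "strict_mono r0" "\<And>n. l (r0 n) = l a"
    using strict_mono_enumerate enumerate_in_set by blast
  define \<kappa> where "\<kappa> = k a"
  define \<xi>h where "\<xi>h = \<xi> a"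
  have kr: "k (r0 n) = \<kappa>" for n
    using arg_cong[OF r0(2)[of n], of length] by (simp add: l_def \<kappa>_def del: upt_Suc)
  have \<xi>r: "\<xi> (r0 n) j = \<xi>h j" if j: "j \<in> {1..\<kappa>}" for n j
  proof -
    obtain i where i: "j = Suc i" "i < \<kappa>" using j by (cases j) auto
    have "l m ! i = \<xi> m j" if "k m = \<kappa>" for m
      using i that by (simp add: l_def del: upt_Suc)
    then show ?thesis using r0(2)[of n] kr[of n] by (metis \<kappa>_def \<xi>h_def)
  qed
  have cr0: "(\<lambda>n. c (r0 n)) \<longlonglongrightarrow> 0" using LIMSEQ_subseq_LIMSEQ[OF clim r0(1)] by (simp add: o_def)
  obtain \<beta> d e \<gamma> where \<beta>: "\<And>x. V x < \<beta> \<Longrightarrow> \<exists>z\<in>int_lattice. norm (x - z) < 1/6" "\<beta> > 0"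
    and d: "0 < d" "d \<le> 1/6" "\<And>z x. z \<in> int_lattice \<Longrightarrow> norm (x - z) \<le> d \<Longrightarrow> V x \<le> e"
    and cheap: "d\<^sup>2 + 2 * e < sqrt \<beta> / 6" and \<gamma>: "\<gamma> > 0"
    and small: "\<And>c z. c < \<gamma> \<Longrightarrow> z \<in> int_lattice \<Longrightarrow> sublevel_at V c z \<subseteq> ball z (d/2)"
    using scales_exist by metis
  \<comment> \<open>Since \<kappa> is already fixed, finitely many successive extractions suffice.
    The limits found for smaller j persist along subsequences, once their time shifts are
    reindexed.\<close>
  have "\<exists>r. strict_mono (r :: nat \<Rightarrow> nat) \<and> (\<forall>j\<in>{1..J}. \<exists>Q \<tau>.
      newton_solution gradV Q \<and> heteroclinic 0 (\<xi>h j) Q \<and>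
      C2_loc_converges (\<lambda>n t. q (r0 (r n)) j (t - \<tau> n)) Q)" if "J \<le> \<kappa>" for J
    using that
  proof (induction J)
    case 0
    then show ?case by (intro exI[of _ id]) (simp add: strict_mono_def)
  next
    case (Suc J)
    then obtain r where r: "strict_mono (r :: nat \<Rightarrow> nat)" and old: "\<forall>j\<in>{1..J}. \<exists>Q \<tau>.
      newton_solution gradV Q \<and> heteroclinic 0 (\<xi>h j) Q \<and>
      C2_loc_converges (\<lambda>n t. q (r0 (r n)) j (t - \<tau> n)) Q" by auto
    have clr: "(\<lambda>n. c (r0 (r n))) \<longlonglongrightarrow> 0" using LIMSEQ_subseq_LIMSEQ[OF cr0 r] by (simp add: o_def)
    have "0 < min (\<beta> / 2) \<gamma>" using \<beta> \<gamma> by simp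
    then obtain n0 where n0: "\<And>n. n \<ge> n0 \<Longrightarrow> c (r0 (r n)) < min (\<beta> / 2) \<gamma>"
      using order_tendstoD(2)[OF clr] unfolding eventually_sequentially by blast
    \<comment> \<open>Dropping the first n0 terms makes the smallness of c hold for every index, so
      a time shift exists for each n.\<close>
    define idx where "idx n = r0 (r (n + n0))" for n
    have "\<exists>s. connecting_orbit V gradV (M_p V) d (c (idx n)) (\<xi>h (Suc J)) (\<lambda>t. q (idx n) (Suc J) (t + s))" for n
    proof -
      have cs: "c (idx n) \<le> \<beta> / 2" "c (idx n) < \<gamma>" using n0[of "n + n0"] by (auto simp: idx_def)
      have "J < k (idx n)" using Suc.prems kr by (simp add: idx_def)
      moreover have "\<xi> (idx n) (Suc J) = \<xi>h (Suc J)" using \<xi>r[of "Suc J"] Suc.prems by (simp add: idx_def)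
      ultimately show ?thesis
        using construction_connecting_orbit[OF con cpos cless, of J "idx n" \<beta> d e] \<beta> cs d cheap small[OF cs(2)]
        by simp
    qed
    then obtain s where s: "\<And>n. connecting_orbit V gradV (M_p V) d (c (idx n)) (\<xi>h (Suc J)) (\<lambda>t. q (idx n) (Suc J) (t + s n))"
      by metis
    have ci: "(\<lambda>n. c (idx n)) \<longlonglongrightarrow> 0" unfolding idx_def using clr by (rule LIMSEQ_ignore_initial_segment)
    have bd: "norm (q (idx n) (Suc J) (t + s n)) \<le> 2 * (Rp + 2)" for n t
      using construction_generator(3)[OF con cpos cless, of J "idx n"] Suc.prems kr by (simp add: idx_def)
    have "\<exists>r' Q. strict_mono (r' :: nat \<Rightarrow> nat) \<and> newton_solution gradV Q \<and> heteroclinic 0 (\<xi>h (Suc J)) Q \<and>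
      C2_loc_converges (\<lambda>n t. q (idx (r' n)) (Suc J) (t + s (r' n))) Q"
      by (rule heteroclinic_limit[OF d(1) ci less_imp_le[OF cpos] s bd]) blast
    then obtain r' Q where r': "strict_mono (r' :: nat \<Rightarrow> nat)" and Q: "newton_solution gradV Q" "heteroclinic 0 (\<xi>h (Suc J)) Q"
      "C2_loc_converges (\<lambda>n t. q (idx (r' n)) (Suc J) (t + s (r' n))) Q"
      by blast
    define h where "h n = r' n + n0" for n
    have h: "strict_mono h" using r' by (simp add: h_def strict_mono_def)
    have "\<exists>Q \<tau>. newton_solution gradV Q \<and> heteroclinic 0 (\<xi>h j) Q \<and>
      C2_loc_converges (\<lambda>n t. q (r0 (r (h n))) j (t - \<tau> n)) Q" if j: "j \<in> {1..Suc J}" for j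
    proof (cases "j = Suc J")
      case True
      \<comment> \<open>The normalisation shifts time by + s and the conclusion by - \<tau>, so
        \<tau> = - s.\<close>
      have "C2_loc_converges (\<lambda>n t. q (r0 (r (h n))) (Suc J) (t - - s (r' n))) Q"
        using Q(3) by (simp add: idx_def h_def)
      then show ?thesis
        unfolding True using Q by (intro exI[of _ Q] exI[of _ "\<lambda>n. - s (r' n)"] conjI)
    next
      case False
      then have "j \<in> {1..J}" using j by auto
      then obtain Q \<tau> where o: "newton_solution gradV Q" "heteroclinic 0 (\<xi>h j) Q"
        "C2_loc_converges (\<lambda>n t. q (r0 (r n)) j (t - \<tau> n)) Q" using old by blast
      from C2_loc_converges_subseq[OF o(3) h] o(1,2) show ?thesis
        by (intro exI[of _ Q] exI[of _ "\<lambda>n. \<tau> (h n)"] conjI)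
    qed
    moreover have "strict_mono (\<lambda>n. r (h n))" using strict_mono_o[OF r h] by (simp add: o_def)
    ultimately show ?case by (intro exI[of _ "\<lambda>n. r (h n)"] conjI) auto
  qed
  from this[OF order_refl] obtain r where r: "strict_mono (r :: nat \<Rightarrow> nat)" "\<forall>j\<in>{1..\<kappa>}. \<exists>Q \<tau>.
      newton_solution gradV Q \<and> heteroclinic 0 (\<xi>h j) Q \<and>
      C2_loc_converges (\<lambda>n t. q (r0 (r n)) j (t - \<tau> n)) Q" by blast
  have "strict_mono (\<lambda>n. r0 (r n))" using strict_mono_o[OF r0(1) r(1)] by (simp add: o_def)
  moreover have "inj_on \<xi>h {1..\<kappa>}" "\<xi>h ` {1..\<kappa>} \<subseteq> int_lattice - {0}"
    using construction_generators(1,2)[OF con cpos cless, of a] by (simp_all add: \<xi>h_def \<kappa>_def)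
  moreover have "lattice_span \<xi>h \<kappa> = int_lattice"
    using con[of a] by (simp add: construction_def \<xi>h_def \<kappa>_def)
  ultimately show ?thesis
    using r(2) kr \<xi>r
    by (intro exI[of _ "\<lambda>n. r0 (r n)"] conjI exI[of _ \<kappa>] exI[of _ \<xi>h]) auto
qed

end
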